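(* Let $n\geq 2$. The minimal number of summands appearing in the codimension one decompositions of the generic form of degree $d$ in $n+1$ variables is the expected one, i.e. $s_{\min}(n,d)=s_{\exp}(n,d)$, if and only if either $d=2,3$ (for any $n\ge 2$), or $d=4,5,6$ or $8$ and $n=2$.
   Context: Let $S=\mathbb{C}[X_0,\dots,X_n]$ and $T=\mathbb{C}[\partial_0,\dots,\partial_n]$, with $T$ acting on $S$ by differentiation ($\partial_i$ acts as $\partial/\partial X_i$; the action is written $D\circ f$), and let $S_d$, $T_d$ denote the homogeneous pieces of degree $d$. A form $g\in S_d$ is called a codimension one form if there is a nonzero $L\in T_1$ with $L\circ g=0$. A codimension one decomposition of $f\in S_d$ is a presentation $f=\hat f_1+\dots+\hat f_s$ with all $\hat f_i\in S_d$ codimension one forms. $s_{\min}(n,d)$ denotes the minimal number of summands appearing in the codimension one decompositions of the generic form of degree $d$ in $n+1$ variables, i.e. the smallest $s$ such that all forms in some nonempty Zariski open subset of $\mathbb{P}S_d$ are sums of $s$ codimension one forms. The expected value of $s_{\min}(n,d)$ is $s_{\exp}(n,d)=\left\lceil \frac{1}{n+\binom{d+n-1}{n-1}}\binom{d+n}{n}\right\rceil$.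
   Formalization: The degree is assumed to satisfy d ≥ 2; for d = 0 and d = 1 every form is a codimension one form, so s_min = s_exp = 1 for all n ≥ 2, and the equivalence as stated fails in these two degrees. *)

theory Defs
  imports Complex_Main "HOL-Library.Poly_Mapping"
begin

text \<open>Polynomials with variables of type \<open>'v\<close>: finitely supported maps from exponent vectors
  to coefficients. They carry the ring structure of \<^theory>\<open>HOL-Library.Poly_Mapping\<close>.\<close>

type_synonym ('v, 'a) mpol = "('v \<Rightarrow>\<^sub>0 nat) \<Rightarrow>\<^sub>0 'a"

definition mdeg :: "('v \<Rightarrow>\<^sub>0 nat) \<Rightarrow> nat" where
  "mdeg a = (\<Sum>i\<in>Poly_Mapping.keys a. Poly_Mapping.lookup a i)"

definition monomials :: "'v set \<Rightarrow> nat \<Rightarrow> ('v \<Rightarrow>\<^sub>0 nat) set" where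
  "monomials V d = {a. Poly_Mapping.keys a \<subseteq> V \<and> mdeg a = d}"

definition forms :: "'v set \<Rightarrow> nat \<Rightarrow> ('v, 'a::zero) mpol set" where
  "forms V d = {f. Poly_Mapping.keys f \<subseteq> monomials V d}"

definition eval_mpol :: "('v, 'a::comm_ring_1) mpol \<Rightarrow> ('v \<Rightarrow> 'a) \<Rightarrow> 'a" where
  "eval_mpol F x = (\<Sum>a\<in>Poly_Mapping.keys F. Poly_Mapping.lookup F a *
     (\<Prod>v\<in>Poly_Mapping.keys a. x v ^ Poly_Mapping.lookup a v))"

definition smul :: "'a::comm_ring_1 \<Rightarrow> ('v, 'a) mpol \<Rightarrow> ('v, 'a) mpol" where
  "smul c f = Poly_Mapping.single 0 c * f"


text \<open>\<open>S = T\<close> as rings: variable \<open>i \<le> n\<close> stands for \<open>X\<^sub>i\<close> in \<open>S\<close> and for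
  \<open>\<partial>\<^sub>i\<close> in \<open>T\<close>.\<close>

abbreviation S_piece :: "nat \<Rightarrow> nat \<Rightarrow> (nat, complex) mpol set" where
  "S_piece n d \<equiv> forms {..n} d"

abbreviation T_piece :: "nat \<Rightarrow> nat \<Rightarrow> (nat, complex) mpol set" where
  "T_piece n d \<equiv> forms {..n} d"

text \<open>Exponent vectors are subtracted with truncation, but the truncated terms have coefficient 0.\<close>

definition partial :: "nat \<Rightarrow> (nat, complex) mpol \<Rightarrow> (nat, complex) mpol" where
  "partial i f = (\<Sum>b\<in>Poly_Mapping.keys f.
     Poly_Mapping.single (b - Poly_Mapping.single i 1)
       (of_nat (Poly_Mapping.lookup b i) * Poly_Mapping.lookup f b))"

definition partial_monom :: "(nat \<Rightarrow>\<^sub>0 nat) \<Rightarrow> (nat, complex) mpol \<Rightarrow> (nat, complex) mpol" where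
  "partial_monom a f =
     fold (\<lambda>i. partial i ^^ Poly_Mapping.lookup a i)
       (sorted_list_of_set (Poly_Mapping.keys a)) f"

definition diff_act :: "(nat, complex) mpol \<Rightarrow> (nat, complex) mpol \<Rightarrow> (nat, complex) mpol" where
  "diff_act D f =
     (\<Sum>a\<in>Poly_Mapping.keys D. smul (Poly_Mapping.lookup D a) (partial_monom a f))"

lemma diff_act_variable:
  "diff_act (Poly_Mapping.single (Poly_Mapping.single i 1) 1) f = partial i f"
  by (simp add: diff_act_def partial_monom_def smul_def)


definition codim_one_form :: "nat \<Rightarrow> nat \<Rightarrow> (nat, complex) mpol \<Rightarrow> bool" where
  "codim_one_form n d g \<longleftrightarrow>
     g \<in> S_piece n d \<and> (\<exists>L \<in> T_piece n 1. L \<noteq> 0 \<and> diff_act L g = 0)"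

definition codim_one_decomposition ::
  "nat \<Rightarrow> nat \<Rightarrow> (nat, complex) mpol \<Rightarrow> (nat, complex) mpol list \<Rightarrow> bool" where
  "codim_one_decomposition n d f gs \<longleftrightarrow>
     (\<forall>g \<in> set gs. codim_one_form n d g) \<and> f = sum_list gs"


text \<open>Points of \<open>\<P>S\<^sub>d\<close> are the lines through the origin of \<open>S\<^sub>d\<close>; homogeneous coordinates are the
  coefficients, so polynomials on \<open>\<P>S\<^sub>d\<close> have the degree \<open>d\<close> monomials as variables.\<close>

definition proj_point :: "(nat, complex) mpol \<Rightarrow> (nat, complex) mpol set" where
  "proj_point f = {smul c f | c. True}"

definition proj_forms :: "nat \<Rightarrow> nat \<Rightarrow> (nat, complex) mpol set set" where
  "proj_forms n d = {proj_point f | f. f \<in> S_piece n d \<and> f \<noteq> 0}"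

definition zariski_closed :: "nat \<Rightarrow> nat \<Rightarrow> (nat, complex) mpol set set \<Rightarrow> bool" where
  "zariski_closed n d Z \<longleftrightarrow>
     (\<exists>\<F> :: (nat \<Rightarrow>\<^sub>0 nat, complex) mpol set.
        (\<forall>F\<in>\<F>. \<exists>e. F \<in> forms (monomials {..n} d) e) \<and>
        Z = {p \<in> proj_forms n d. \<forall>F\<in>\<F>. \<forall>f\<in>p. eval_mpol F (Poly_Mapping.lookup f) = 0})"

definition zariski_open :: "nat \<Rightarrow> nat \<Rightarrow> (nat, complex) mpol set set \<Rightarrow> bool" where
  "zariski_open n d U \<longleftrightarrow> U \<subseteq> proj_forms n d \<and> zariski_closed n d (proj_forms n d - U)"

definition s_min :: "nat \<Rightarrow> nat \<Rightarrow> nat" where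
  "s_min n d = (LEAST s. \<exists>U. zariski_open n d U \<and> U \<noteq> {} \<and>
     (\<forall>f \<in> S_piece n d. f \<noteq> 0 \<longrightarrow> proj_point f \<in> U \<longrightarrow>
        (\<exists>gs. length gs = s \<and> codim_one_decomposition n d f gs)))"

definition s_exp :: "nat \<Rightarrow> nat \<Rightarrow> int" where
  "s_exp n d =
     \<lceil>1 / (real n + real ((d + n - 1) choose (n - 1))) * real ((d + n) choose n)\<rceil>"

end

theory Submission
  imports Defs "HOL-Computational_Algebra.Fundamental_Theorem_Algebra" "HOL-Library.FuncSet"
begin

text \<open>A sum of \<open>s\<close> codimension one forms is annihilated by a product \<open>L\<^sub>1 \<cdots> L\<^sub>s\<close> of linear operators,
  which is \<open>(d - s + n choose n)\<close> linear conditions on \<open>f\<close>, while the operators \<open>L\<^sub>i\<close> depend on \<open>n * s\<close>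
  parameters. If \<open>n * s < (d - s + n choose n)\<close>, the forms that can be reached are parametrized by
  fewer parameters than \<open>dim S\<^sub>d\<close>, hence satisfy a polynomial relation. Otherwise the sums
  are dense: their tangent space at a sum of \<open>d\<close>-th powers of \<open>n * s\<close> linear forms in general position
  (on a monomial curve) is all of \<open>S\<^sub>d\<close>, because a functional vanishing on it is
  \<open>L\<^sub>1 \<cdots> L\<^sub>s E\<close> with \<open>E\<close> of degree \<open>d - s\<close> vanishing at \<open>n * s\<close> general points. So \<open>s_min n d\<close> is the
  least \<open>s\<close> with \<open>n * s \<ge> (d - s + n choose n)\<close>, and it remains to compare this with \<open>s_exp n d\<close>.\<close>

text \<open>\<open>s_exp\<close> counts \<open>n + (d+n-1 choose n-1)\<close> parameters per
  summand, as if the spaces of forms killed by \<open>L_1\<close>, ..., \<open>L_s\<close> were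
  independent. They are not: any two share the forms killed by both operators, and together they
  span only the forms killed by the product. This overlap is the defect, and it makes the true
  condition depend on \<open>d - s\<close>. Density of the sums does not suffice, since every form
  in some open set has to be a sum. The tangent computation is therefore turned into an explicit
  polynomial map with as many parameters as coordinates and with the identity as derivative at the
  origin. Its components are algebraically independent, and its image contains the complement of a
  hypersurface because complex points of the ring they generate extend to the whole polynomial ring.
  Genericity of the nodes is replaced by positivity: a real polynomial with \<open>N\<close> terms
  has fewer than \<open>N\<close> positive zeros, so distinct positive parameters on the curve
  impose independent conditions.\<close>

abbreviation "lookup \<equiv> Poly_Mapping.lookup"
abbreviation "keys \<equiv> Poly_Mapping.keys"
abbreviation "single \<equiv> Poly_Mapping.single"

section \<open>Polynomials as functions: substitution, degree, homogeneous components,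
  nonvanishing\<close>

section \<open>Evaluation of polynomials\<close>

definition monom_val :: "('v \<Rightarrow> 'a::comm_ring_1) \<Rightarrow> ('v \<Rightarrow>\<^sub>0 nat) \<Rightarrow> 'a" where
  "monom_val x a = (\<Prod>v\<in>keys a. x v ^ lookup a v)"

lemma keys_add_nat: "keys (a + b) = keys a \<union> keys (b :: 'v \<Rightarrow>\<^sub>0 nat)"
  by (auto simp: in_keys_iff lookup_add)

lemma monom_val_superset:
  assumes "finite A" "keys a \<subseteq> A"
  shows "monom_val x a = (\<Prod>v\<in>A. x v ^ lookup a v)"
  unfolding monom_val_def using assms
  by (intro prod.mono_neutral_left) (auto simp: in_keys_iff)

lemma monom_val_0 [simp]: "monom_val x 0 = 1"
  by (simp add: monom_val_def)

lemma monom_val_single [simp]: "monom_val x (single v 1) = x v"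
  "monom_val x (single v (Suc 0)) = x v"
  by (simp_all add: monom_val_def)

lemma monom_val_add: "monom_val x (a + b) = monom_val x a * monom_val x b"
  by (simp add: monom_val_superset[of "keys a \<union> keys b"] keys_add_nat lookup_add power_add
      prod.distrib)

lemma mdeg_superset:
  assumes "finite A" "keys a \<subseteq> A"
  shows "mdeg a = (\<Sum>v\<in>A. lookup a v)"
  unfolding mdeg_def using assms
  by (intro sum.mono_neutral_left) (auto simp: in_keys_iff)

lemma mdeg_0 [simp]: "mdeg 0 = 0"
  by (simp add: mdeg_def)

lemma mdeg_single [simp]: "mdeg (single v k) = k"
  by (simp add: mdeg_def)

lemma mdeg_add: "mdeg (a + b) = mdeg a + mdeg b"
  by (simp add: mdeg_superset[of "keys a \<union> keys b"] keys_add_nat lookup_add sum.distrib)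

lemma mdeg_sum: "mdeg (sum f A) = (\<Sum>i\<in>A. mdeg (f i))"
  by (induction A rule: infinite_finite_induct) (auto simp: mdeg_add)

lemma mdeg_eq_0_iff [simp]: "mdeg a = 0 \<longleftrightarrow> a = 0"
  by (metis finite_keys in_keys_iff keys_eq_empty mdeg_0 mdeg_def subsetI subset_antisym
      sum_eq_0_iff empty_iff)

lemma lookup_le_mdeg: "lookup a v \<le> mdeg a"
proof (cases "v \<in> keys a")
  case True
  then show ?thesis unfolding mdeg_def by (intro member_le_sum) auto
qed (auto simp: in_keys_iff)

lemma expvec_induct [case_names zero add]:
  fixes a :: "'v \<Rightarrow>\<^sub>0 nat"
  assumes "P 0" "\<And>a v. P a \<Longrightarrow> P (a + single v 1)"
  shows "P a"
proof (induction "mdeg a" arbitrary: a)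
  case 0
  then show ?case using assms(1) by simp
next
  case (Suc m)
  then obtain v where v: "v \<in> keys a"
    by (metis all_not_in_conv keys_eq_empty mdeg_0 nat.distinct(1))
  define b where "b = a - single v 1"
  have ab: "a = b + single v 1"
    by (rule poly_mapping_eqI)
      (use v in \<open>auto simp: b_def lookup_add lookup_minus lookup_single when_def in_keys_iff\<close>)
  then have "m = mdeg b" using Suc(2) by (simp add: mdeg_add)
  then show ?case using Suc(1) assms(2) ab by metis
qed

lemma finite_expvecs_le:
  assumes "finite V"
  shows "finite {a :: 'v \<Rightarrow>\<^sub>0 nat. keys a \<subseteq> V \<and> (\<forall>v. lookup a v \<le> K)}"
proof -
  let ?r = "\<lambda>a::'v \<Rightarrow>\<^sub>0 nat. restrict (lookup a) V"
  have "inj_on ?r {a. keys a \<subseteq> V \<and> (\<forall>v. lookup a v \<le> K)}"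
  proof (rule inj_onI, rule poly_mapping_eqI)
    fix a b v
    assume "a \<in> {a. keys a \<subseteq> V \<and> (\<forall>v. lookup a v \<le> K)}"
      "b \<in> {a. keys a \<subseteq> V \<and> (\<forall>v. lookup a v \<le> K)}" "?r a = ?r b"
    then show "lookup a v = lookup b v"
      by (cases "v \<in> V") (metis restrict_apply', metis (mono_tags) in_keys_iff mem_Collect_eq subsetD)
  qed
  moreover have "?r ` {a. keys a \<subseteq> V \<and> (\<forall>v. lookup a v \<le> K)} \<subseteq> PiE V (\<lambda>_. {..K})"
    by auto
  ultimately show ?thesis
    by (meson assms finite_PiE finite_atMost finite_imageD finite_subset)
qed

lemma finite_monomials: "finite V \<Longrightarrow> finite (monomials V e)"
  by (rule finite_subset[OF _ finite_expvecs_le[of V e]])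
    (auto simp: monomials_def lookup_le_mdeg)

lemma mpol_sum_single: "F = (\<Sum>a\<in>keys F. single a (lookup F a))"
proof (rule poly_mapping_eqI)
  fix k
  show "lookup F k = lookup (\<Sum>a\<in>keys F. single a (lookup F a)) k"
    by (cases "k \<in> keys F")
      (auto simp: lookup_sum lookup_single when_def sum.delta' in_keys_iff)
qed

lemma eval_mpol_superset:
  assumes "finite A" "keys F \<subseteq> A"
  shows "eval_mpol F x = (\<Sum>a\<in>A. lookup F a * monom_val x a)"
  unfolding eval_mpol_def monom_val_def using assms
  by (intro sum.mono_neutral_left) (auto simp: in_keys_iff)

lemma eval_mpol_0 [simp]: "eval_mpol 0 x = 0"
  by (simp add: eval_mpol_def)

lemma eval_mpol_single [simp]: "eval_mpol (single a c) x = c * monom_val x a"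
  by (simp add: eval_mpol_superset[of "{a}"])

lemma eval_mpol_1 [simp]: "eval_mpol 1 x = 1"
  by (metis eval_mpol_single monom_val_0 mult_1 single_one)

lemma eval_mpol_add [simp]: "eval_mpol (F + G) x = eval_mpol F x + eval_mpol G x"
  by (simp add: eval_mpol_superset[of "keys F \<union> keys G"] keys_add lookup_add
      sum.distrib distrib_right)

lemma eval_mpol_uminus [simp]: "eval_mpol (- F) x = - eval_mpol F x"
  by (simp add: eval_mpol_superset[of "keys F"] sum_negf)

lemma eval_mpol_diff [simp]: "eval_mpol (F - G) x = eval_mpol F x - eval_mpol G x"
  by (metis ab_group_add_class.ab_diff_conv_add_uminus eval_mpol_add eval_mpol_uminus)

lemma eval_mpol_sum [simp]: "eval_mpol (\<Sum>i\<in>A. F i) x = (\<Sum>i\<in>A. eval_mpol (F i) x)"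
  by (induction A rule: infinite_finite_induct) auto

lemma eval_mpol_mult [simp]: "eval_mpol (F * G) x = eval_mpol F x * eval_mpol G x"
proof -
  have "F * G = (\<Sum>a\<in>keys F. \<Sum>b\<in>keys G. single (a + b) (lookup F a * lookup G b))"
    using arg_cong2[OF mpol_sum_single[of F] mpol_sum_single[of G], of "(*)"]
    by (simp only: sum_product mult_single)
  then show ?thesis
    by (simp add: eval_mpol_superset[of "keys F"] eval_mpol_superset[of "keys G"] sum_product
        monom_val_add mult_ac)
qed

lemma eval_mpol_prod [simp]: "eval_mpol (\<Prod>i\<in>A. F i) x = (\<Prod>i\<in>A. eval_mpol (F i) x)"
  by (induction A rule: infinite_finite_induct) auto

lemma eval_mpol_power [simp]: "eval_mpol (F ^ k) x = eval_mpol F x ^ k"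
  by (induction k) auto

subsection \<open>Polynomial functions\<close>

definition mpols :: "'v set \<Rightarrow> ('v, 'a::zero) mpol set" where
  "mpols V = {F. \<forall>a\<in>keys F. keys a \<subseteq> V}"

lemma mpols_add: "F \<in> mpols V \<Longrightarrow> G \<in> mpols V \<Longrightarrow> F + G \<in> mpols V"
  unfolding mpols_def using keys_add[of F G] by blast

lemma mpols_mult: "F \<in> mpols V \<Longrightarrow> G \<in> mpols V \<Longrightarrow> F * G \<in> mpols V"
  unfolding mpols_def using keys_mult[of F G] by (fastforce simp: keys_add_nat)

lemma mpols_single: "keys a \<subseteq> V \<Longrightarrow> single a c \<in> mpols V"
  by (simp add: mpols_def)

lemma mpols_diff: "F \<in> mpols V \<Longrightarrow> G \<in> mpols V \<Longrightarrow> F - G \<in> mpols V"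
  unfolding mpols_def using keys_diff[of F G] by blast

lemma mpols_sum: "(\<And>i. i \<in> A \<Longrightarrow> F i \<in> mpols V) \<Longrightarrow> sum F A \<in> mpols V"
  unfolding mpols_def using keys_sum[of F A] by blast

definition polyfun :: "'v set \<Rightarrow> (('v \<Rightarrow> 'a::comm_ring_1) \<Rightarrow> 'a) \<Rightarrow> bool" where
  "polyfun V g \<longleftrightarrow> (\<exists>F\<in>mpols V. g = eval_mpol F)"

lemma polyfun_eval [intro]: "F \<in> mpols V \<Longrightarrow> polyfun V (eval_mpol F)"
  by (auto simp: polyfun_def)

lemma polyfun_const [intro]: "polyfun V (\<lambda>_. c)"
  unfolding polyfun_def
  by (rule bexI[of _ "single 0 c"]) (auto simp: mpols_single fun_eq_iff)

lemma polyfun_var [intro]: "v \<in> V \<Longrightarrow> polyfun V (\<lambda>x. x v)"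
  unfolding polyfun_def
  by (rule bexI[of _ "single (single v 1) 1"]) (auto simp: mpols_single fun_eq_iff)

lemma polyfun_add [intro]: "polyfun V f \<Longrightarrow> polyfun V g \<Longrightarrow> polyfun V (\<lambda>x. f x + g x)"
  unfolding polyfun_def by (auto intro!: bexI[OF _ mpols_add])

lemma polyfun_mult [intro]: "polyfun V f \<Longrightarrow> polyfun V g \<Longrightarrow> polyfun V (\<lambda>x. f x * g x)"
  unfolding polyfun_def by (auto intro!: bexI[OF _ mpols_mult])

lemma polyfun_uminus [intro]: "polyfun V f \<Longrightarrow> polyfun V (\<lambda>x. - f x)"
  using polyfun_mult[OF polyfun_const[of V "-1"]] by simp

lemma polyfun_sum [intro]:
  "(\<And>i. i \<in> A \<Longrightarrow> polyfun V (f i)) \<Longrightarrow> polyfun V (\<lambda>x. \<Sum>i\<in>A. f i x)"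
  by (induction A rule: infinite_finite_induct) auto

lemma polyfun_prod [intro]:
  "(\<And>i. i \<in> A \<Longrightarrow> polyfun V (f i)) \<Longrightarrow> polyfun V (\<lambda>x. \<Prod>i\<in>A. f i x)"
  by (induction A rule: infinite_finite_induct) auto

lemma polyfun_power [intro]: "polyfun V f \<Longrightarrow> polyfun V (\<lambda>x. f x ^ k)"
  by (induction k) auto

lemma polyfun_subst:
  assumes "F \<in> mpols V" "\<And>v. v \<in> V \<Longrightarrow> polyfun W (g v)"
  shows "polyfun W (\<lambda>x. eval_mpol F (\<lambda>v. g v x))"
  unfolding eval_mpol_def using assms by (auto simp: mpols_def intro!: polyfun_mult polyfun_sum polyfun_prod polyfun_power)

lemma eval_mpol_cong:
  assumes "F \<in> mpols V" "\<And>v. v \<in> V \<Longrightarrow> x v = y v"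
  shows "eval_mpol F x = eval_mpol F y"
  unfolding eval_mpol_def using assms
  by (intro sum.cong refl arg_cong[where f = "\<lambda>z. _ * z"] prod.cong)
    (auto simp: mpols_def subset_iff)

lemma forms_mpols: "forms V e \<subseteq> mpols V"
  by (auto simp: forms_def mpols_def monomials_def)

lemma forms_add: "F \<in> forms V e \<Longrightarrow> G \<in> forms V e \<Longrightarrow> F + G \<in> forms V e"
  unfolding forms_def using keys_add[of F G] by blast

lemma forms_mult: "F \<in> forms V d \<Longrightarrow> G \<in> forms V e \<Longrightarrow> F * G \<in> forms V (d + e)"
  unfolding forms_def monomials_def using keys_mult[of F G]
  by (fastforce simp: keys_add_nat mdeg_add)

lemma forms_single: "a \<in> monomials V e \<Longrightarrow> single a c \<in> forms V e"
  by (simp add: forms_def)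

lemma forms_sum: "(\<And>i. i \<in> A \<Longrightarrow> F i \<in> forms V e) \<Longrightarrow> sum F A \<in> forms V e"
  unfolding forms_def using keys_sum[of F A] by blast

lemma monom_val_scale: "monom_val (\<lambda>v. c * x v) a = c ^ mdeg a * monom_val x a"
  by (simp add: monom_val_def mdeg_def power_mult_distrib prod.distrib power_sum)

lemma eval_form_scale:
  assumes "F \<in> forms V e"
  shows "eval_mpol F (\<lambda>v. c * x v) = c ^ e * eval_mpol F x"
  using assms
  by (auto simp: eval_mpol_superset[of "keys F"] monom_val_scale forms_def monomials_def
      sum_distrib_left subset_iff mult_ac intro!: sum.cong)

text \<open>Homogeneous component of degree \<open>e\<close>. It serves to expand around a point by
  lowest order, and to pass from an inhomogeneous equation to forms, which alone define closed sets
  of the projective space.\<close>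

definition hpart :: "nat \<Rightarrow> ('v, 'a::comm_ring_1) mpol \<Rightarrow> ('v, 'a) mpol" where
  "hpart e F = (\<Sum>a\<in>{a\<in>keys F. mdeg a = e}. single a (lookup F a))"

lemma lookup_hpart: "lookup (hpart e F) a = (if mdeg a = e then lookup F a else 0)"
  by (auto simp: hpart_def lookup_sum lookup_single when_def sum.delta' in_keys_iff)

lemma hpart_forms: "F \<in> mpols V \<Longrightarrow> hpart e F \<in> forms V e"
  unfolding forms_def mpols_def monomials_def
  by (auto simp: in_keys_iff lookup_hpart split: if_splits)

lemma sum_hpart:
  assumes "\<And>a. a \<in> keys F \<Longrightarrow> mdeg a \<le> K"
  shows "F = (\<Sum>e\<le>K. hpart e F)"
  by (rule poly_mapping_eqI) (use assms in \<open>auto simp: lookup_sum lookup_hpart in_keys_iff\<close>)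

lemma mdeg_bounded: "\<exists>K. \<forall>a\<in>keys F. mdeg a \<le> K"
  by (meson finite_imageI finite_keys finite_nat_set_iff_bounded_le imageI)

subsection \<open>Kronecker substitution\<close>

lemma base_digits_unique:
  fixes a b :: "nat \<Rightarrow> nat"
  assumes "\<And>k. k < N \<Longrightarrow> a k < B" "\<And>k. k < N \<Longrightarrow> b k < B"
    and "(\<Sum>k<N. a k * B ^ k) = (\<Sum>k<N. b k * B ^ k)" and "k < N"
  shows "a k = b k"
  using assms
proof (induction N arbitrary: a b k)
  case (Suc N)
  have eq: "a 0 + B * (\<Sum>k<N. a (Suc k) * B ^ k) = b 0 + B * (\<Sum>k<N. b (Suc k) * B ^ k)"
    using Suc.prems(3) by (simp only: sum.lessThan_Suc_shift sum_distrib_left) (simp add: mult_ac)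
  have "a 0 < B" "b 0 < B" using Suc.prems by auto
  then have 0: "a 0 = b 0" and "(\<Sum>k<N. a (Suc k) * B ^ k) = (\<Sum>k<N. b (Suc k) * B ^ k)"
    using arg_cong[OF eq, of "\<lambda>z. z mod B"] arg_cong[OF eq, of "\<lambda>z. z div B"] by auto
  with Suc.IH[of "a \<circ> Suc" "b \<circ> Suc"] Suc.prems have "\<And>k. k < N \<Longrightarrow> a (Suc k) = b (Suc k)"
    by auto
  with 0 show ?case using Suc.prems(4) by (cases k) auto
qed simp

text \<open>Kronecker's trick: substituting \<open>t ^ (B ^ h v)\<close> for the variable
  \<open>v\<close>, with \<open>B\<close> above all degrees, sends distinct monomials to distinct
  powers of \<open>t\<close>, because exponents become digits in base \<open>B\<close>. No
  cancellation occurs, and a nonzero polynomial in \<open>t\<close> has a nonroot.\<close>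

lemma mpol_nonzero_eval:
  fixes F :: "('v, 'a::{idom,ring_char_0}) mpol"
  assumes "F \<in> mpols V" "finite V" "F \<noteq> 0"
  obtains x where "eval_mpol F x \<noteq> 0"
proof -
  obtain K where K: "\<And>a. a \<in> keys F \<Longrightarrow> mdeg a \<le> K" using mdeg_bounded by blast
  obtain h where h: "bij_betw h V {..<card V}"
    by (metis assms(2) atLeast0LessThan ex_bij_betw_finite_nat)
  define g where "g = inv_into V h"
  have g: "bij_betw g {..<card V} V" unfolding g_def using h by (rule bij_betw_inv_into)
  define \<kappa> where "\<kappa> a = (\<Sum>k<card V. lookup a (g k) * (Suc K) ^ k)" for a :: "'v \<Rightarrow>\<^sub>0 nat"
  have inj: "inj_on \<kappa> (keys F)"
  proof (rule inj_onI)
    fix a b assume ab: "a \<in> keys F" "b \<in> keys F" "\<kappa> a = \<kappa> b"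
    have less: "lookup c v < Suc K" if "c \<in> keys F" for c v
      using K[OF that] lookup_le_mdeg[of c v] by linarith
    have *: "lookup a (g k) = lookup b (g k)" if "k < card V" for k
      by (rule base_digits_unique[of "card V" "\<lambda>k. lookup a (g k)" "Suc K" "\<lambda>k. lookup b (g k)"])
        (use ab less that in \<open>auto simp: \<kappa>_def\<close>)
    show "a = b"
    proof (rule poly_mapping_eqI)
      fix v
      show "lookup a v = lookup b v"
      proof (cases "v \<in> V")
        case True
        then obtain k where "k < card V" "v = g k" using g by (auto simp: bij_betw_def)
        then show ?thesis using * by simp
      next
        case False
        then have "v \<notin> keys a" "v \<notin> keys b" using ab assms(1) by (auto simp: mpols_def)
        then show ?thesis by (simp add: in_keys_iff)
      qed
    qed
  qed
  define P where "P = (\<Sum>a\<in>keys F. monom (lookup F a) (\<kappa> a))"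
  obtain a0 where a0: "a0 \<in> keys F" using assms(3) by (meson all_not_in_conv keys_eq_empty)
  have "coeff P (\<kappa> a0) = (\<Sum>a\<in>keys F. if a = a0 then lookup F a else 0)"
    unfolding P_def coeff_sum by (rule sum.cong) (use inj a0 in \<open>auto simp: inj_on_def\<close>)
  also have "\<dots> \<noteq> 0" using a0 by (simp add: in_keys_iff)
  finally have "P \<noteq> 0" by auto
  then obtain t where t: "poly P t \<noteq> 0" using poly_all_0_iff_0 by blast
  define x where "x v = t ^ (Suc K ^ h v)" for v
  have "eval_mpol F x = (\<Sum>a\<in>keys F. lookup F a * t ^ \<kappa> a)"
  proof -
    have "monom_val x a = t ^ \<kappa> a" if "a \<in> keys F" for a
    proof -
      have "keys a \<subseteq> V" using assms(1) that by (auto simp: mpols_def)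
      then have "monom_val x a = (\<Prod>v\<in>V. x v ^ lookup a v)"
        by (intro monom_val_superset assms)
      also have "\<dots> = (\<Prod>k<card V. x (g k) ^ lookup a (g k))"
        by (rule prod.reindex_bij_betw[OF g, symmetric])
      also have "\<dots> = t ^ \<kappa> a"
        unfolding \<kappa>_def power_sum
      proof (rule prod.cong[OF refl])
        fix k assume "k \<in> {..<card V}"
        then have "h (g k) = k" unfolding g_def using h
          by (metis bij_betw_def f_inv_into_f)
        then show "x (g k) ^ lookup a (g k) = t ^ (lookup a (g k) * Suc K ^ k)"
          by (simp only: x_def power_mult[symmetric] mult.commute)
      qed
      finally show ?thesis .
    qed
    then show ?thesis by (simp add: eval_mpol_superset[of "keys F"])
  qed
  also have "\<dots> = poly P t" by (simp add: P_def poly_sum poly_monom)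
  finally show ?thesis using t that by metis
qed

lemma mpol_eq_if_eval_eq:
  fixes F :: "('v, 'a::{idom,ring_char_0}) mpol"
  assumes "\<And>x. eval_mpol F x = eval_mpol G x"
  shows "F = G"
proof (rule ccontr)
  assume "F \<noteq> G"
  define V where "V = (\<Union>a\<in>keys (F - G). keys a)"
  have "finite V" "F - G \<in> mpols V" by (auto simp: V_def mpols_def)
  then obtain x where "eval_mpol (F - G) x \<noteq> 0"
    using mpol_nonzero_eval \<open>F \<noteq> G\<close> by (metis right_minus_eq)
  then show False using assms by simp
qed

section \<open>Extending complex points along finitely generated extensions of domains (the core of
  Chevalley's theorem)\<close>

section \<open>Extension of homomorphisms into the complex numbers\<close>

text \<open>Rings are subsets of one ambient ring and homomorphisms are total functions restricted
  to them, so that a tower of extensions can be built inside a single type.\<close>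

definition is_subring :: "'b::comm_ring_1 set \<Rightarrow> bool" where
  "is_subring A \<longleftrightarrow> 1 \<in> A \<and> (\<forall>a\<in>A. \<forall>b\<in>A. a - b \<in> A \<and> a * b \<in> A)"

definition hom_on :: "'b::comm_ring_1 set \<Rightarrow> ('b \<Rightarrow> 'c::comm_ring_1) \<Rightarrow> bool" where
  "hom_on A f \<longleftrightarrow> f 1 = 1 \<and> (\<forall>a\<in>A. \<forall>b\<in>A. f (a + b) = f a + f b \<and> f (a * b) = f a * f b)"

text \<open>Geometrically: every complex point of \<open>A\<close> in the principal open set of
  \<open>u\<close> is the image of a complex point of \<open>B\<close> in the principal open set of
  \<open>v\<close>.\<close>

definition homs_extend :: "'b::comm_ring_1 set \<Rightarrow> 'b set \<Rightarrow> 'b \<Rightarrow> 'b \<Rightarrow> bool" where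
  "homs_extend A B u v \<longleftrightarrow> (\<forall>f :: 'b \<Rightarrow> complex. hom_on A f \<longrightarrow> f u \<noteq> 0 \<longrightarrow>
    (\<exists>g. hom_on B g \<and> (\<forall>a\<in>A. g a = f a) \<and> g v \<noteq> 0))"

definition poly_over :: "'b::comm_ring_1 set \<Rightarrow> 'b poly set" where
  "poly_over A = {p. \<forall>i. coeff p i \<in> A}"

definition adjoin :: "'b::comm_ring_1 set \<Rightarrow> 'b \<Rightarrow> 'b set" where
  "adjoin A x = (\<lambda>p. poly p x) ` poly_over A"

context
  fixes A :: "'b::comm_ring_1 set"
  assumes A: "is_subring A"
begin

lemma subring_0: "0 \<in> A"
  using A by (metis diff_self is_subring_def)

lemma subring_diff: "a \<in> A \<Longrightarrow> b \<in> A \<Longrightarrow> a - b \<in> A"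
  using A by (simp add: is_subring_def)

lemma subring_mult: "a \<in> A \<Longrightarrow> b \<in> A \<Longrightarrow> a * b \<in> A"
  using A by (simp add: is_subring_def)

lemma subring_add: "a \<in> A \<Longrightarrow> b \<in> A \<Longrightarrow> a + b \<in> A"
  using subring_diff[of a "0 - b"] subring_diff[of 0 b] subring_0 by simp

lemma subring_sum: "(\<And>i. i \<in> I \<Longrightarrow> h i \<in> A) \<Longrightarrow> sum h I \<in> A"
  by (induction I rule: infinite_finite_induct) (auto simp: subring_0 subring_add)

lemma poly_over_diff: "p \<in> poly_over A \<Longrightarrow> q \<in> poly_over A \<Longrightarrow> p - q \<in> poly_over A"
  by (simp add: poly_over_def subring_diff)

lemma poly_over_add: "p \<in> poly_over A \<Longrightarrow> q \<in> poly_over A \<Longrightarrow> p + q \<in> poly_over A"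
  by (simp add: poly_over_def subring_add)

lemma poly_over_mult: "p \<in> poly_over A \<Longrightarrow> q \<in> poly_over A \<Longrightarrow> p * q \<in> poly_over A"
  by (auto simp: poly_over_def coeff_mult intro!: subring_sum subring_mult)

lemma poly_over_monom: "a \<in> A \<Longrightarrow> monom a k \<in> poly_over A"
  by (simp add: poly_over_def subring_0)

lemma poly_over_smult: "a \<in> A \<Longrightarrow> p \<in> poly_over A \<Longrightarrow> smult a p \<in> poly_over A"
  by (simp add: poly_over_def subring_mult)

lemma poly_over_const: "a \<in> A \<Longrightarrow> [:a:] \<in> poly_over A"
  using poly_over_monom[of a 0] by (simp add: monom_0)

lemma adjoin_base: "A \<subseteq> adjoin A x"
proof
  fix a assume "a \<in> A"
  then show "a \<in> adjoin A x"
    unfolding adjoin_def by (intro image_eqI[of _ _ "[:a:]"]) (auto intro: poly_over_const)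
qed

lemma adjoin_gen: "x \<in> adjoin A x"
  unfolding adjoin_def
  by (intro image_eqI[of _ _ "monom 1 1"])
    (use A in \<open>auto intro!: poly_over_monom simp: poly_monom is_subring_def\<close>)

lemma adjoin_subring: "is_subring (adjoin A x)"
  unfolding is_subring_def
proof (intro conjI ballI)
  show "1 \<in> adjoin A x" using adjoin_base A by (auto simp: is_subring_def)
next
  fix a b assume "a \<in> adjoin A x" "b \<in> adjoin A x"
  then obtain p q where "p \<in> poly_over A" "q \<in> poly_over A" "a = poly p x" "b = poly q x"
    by (auto simp: adjoin_def)
  then show "a - b \<in> adjoin A x" "a * b \<in> adjoin A x"
    using poly_over_diff[of p q] poly_over_mult[of p q] by (auto simp: adjoin_def image_iff)
      (metis poly_diff, metis poly_mult)
qed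

text \<open>Coefficients cannot be inverted in \<open>A\<close>, so \<open>q\<close> is multiplied
  by the leading coefficient of \<open>p\<close> before each cancellation of its leading term; the
  power \<open>k\<close> counts these multiplications.\<close>

lemma pseudo_division:
  assumes "p \<in> poly_over A" "p \<noteq> 0" "q \<in> poly_over A"
  shows "\<exists>k h r. h \<in> poly_over A \<and> r \<in> poly_over A \<and> smult (lead_coeff p ^ k) q = p * h + r \<and>
    (r = 0 \<or> degree r < degree p)"
  using assms(3)
proof (induction "degree q" arbitrary: q rule: less_induct)
  case less
  show ?case
  proof (cases "q = 0 \<or> degree q < degree p")
    case True
    then show ?thesis
      using less.prems
      by (intro exI[of _ 0] exI[of _ "0 :: 'b poly"] exI[of _ q]) (auto simp: poly_over_def subring_0)
  next
    case False
    define c where "c = lead_coeff p"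
    define m where "m = monom (lead_coeff q) (degree q - degree p)"
    define q' where "q' = smult c q - p * m"
    have cA: "c \<in> A" using assms(1) by (simp add: c_def poly_over_def)
    have mA: "m \<in> poly_over A"
      unfolding m_def using less.prems by (intro poly_over_monom) (simp add: poly_over_def)
    have q'A: "q' \<in> poly_over A"
      unfolding q'_def using assms less.prems mA cA
      by (intro poly_over_diff poly_over_smult poly_over_mult)
    \<comment> \<open>The first alternative is the constant case: \<open>degree 0 = 0\<close>, so
      cancelling a constant does not lower the degree although it produces the zero
      polynomial.\<close>
    have deg: "degree q' = 0 \<and> degree q = 0 \<or> degree q' < degree q"
    proof -
      have le: "degree q' \<le> degree q"
        unfolding q'_def
      proof (rule degree_diff_le)
        show "degree (smult c q) \<le> degree q" by (rule degree_smult_le)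
        have "degree (p * m) \<le> degree p + degree m" by (rule degree_mult_le)
        also have "\<dots> \<le> degree q" using False degree_monom_le[of "lead_coeff q"]
          by (metis le_add_diff_inverse m_def add_left_mono not_less)
        finally show "degree (p * m) \<le> degree q" .
      qed
      have "coeff q' (degree q) = 0"
      proof -
        have "coeff (p * m) (degree q) = coeff (p * m) (degree p + (degree q - degree p))"
          using False by simp
        also have "\<dots> = lead_coeff p * lead_coeff q"
          unfolding m_def
          using False by (simp add: coeff_monom_mult mult.commute[of p])
        finally show ?thesis by (simp add: q'_def c_def)
      qed
      with le show ?thesis
        by (metis degree_0 le_neq_implies_less leading_coeff_0_iff)
    qed
    have "\<exists>k h r. h \<in> poly_over A \<and> r \<in> poly_over A \<and> smult (c ^ k) q' = p * h + r \<and>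
      (r = 0 \<or> degree r < degree p)"
    proof (cases "degree q' < degree q")
      case True
      then show ?thesis using less.hyps q'A unfolding c_def by blast
    next
      case F: False
      then have "q' = 0"
      proof -
        have "degree p = 0" "degree q = 0" "degree q' = 0" using F deg False by auto
        then have "coeff q' 0 = 0"
          by (simp add: q'_def c_def m_def coeff_mult monom_0 mult.commute)
        then show ?thesis using \<open>degree q' = 0\<close> by (metis leading_coeff_0_iff)
      qed
      then show ?thesis
        by (intro exI[of _ 0] exI[of _ "0 :: 'b poly"] exI[of _ "0 :: 'b poly"])
          (auto simp: poly_over_def subring_0)
    qed
    then obtain k h r where khr: "h \<in> poly_over A" "r \<in> poly_over A"
      "smult (c ^ k) q' = p * h + r" "r = 0 \<or> degree r < degree p" by blast
    have ck: "c ^ k \<in> A" using cA A by (induction k) (auto simp: is_subring_def)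
    have "smult (c ^ Suc k) q = p * (h + smult (c ^ k) m) + r"
    proof -
      have "smult (c ^ Suc k) q = smult (c ^ k) (q' + p * m)"
        by (simp add: q'_def mult.commute)
      then show ?thesis using khr by (simp add: smult_add_right algebra_simps)
    qed
    then show ?thesis
      using khr mA ck unfolding c_def
      by (intro exI[of _ "Suc k"] exI[of _ "h + smult (c ^ k) m"] exI[of _ r])
        (auto simp: c_def intro!: poly_over_add poly_over_smult)
  qed
qed

context
  fixes f :: "'b \<Rightarrow> 'c::comm_ring_1"
  assumes f: "hom_on A f"
begin

lemma hom_on_0: "f 0 = 0"
  using f subring_0 unfolding hom_on_def by (metis add.right_neutral add_left_cancel)

lemma hom_on_sum: "(\<And>i. i \<in> I \<Longrightarrow> h i \<in> A) \<Longrightarrow> f (sum h I) = (\<Sum>i\<in>I. f (h i))"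
proof (induction I rule: infinite_finite_induct)
  case (insert i I)
  then show ?case using f subring_sum[of I h] by (simp add: hom_on_def)
qed (auto simp: hom_on_0)

lemma map_poly_add_over:
  "p \<in> poly_over A \<Longrightarrow> q \<in> poly_over A \<Longrightarrow> map_poly f (p + q) = map_poly f p + map_poly f q"
  using f by (intro poly_eqI) (auto simp: coeff_map_poly hom_on_0 poly_over_def hom_on_def)

lemma map_poly_mult_over:
  assumes "p \<in> poly_over A" "q \<in> poly_over A"
  shows "map_poly f (p * q) = map_poly f p * map_poly f q"
proof (rule poly_eqI)
  fix n
  have "f (\<Sum>i\<le>n. coeff p i * coeff q (n - i)) = (\<Sum>i\<le>n. f (coeff p i * coeff q (n - i)))"
    using assms by (intro hom_on_sum subring_mult) (auto simp: poly_over_def)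
  also have "\<dots> = (\<Sum>i\<le>n. f (coeff p i) * f (coeff q (n - i)))"
    using assms f by (intro sum.cong refl) (auto simp: hom_on_def poly_over_def)
  finally show "coeff (map_poly f (p * q)) n = coeff (map_poly f p * map_poly f q) n"
    by (simp add: coeff_map_poly hom_on_0 coeff_mult)
qed

lemma map_poly_const: "map_poly f [:a:] = [:f a:]"
  by (rule poly_eqI) (auto simp: coeff_map_poly hom_on_0 coeff_pCons split: nat.split)

lemma hom_on_power: "a \<in> A \<Longrightarrow> f (a ^ k) = f a ^ k"
proof (induction k)
  case (Suc k)
  have "a ^ k \<in> A" using Suc.prems A by (induction k) (auto simp: is_subring_def)
  then show ?case using Suc f by (simp add: hom_on_def)
qed (use f in \<open>simp add: hom_on_def\<close>)

text \<open>Two expressions of one element as polynomials in \<open>x\<close> differ by a relation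
  of \<open>x\<close>. The hypothesis says that \<xi> satisfies the image of every relation, so
  sending \<open>x\<close> to \<xi> is well defined and any representative may be chosen.\<close>

lemma hom_on_adjoin:
  assumes "\<And>q. q \<in> poly_over A \<Longrightarrow> poly q x = 0 \<Longrightarrow> poly (map_poly f q) \<xi> = 0"
  shows "\<exists>g. hom_on (adjoin A x) g \<and> (\<forall>a\<in>A. g a = f a) \<and>
    (\<forall>q\<in>poly_over A. g (poly q x) = poly (map_poly f q) \<xi>)"
proof -
  define g where "g b = poly (map_poly f (SOME q. q \<in> poly_over A \<and> poly q x = b)) \<xi>" for b
  have g: "g (poly q x) = poly (map_poly f q) \<xi>" if q: "q \<in> poly_over A" for q
  proof -
    define q' where "q' = (SOME q'. q' \<in> poly_over A \<and> poly q' x = poly q x)"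
    have q': "q' \<in> poly_over A" "poly q' x = poly q x"
      using someI[of "\<lambda>q'. q' \<in> poly_over A \<and> poly q' x = poly q x" q] q by (auto simp: q'_def)
    have d: "q' - q \<in> poly_over A" using q' q by (intro poly_over_diff)
    with q' have "poly (map_poly f (q' - q)) \<xi> = 0" by (intro assms) auto
    moreover have "map_poly f q' = map_poly f (q' - q) + map_poly f q"
      using map_poly_add_over[OF d q] by simp
    ultimately show ?thesis by (simp add: g_def q'_def)
  qed
  have "hom_on (adjoin A x) g"
    unfolding hom_on_def adjoin_def
  proof (intro conjI ballI; (elim imageE)?; hypsubst?)
    have "1 \<in> A" using A by (simp add: is_subring_def)
    from g[OF poly_over_const[OF this]] show "g 1 = 1"
      using f by (simp add: map_poly_const hom_on_def)
  next
    fix p q assume pq: "p \<in> poly_over A" "q \<in> poly_over A"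
    show "g (poly p x + poly q x) = g (poly p x) + g (poly q x)"
      using g[OF poly_over_add[OF pq]] g pq by (simp add: map_poly_add_over)
    show "g (poly p x * poly q x) = g (poly p x) * g (poly q x)"
      using g[OF poly_over_mult[OF pq]] g pq by (simp add: map_poly_mult_over)
  qed
  moreover have "\<forall>a\<in>A. g a = f a"
    using g[OF poly_over_const] by (simp add: map_poly_const)
  ultimately show ?thesis using g by blast
qed

end

end

text \<open>If \<open>x\<close> is transcendental over \<open>A\<close>, any value may be chosen for \<open>x\<close>; otherwise it must be a
  root of the image of a polynomial \<open>p\<close> of minimal degree with \<open>p(x) = 0\<close>. As long as the leading
  coefficient of \<open>p\<close> survives, pseudo-division by \<open>p\<close> shows that this is consistent, and the
  Euclidean algorithm for \<open>p\<close> and \<open>v\<close> produces a nonzero multiple of \<open>v\<close> that lies in \<open>A\<close>.\<close>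

lemma hom_extension_step:
  fixes A :: "'b::idom set"
  assumes A: "is_subring A" and v: "v \<in> adjoin A x" "v \<noteq> 0"
  shows "\<exists>u\<in>A. u \<noteq> 0 \<and> homs_extend A (adjoin A x) u v"
proof -
  obtain q0 where q0: "q0 \<in> poly_over A" "v = poly q0 x" using v by (auto simp: adjoin_def)
  with v have "q0 \<noteq> 0" by auto
  show ?thesis
  proof (cases "\<exists>p\<in>poly_over A. p \<noteq> 0 \<and> poly p x = 0")
    case False
    show ?thesis
      unfolding homs_extend_def
    \<comment> \<open>If this coefficient survives, the image of \<open>q0\<close> is a nonzero
      polynomial, and some value for \<open>x\<close> avoids its roots, which keeps \<open>v\<close>
      nonzero.\<close>
    proof (intro bexI[of _ "lead_coeff q0"] conjI allI impI)
      fix f :: "'b \<Rightarrow> complex" assume f: "hom_on A f" and u: "f (lead_coeff q0) \<noteq> 0"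
      have "map_poly f q0 \<noteq> 0"
        using u hom_on_0[OF A f] by (metis coeff_0 coeff_map_poly)
      then obtain \<xi> where \<xi>: "poly (map_poly f q0) \<xi> \<noteq> 0" using poly_all_0_iff_0 by blast
      have "poly (map_poly f q) \<xi> = 0" if "q \<in> poly_over A" "poly q x = 0" for q
        using False that by fastforce
      from hom_on_adjoin[OF A f this] \<xi> q0
      show "\<exists>g. hom_on (adjoin A x) g \<and> (\<forall>a\<in>A. g a = f a) \<and> g v \<noteq> 0" by metis
    qed (use q0 \<open>q0 \<noteq> 0\<close> in \<open>auto simp: poly_over_def\<close>)
  next
    case True
    define n where "n = (LEAST n. \<exists>p\<in>poly_over A. p \<noteq> 0 \<and> poly p x = 0 \<and> degree p = n)"
    have "\<exists>p\<in>poly_over A. p \<noteq> 0 \<and> poly p x = 0 \<and> degree p = n"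
      unfolding n_def by (rule LeastI_ex) (use True in blast)
    then obtain p where p: "p \<in> poly_over A" "p \<noteq> 0" "poly p x = 0" "degree p = n" by blast
    have min: "q = 0" if "q \<in> poly_over A" "poly q x = 0" "degree q < n" for q
      using not_less_Least[of "degree q" "\<lambda>n. \<exists>p\<in>poly_over A. p \<noteq> 0 \<and> poly p x = 0 \<and> degree p = n"]
        that unfolding n_def by blast
    have n: "n > 0"
      using p by (metis degree_eq_zeroE gr0I mult_zero_right poly_const_conv pCons_0_0)
    define c where "c = lead_coeff p"
    have c: "c \<in> A" "c \<noteq> 0" using p by (auto simp: c_def poly_over_def)
    \<comment> \<open>Candidates are the nonzero polynomials of degree below \<open>n\<close> whose
      value at \<open>x\<close> is a multiple of \<open>v\<close>. Choosing one of least degree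
      replaces the run of the Euclidean algorithm.\<close>
    define R where "R r \<longleftrightarrow> r \<in> poly_over A \<and> r \<noteq> 0 \<and> degree r < n \<and>
      (\<exists>b\<in>poly_over A. poly r x = poly b x * v)" for r
    have "\<exists>r. R r"
    proof -
      obtain k h r where khr: "h \<in> poly_over A" "r \<in> poly_over A" "smult (c ^ k) q0 = p * h + r"
        "r = 0 \<or> degree r < n"
        using pseudo_division[OF A p(1,2) q0(1)] p(4) unfolding c_def by blast
      have "poly r x = c ^ k * v"
        using arg_cong[OF khr(3), of "\<lambda>q. poly q x"] p q0 by simp
      moreover from this have "r \<noteq> 0" using c v by auto
      moreover have "c ^ k \<in> A" using c A by (induction k) (auto simp: is_subring_def)
      ultimately have "R r" unfolding R_def using khr poly_over_const[OF A]
        by (intro conjI bexI[of _ "[:c ^ k:]"]) auto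
      then show ?thesis ..
    qed
    then obtain r where r: "R r" "\<And>r'. R r' \<Longrightarrow> degree r \<le> degree r'"
      using ex_has_least_nat[of R _ degree] by blast
    have "degree r = 0"
    \<comment> \<open>Divide \<open>p\<close> by a nonconstant \<open>r\<close>. A nonzero remainder
      would again satisfy \<open>R\<close> with smaller degree; a zero remainder makes
      \<open>r\<close> or the quotient \<open>h\<close>, both of degree below \<open>n\<close>,
      vanish at \<open>x\<close>, against the minimality of \<open>p\<close>.\<close>
    proof (rule ccontr)
      assume dr: "degree r \<noteq> 0"
      have rA: "r \<in> poly_over A" "r \<noteq> 0" "degree r < n" using r by (auto simp: R_def)
      obtain b where b: "b \<in> poly_over A" "poly r x = poly b x * v" using r by (auto simp: R_def)
      obtain k h r' where khr: "h \<in> poly_over A" "r' \<in> poly_over A"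
        "smult (lead_coeff r ^ k) p = r * h + r'" "r' = 0 \<or> degree r' < degree r"
        using pseudo_division[OF A rA(1,2) p(1)] by blast
      have ev: "poly r x * poly h x + poly r' x = 0"
        using arg_cong[OF khr(3), of "\<lambda>q. poly q x"] p by simp
      have "r' = 0"
      proof (rule ccontr)
        assume "r' \<noteq> 0"
        have "0 - b * h \<in> poly_over A"
          using b khr A by (intro poly_over_diff[OF A] poly_over_mult[OF A])
            (auto simp: poly_over_def subring_0)
        moreover have "poly r' x = poly (0 - b * h) x * v"
          using ev b by (simp add: algebra_simps eq_neg_iff_add_eq_0)
        ultimately have "R r'" using \<open>r' \<noteq> 0\<close> khr rA unfolding R_def
          by (intro conjI bexI[of _ "0 - b * h"]) auto
        then show False using r(2) khr(4) \<open>r' \<noteq> 0\<close> by fastforce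
      qed
      have "poly r x \<noteq> 0" using min[of r] rA by blast
      then have "poly h x = 0" using ev \<open>r' = 0\<close> by simp
      moreover have "h \<noteq> 0" "degree h < n"
      proof -
        have ne: "smult (lead_coeff r ^ k) p \<noteq> 0" using rA p by simp
        then show "h \<noteq> 0" using khr(3) \<open>r' = 0\<close> by auto
        have "n = degree (r * h)" using khr(3) \<open>r' = 0\<close> rA p(4)
          by (metis add.right_neutral degree_smult_eq leading_coeff_0_iff power_eq_0_iff)
        then show "degree h < n" using dr rA \<open>h \<noteq> 0\<close> by (simp add: degree_mult_eq)
      qed
      ultimately show False using min khr(1) by blast
    qed
    then obtain a where a: "r = [:a:]" by (rule degree_eq_zeroE)
    then have aA: "a \<in> A" "a \<noteq> 0" using r by (auto simp: R_def poly_over_def dest: spec[of _ 0])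
    obtain b where b: "b \<in> poly_over A" "a = poly b x * v" using r a by (auto simp: R_def)
    show ?thesis
      unfolding homs_extend_def
    \<comment> \<open>Nonvanishing of \<open>c\<close> keeps the image of \<open>p\<close>
      nonconstant, hence with a root, and allows powers of \<open>c\<close> to be cancelled;
      \<open>a\<close> is a multiple of \<open>v\<close>, so its nonvanishing protects
      \<open>v\<close>.\<close>
    proof (intro bexI[of _ "c * a"] conjI allI impI)
      fix f :: "'b \<Rightarrow> complex" assume f: "hom_on A f" and u: "f (c * a) \<noteq> 0"
      then have fc: "f c \<noteq> 0" "f a \<noteq> 0" using c aA by (auto simp: hom_on_def)
      have "coeff (map_poly f p) n \<noteq> 0"
        using fc p(4) by (simp add: coeff_map_poly hom_on_0[OF A f] c_def)
      then have "degree (map_poly f p) \<noteq> 0" using n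
        by (metis coeff_eq_0 gr_implies_not0 le_degree not_gr_zero bot_nat_0.extremum_uniqueI)
      then obtain \<xi> where \<xi>: "poly (map_poly f p) \<xi> = 0"
        using fundamental_theorem_of_algebra_alt[of "map_poly f p"]
        by (metis degree_pCons_0)
      have "poly (map_poly f q) \<xi> = 0" if q: "q \<in> poly_over A" "poly q x = 0" for q
      proof -
        obtain k h s where khs: "h \<in> poly_over A" "s \<in> poly_over A" "smult (c ^ k) q = p * h + s"
          "s = 0 \<or> degree s < n"
          using pseudo_division[OF A p(1,2) q(1)] p(4) unfolding c_def by blast
        have "poly s x = 0" using arg_cong[OF khs(3), of "\<lambda>q. poly q x"] p q by simp
        then have "s = 0" using min khs by blast
        have ck: "c ^ k \<in> A" using c A by (induction k) (auto simp: is_subring_def)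
        have "[:c ^ k:] * q = p * h" using khs \<open>s = 0\<close> by simp
        then have "map_poly f [:c ^ k:] * map_poly f q = map_poly f p * map_poly f h"
          using map_poly_mult_over[OF A f] poly_over_const[OF A ck] q p khs by metis
        then have "poly (map_poly f [:c ^ k:]) \<xi> * poly (map_poly f q) \<xi> = 0"
          using \<xi> by (metis mult_zero_left poly_mult)
        then show ?thesis
          using fc c by (simp add: map_poly_const[OF A f] hom_on_power[OF A f])
      qed
      from hom_on_adjoin[OF A f this] obtain g where g: "hom_on (adjoin A x) g" "\<forall>a\<in>A. g a = f a"
        by blast
      have "g a = g (poly b x) * g v"
        using g(1) b v unfolding hom_on_def adjoin_def by blast
      then have "g v \<noteq> 0" using fc g aA by auto
      with g show "\<exists>g. hom_on (adjoin A x) g \<and> (\<forall>a\<in>A. g a = f a) \<and> g v \<noteq> 0" by blast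
    qed (use c aA A in \<open>auto simp: is_subring_def\<close>)
  qed
qed

lemma homs_extend_trans:
  assumes "homs_extend A A' u w" "homs_extend A' B w v" "A \<subseteq> A'"
  shows "homs_extend A B u v"
  unfolding homs_extend_def
proof (intro allI impI)
  fix f :: "'a \<Rightarrow> complex" assume "hom_on A f" "f u \<noteq> 0"
  then obtain g where g: "hom_on A' g" "\<forall>a\<in>A. g a = f a" "g w \<noteq> 0"
    using assms(1) unfolding homs_extend_def by blast
  then obtain g' where "hom_on B g'" "\<forall>a\<in>A'. g' a = g a" "g' v \<noteq> 0"
    using assms(2) unfolding homs_extend_def by blast
  with g assms(3) show "\<exists>g. hom_on B g \<and> (\<forall>a\<in>A. g a = f a) \<and> g v \<noteq> 0"
    by (intro exI[of _ g']) auto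
qed

text \<open>The elements are adjoined one at a time; each step pulls a nonvanishing condition one
  level down the tower, and \<open>homs_extend_trans\<close> composes the levels.\<close>

lemma hom_extension:
  fixes A :: "'b::idom set"
  assumes "is_subring A"
  shows "\<exists>B. is_subring B \<and> A \<subseteq> B \<and> set xs \<subseteq> B \<and>
    (\<forall>v\<in>B. v \<noteq> 0 \<longrightarrow> (\<exists>u\<in>A. u \<noteq> 0 \<and> homs_extend A B u v))"
  using assms
proof (induction xs arbitrary: A)
  case Nil
  then show ?case by (intro exI[of _ A]) (auto simp: homs_extend_def)
next
  case (Cons x xs)
  let ?A = "adjoin A x"
  obtain B where B: "is_subring B" "?A \<subseteq> B" "set xs \<subseteq> B"
    and ext: "\<And>v. v \<in> B \<Longrightarrow> v \<noteq> 0 \<Longrightarrow> \<exists>u\<in>?A. u \<noteq> 0 \<and> homs_extend ?A B u v"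
    using Cons.IH[OF adjoin_subring[OF Cons.prems, of x]] by blast
  have AA: "A \<subseteq> ?A" "x \<in> ?A" using adjoin_base adjoin_gen Cons.prems by auto
  have "\<exists>u\<in>A. u \<noteq> 0 \<and> homs_extend A B u v" if v: "v \<in> B" "v \<noteq> 0" for v
  proof -
    obtain w where w: "w \<in> ?A" "w \<noteq> 0" and wv: "homs_extend ?A B w v"
      using ext[OF v] by blast
    obtain u where "u \<in> A" "u \<noteq> 0" "homs_extend A ?A u w"
      using hom_extension_step[OF Cons.prems w] by blast
    then show ?thesis using homs_extend_trans[OF _ wv AA(1)] by blast
  qed
  then show ?case using B AA by (intro exI[of _ B]) auto
qed

section \<open>Dominant polynomial maps: a large image, and dominance read off from a
  derivative\<close>

section \<open>Polynomial maps with algebraically independent components\<close>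

lemma mpols_1: "1 \<in> mpols V"
  by (simp add: mpols_def)

lemma poly_map_image:
  fixes \<Phi> :: "'v::linorder \<Rightarrow> ('v, complex) mpol"
  assumes fin: "finite V" and \<Phi>: "\<And>v. v \<in> V \<Longrightarrow> \<Phi> v \<in> mpols V"
    and indep: "\<And>F. F \<in> mpols V \<Longrightarrow> (\<And>x. eval_mpol F (\<lambda>v. eval_mpol (\<Phi> v) x) = 0) \<Longrightarrow> F = 0"
  obtains u where "u \<in> mpols V" "u \<noteq> 0"
    "\<And>y. eval_mpol u y \<noteq> 0 \<Longrightarrow> \<exists>x. \<forall>v\<in>V. eval_mpol (\<Phi> v) x = y v"
proof -
  define rep where "rep F b \<longleftrightarrow> F \<in> mpols V \<and>
    (\<forall>x. eval_mpol b x = eval_mpol F (\<lambda>v. eval_mpol (\<Phi> v) x))" for F b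
  define A where "A = {b. \<exists>F. rep F b}"
  define f where "f y b = eval_mpol (SOME F. rep F b) y" for y b
  have f: "f y b = eval_mpol F y" if "rep F b" for y F b
  proof -
    obtain F' where F': "F' = (SOME F. rep F b)" by blast
    have "rep F' b" unfolding F' using that by (rule someI)
    then have "F' - F = 0"
      using that by (intro indep) (auto simp: rep_def mpols_diff)
    then show ?thesis by (simp add: f_def F'[symmetric])
  qed
  have r1: "rep 1 1" by (simp add: rep_def mpols_1)
  have radd: "rep (F + G) (a + b)" "rep (F - G) (a - b)" "rep (F * G) (a * b)"
    if "rep F a" "rep G b" for F G a b
    using that by (auto simp: rep_def mpols_add mpols_diff mpols_mult)
  have A: "is_subring A"
    unfolding is_subring_def A_def using r1 radd by blast
  have hf: "hom_on A (f y)" for y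
    unfolding hom_on_def
  proof (intro conjI ballI)
    show "f y 1 = 1" using f[OF r1] by simp
  next
    fix a b assume "a \<in> A" "b \<in> A"
    then obtain F G where FG: "rep F a" "rep G b" by (auto simp: A_def)
    show "f y (a + b) = f y a + f y b" "f y (a * b) = f y a * f y b"
      using f[OF radd(1)[OF FG]] f[OF radd(3)[OF FG]] FG by (simp_all add: f)
  qed
  define X where "X v = single (single v (1::nat)) (1::complex)" for v :: 'v
  obtain xs where xs: "set xs = V" using fin finite_list by blast
  obtain B where B: "is_subring B" "A \<subseteq> B" "set (map X xs) \<subseteq> B"
    "\<And>v. v \<in> B \<Longrightarrow> v \<noteq> 0 \<Longrightarrow> \<exists>u\<in>A. u \<noteq> 0 \<and> homs_extend A B u v"
    using hom_extension[OF A, of "map X xs"] by blast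
  \<comment> \<open>Asking that 1 stays nonzero asks for the bare existence of an extension.\<close>
  from B(1) B(4)[of 1] obtain u0 where u0: "u0 \<in> A" "u0 \<noteq> 0" "homs_extend A B u0 1"
    by (auto simp: is_subring_def)
  obtain u where u: "rep u u0" using u0 by (auto simp: A_def)
  show thesis
  proof
    show "u \<in> mpols V" using u by (simp add: rep_def)
    show "u \<noteq> 0"
    proof
      assume "u = 0"
      then have "eval_mpol u0 x = eval_mpol 0 x" for x using u by (simp add: rep_def)
      then have "u0 = 0" by (rule mpol_eq_if_eval_eq)
      with u0 show False by simp
    qed
    fix y assume "eval_mpol u y \<noteq> 0"
    then have "f y u0 \<noteq> 0" using f[OF u] by simp
    with u0(3) hf obtain g where g: "hom_on B g" "\<forall>a\<in>A. g a = f y a"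
      unfolding homs_extend_def by blast
    define x where "x v = g (X v)" for v
    \<comment> \<open>Homomorphisms are only required to respect the ring operations; the constants
      are fixed because they lie in \<open>A\<close>, where \<open>f y\<close> fixes them.\<close>
    have gc: "single 0 c \<in> B \<and> g (single 0 c) = c" for c
    proof -
      have "rep (single 0 c) (single 0 c)" by (simp add: rep_def mpols_single)
      then have "single 0 c \<in> A" "f y (single 0 c) = c" using f[of "single 0 c"] by (auto simp: A_def)
      then show ?thesis using g B by auto
    qed
    have gm: "single a 1 \<in> B \<and> g (single a 1) = monom_val x a" if "keys a \<subseteq> V" for a
      using that
    proof (induction a rule: expvec_induct)
      case zero
      then show ?case using gc[of 1] by simp
    next
      case (add a v)
      then have "single a 1 \<in> B" "g (single a 1) = monom_val x a" "v \<in> V"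
        by (auto simp: keys_add_nat)
      moreover have "X v \<in> B" using \<open>v \<in> V\<close> B xs by auto
      moreover have "single (a + single v 1) (1::complex) = single a 1 * X v"
        by (simp add: X_def mult_single)
      moreover have "g (X v) = x v" by (simp add: x_def)
      ultimately show ?case using g(1) B(1)
        by (auto simp: hom_on_def monom_val_add is_subring_def simp del: One_nat_def)
    qed
    have gF: "g F = eval_mpol F x" if "F \<in> mpols V" for F
    proof -
      have *: "single 0 (lookup F a) * single a 1 \<in> B"
        "g (single 0 (lookup F a) * single a 1) = lookup F a * monom_val x a" if "a \<in> keys F" for a
        using gc gm[of a] \<open>F \<in> mpols V\<close> that B(1) g(1)
        by (auto simp: is_subring_def mpols_def hom_on_def)
      have "(\<Sum>a\<in>keys F. single 0 (lookup F a) * single a 1) = F"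
        unfolding mult_single by (simp flip: mpol_sum_single)
      then have "g F = g (\<Sum>a\<in>keys F. single 0 (lookup F a) * single a 1)" by simp
      also have "\<dots> = (\<Sum>a\<in>keys F. g (single 0 (lookup F a) * single a 1))"
        by (rule hom_on_sum[OF B(1) g(1)]) (rule *)
      finally show ?thesis using * by (simp add: eval_mpol_superset[of "keys F"])
    qed
    have "eval_mpol (\<Phi> v) x = y v" if "v \<in> V" for v
    proof -
      have "rep (X v) (\<Phi> v)" using that by (auto simp: rep_def X_def mpols_single)
      then have "\<Phi> v \<in> A" "f y (\<Phi> v) = y v" using f[of "X v" "\<Phi> v" y] by (auto simp: A_def X_def)
      then have "g (\<Phi> v) = y v" using g by simp
      then show ?thesis using gF \<Phi> that by simp
    qed
    then show "\<exists>x. \<forall>v\<in>V. eval_mpol (\<Phi> v) x = y v" by blast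
  qed
qed

lemma tendsto_eval_mpol:
  fixes F :: "('v, complex) mpol"
  assumes "F \<in> mpols V" "\<And>v. v \<in> V \<Longrightarrow> (y v \<longlongrightarrow> t v) net"
  shows "((\<lambda>\<epsilon>. eval_mpol F (\<lambda>v. y v \<epsilon>)) \<longlongrightarrow> eval_mpol F t) net"
  unfolding eval_mpol_def using assms
  by (auto simp: mpols_def subset_iff intro!: tendsto_sum tendsto_mult tendsto_prod tendsto_power)

text \<open>Recentre a relation \<open>F\<close> at the value of the map at 0, obtaining
  \<open>G\<close>, with lowest nonzero component of degree \<open>k\<close>. Along the line through
  \<open>t\<close> the map is the centre plus \<open>\<epsilon> * y\<close> with \<open>y\<close>
  tending to \<open>t\<close>. Dividing the relation by \<open>\<epsilon> ^ k\<close> and letting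
  \<epsilon> tend to 0 shows that this component vanishes at \<open>t\<close>, for every
  \<open>t\<close>.\<close>

lemma independent_if_deriv_id:
  fixes F :: "('v, complex) mpol" and \<phi> :: "'v \<Rightarrow> ('v \<Rightarrow> complex) \<Rightarrow> complex"
  assumes fin: "finite V" and F: "F \<in> mpols V"
    and der: "\<And>v t. v \<in> V \<Longrightarrow> ((\<lambda>\<epsilon>. \<phi> v (\<lambda>w. \<epsilon> * t w)) has_field_derivative t v) (at 0)"
    and zero: "\<And>x. eval_mpol F (\<lambda>v. \<phi> v x) = 0"
  shows "F = 0"
proof (rule ccontr)
  assume "F \<noteq> 0"
  then obtain x0 where x0: "eval_mpol F x0 \<noteq> 0" using mpol_nonzero_eval F fin by blast
  define c where "c v = \<phi> v (\<lambda>_. 0)" for v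
  have "polyfun V (\<lambda>y. eval_mpol F (\<lambda>v. c v + y v))"
    using F by (intro polyfun_subst polyfun_add polyfun_const polyfun_var)
  then obtain G where G: "G \<in> mpols V" "\<And>y. eval_mpol F (\<lambda>v. c v + y v) = eval_mpol G y"
    unfolding polyfun_def by (auto dest: fun_cong)
  have "G \<noteq> 0" using G(2)[of "\<lambda>v. x0 v - c v"] x0 by auto
  then obtain a0 where "a0 \<in> keys G" by (meson all_not_in_conv keys_eq_empty)
  then obtain a where a: "a \<in> keys G" and amin: "\<And>b. b \<in> keys G \<Longrightarrow> mdeg a \<le> mdeg b"
    using ex_has_least_nat[of "\<lambda>a. a \<in> keys G" a0 mdeg] by blast
  define k where "k = mdeg a"
  obtain K where K: "\<And>b. b \<in> keys G \<Longrightarrow> mdeg b \<le> K" using mdeg_bounded by blast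
  have hp: "hpart e G \<in> forms V e" "hpart e G \<in> mpols V" for e
    using hpart_forms[OF G(1)] forms_mpols by blast+
  have "hpart k G \<noteq> 0" using a by (metis in_keys_iff k_def lookup_hpart lookup_zero)
  then obtain t where t: "eval_mpol (hpart k G) t \<noteq> 0" using mpol_nonzero_eval hp fin by blast
  have low: "hpart e G = 0" if "e < k" for e
    by (rule poly_mapping_eqI) (use amin that in \<open>fastforce simp: lookup_hpart in_keys_iff k_def\<close>)
  define y where "y v \<epsilon> = (\<phi> v (\<lambda>w. \<epsilon> * t w) - c v) / \<epsilon>" for v \<epsilon>
  define S where "S \<epsilon> = (\<Sum>e\<in>{k..K}. \<epsilon> ^ (e - k) * eval_mpol (hpart e G) (\<lambda>v. y v \<epsilon>))" for \<epsilon>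
  have "S \<epsilon> = 0" if "\<epsilon> \<noteq> 0" for \<epsilon>
  proof -
    have "0 = eval_mpol F (\<lambda>v. c v + \<epsilon> * y v \<epsilon>)"
      using zero[of "\<lambda>w. \<epsilon> * t w"] that by (simp add: y_def)
    also have "\<dots> = eval_mpol G (\<lambda>v. \<epsilon> * y v \<epsilon>)" by (rule G)
    also have "\<dots> = (\<Sum>e\<le>K. eval_mpol (hpart e G) (\<lambda>v. \<epsilon> * y v \<epsilon>))"
      using sum_hpart[OF K] by (metis eval_mpol_sum)
    also have "\<dots> = (\<Sum>e\<le>K. \<epsilon> ^ e * eval_mpol (hpart e G) (\<lambda>v. y v \<epsilon>))"
      by (intro sum.cong refl eval_form_scale[OF hp(1)])
    also have "\<dots> = (\<Sum>e\<in>{k..K}. \<epsilon> ^ e * eval_mpol (hpart e G) (\<lambda>v. y v \<epsilon>))"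
      by (rule sum.mono_neutral_right) (use low in auto)
    also have "\<dots> = \<epsilon> ^ k * S \<epsilon>"
      unfolding S_def sum_distrib_left
      by (intro sum.cong refl) (simp add: power_add[symmetric] flip: mult.assoc)
    finally show ?thesis using that by simp
  qed
  then have "eventually (\<lambda>\<epsilon>. S \<epsilon> = 0) (at 0)" by (auto simp: eventually_at intro: exI[of _ 1])
  then have lim0: "(S \<longlongrightarrow> 0) (at 0)" by (rule tendsto_eventually)
  have "(y v \<longlongrightarrow> t v) (at 0)" if "v \<in> V" for v
    using der[OF that, of t] unfolding has_field_derivative_iff y_def c_def by simp
  then have "((\<lambda>\<epsilon>. eval_mpol (hpart e G) (\<lambda>v. y v \<epsilon>)) \<longlongrightarrow> eval_mpol (hpart e G) t) (at 0)" for e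
    by (intro tendsto_eval_mpol[OF hp(2)]) auto
  then have "(S \<longlongrightarrow> (\<Sum>e\<in>{k..K}. 0 ^ (e - k) * eval_mpol (hpart e G) t)) (at 0)"
    unfolding S_def by (intro tendsto_sum tendsto_mult tendsto_power tendsto_ident_at)
  moreover have "(\<Sum>e\<in>{k..K}. 0 ^ (e - k) * eval_mpol (hpart e G) t) = eval_mpol (hpart k G) t"
  proof -
    have "k \<in> {k..K}" using K[OF a] by (simp add: k_def)
    then have "(\<Sum>e\<in>{k..K}. 0 ^ (e - k) * eval_mpol (hpart e G) t) =
        (\<Sum>e\<in>{k}. 0 ^ (e - k) * eval_mpol (hpart e G) t)"
      by (intro sum.mono_neutral_right) (auto simp: power_0_left)
    then show ?thesis by simp
  qed
  ultimately have "eval_mpol (hpart k G) t = 0"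
    using lim0 tendsto_unique[of "at (0::complex)" S] by simp
  with t show False ..
qed

section \<open>More polynomials than variables: a relation found by counting\<close>

section \<open>Algebraic dependence\<close>

lemma homogeneous_system_solvable:
  fixes m :: "'j \<Rightarrow> 'i \<Rightarrow> 'a::field"
  assumes "finite J" "finite I" "card J < card I"
  shows "\<exists>z. (\<exists>i\<in>I. z i \<noteq> 0) \<and> (\<forall>j\<in>J. (\<Sum>i\<in>I. m j i * z i) = 0)"
  using assms
proof (induction J arbitrary: I m rule: finite_induct)
  case empty
  then show ?case by (intro exI[of _ "\<lambda>_. 1"]) (auto simp: card_gt_0_iff)
next
  case (insert j J)
  show ?case
  proof (cases "\<forall>i\<in>I. m j i = 0")
    case True
    have "card J < card I" using insert by simp
    from insert.IH[OF insert.prems(1) this, of m] obtain z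
      where "\<exists>i\<in>I. z i \<noteq> 0" "\<forall>j\<in>J. (\<Sum>i\<in>I. m j i * z i) = 0" by blast
    with True show ?thesis by (intro exI[of _ z]) simp
  next
    case False
    then obtain i0 where i0: "i0 \<in> I" "m j i0 \<noteq> 0" by blast
    define I' where "I' = I - {i0}"
    have I': "finite I'" "i0 \<notin> I'" "I = insert i0 I'" "card J < card I'"
      using insert i0 by (auto simp: I'_def)
    from insert.IH[OF I'(1,4), of "\<lambda>j' i. m j' i - m j' i0 * m j i / m j i0"]
    obtain z where z: "\<exists>i\<in>I'. z i \<noteq> 0"
      "\<And>j'. j' \<in> J \<Longrightarrow> (\<Sum>i\<in>I'. (m j' i - m j' i0 * m j i / m j i0) * z i) = 0" by blast
    define w where "w = - (\<Sum>i\<in>I'. m j i * z i) / m j i0"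
    define z' where "z' = z(i0 := w)"
    have sum: "(\<Sum>i\<in>I. m j' i * z' i) = m j' i0 * w + (\<Sum>i\<in>I'. m j' i * z i)" for j'
    proof -
      have "(\<Sum>i\<in>I'. m j' i * z' i) = (\<Sum>i\<in>I'. m j' i * z i)"
        using I' by (intro sum.cong) (auto simp: z'_def)
      then show ?thesis using I' by (simp add: z'_def)
    qed
    have "(\<Sum>i\<in>I. m j' i * z' i) = 0" if "j' \<in> insert j J" for j'
    proof (cases "j' = j")
      case True
      then show ?thesis using i0 unfolding sum w_def by simp
    next
      case False
      then have "0 = (\<Sum>i\<in>I'. (m j' i - m j' i0 * m j i / m j i0) * z i)" using z that by simp
      also have "\<dots> = (\<Sum>i\<in>I'. m j' i * z i) - m j' i0 / m j i0 * (\<Sum>i\<in>I'. m j i * z i)"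
        by (simp add: algebra_simps sum_subtractf sum_distrib_left)
      also have "\<dots> = (\<Sum>i\<in>I. m j' i * z' i)" unfolding sum w_def by simp
      finally show ?thesis by simp
    qed
    moreover have "\<exists>i\<in>I. z' i \<noteq> 0" using z(1) I' by (auto simp: z'_def)
    ultimately show ?thesis by blast
  qed
qed

definition box :: "'v set \<Rightarrow> nat \<Rightarrow> ('v \<Rightarrow>\<^sub>0 nat) set" where
  "box V r = {a. keys a \<subseteq> V \<and> (\<forall>v. lookup a v \<le> r)}"

lemma finite_box: "finite V \<Longrightarrow> finite (box V r)"
  unfolding box_def by (rule finite_expvecs_le)

lemma card_box:
  assumes "finite V"
  shows "card (box V r) = (r + 1) ^ card V"
proof -
  have "bij_betw (\<lambda>a. restrict (lookup a) V) (box V r) (PiE V (\<lambda>_. {..r}))"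
  proof (rule bij_betwI')
    fix a b assume ab: "a \<in> box V r" "b \<in> box V r"
    show "(restrict (lookup a) V = restrict (lookup b) V) = (a = b)"
    proof
      assume eq: "restrict (lookup a) V = restrict (lookup b) V"
      show "a = b"
      proof (rule poly_mapping_eqI)
        fix v
        show "lookup a v = lookup b v"
          by (cases "v \<in> V") (metis eq restrict_apply', metis (mono_tags) ab box_def in_keys_iff mem_Collect_eq subsetD)
      qed
    qed auto
  next
    fix g assume g: "g \<in> PiE V (\<lambda>_. {..r})"
    define a where "a = (\<Sum>v\<in>V. single v (g v))"
    have l: "lookup a v = (if v \<in> V then g v else 0)" for v
      using assms by (auto simp: a_def lookup_sum lookup_single when_def sum.delta')
    show "\<exists>a\<in>box V r. g = restrict (lookup a) V"
    proof
      show "a \<in> box V r" using g l by (auto simp: box_def in_keys_iff split: if_splits)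
      show "g = restrict (lookup a) V" using g l by (auto simp: fun_eq_iff PiE_def extensional_def)
    qed
  qed (auto simp: box_def)
  then have "card (box V r) = card (PiE V (\<lambda>_. {..r}))" by (rule bij_betw_same_card)
  then show ?thesis using assms by (simp add: card_PiE)
qed

definition mpols_le :: "'v set \<Rightarrow> nat \<Rightarrow> ('v, 'a::zero) mpol set" where
  "mpols_le V K = {F. \<forall>a\<in>keys F. keys a \<subseteq> V \<and> mdeg a \<le> K}"

lemma mpols_le_mult: "F \<in> mpols_le V K \<Longrightarrow> G \<in> mpols_le V L \<Longrightarrow> F * G \<in> mpols_le V (K + L)"
  unfolding mpols_le_def using keys_mult[of F G]
  by (fastforce simp: keys_add_nat mdeg_add intro: add_mono)

lemma mpols_le_1: "1 \<in> mpols_le V K"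
  by (simp add: mpols_le_def)

lemma mpols_le_mono: "K \<le> L \<Longrightarrow> mpols_le V K \<subseteq> mpols_le V L"
  by (force simp: mpols_le_def)

lemma mpols_le_power: "F \<in> mpols_le V K \<Longrightarrow> F ^ r \<in> mpols_le V (K * r)"
  by (induction r) (auto simp: mpols_le_1 mpols_le_mult)

lemma mpols_le_prod:
  "(\<And>i. i \<in> A \<Longrightarrow> F i \<in> mpols_le V (k i)) \<Longrightarrow> prod F A \<in> mpols_le V (sum k A)"
  by (induction A rule: infinite_finite_induct) (auto simp: mpols_le_1 mpols_le_mult)

text \<open>The monomials in the \<open>\<Phi> v\<close> with exponents up to \<open>r\<close>
  number \<open>(r + 1) ^ card V\<close>, while they lie in a space of dimension
  \<open>(K * D * r + 1) ^ card P\<close>. For large \<open>r\<close> the former number wins, so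
  they are linearly dependent.\<close>

lemma algebraically_dependent:
  fixes \<Phi> :: "'v \<Rightarrow> ('p, 'a::field) mpol"
  assumes fin: "finite V" "finite P" and less: "card P < card V"
    and \<Phi>: "\<And>v. v \<in> V \<Longrightarrow> \<Phi> v \<in> mpols P"
  shows "\<exists>F\<in>mpols V. F \<noteq> 0 \<and> (\<forall>x. eval_mpol F (\<lambda>v. eval_mpol (\<Phi> v) x) = 0)"
proof -
  obtain K where K: "\<And>v. v \<in> V \<Longrightarrow> \<Phi> v \<in> mpols_le P K"
  proof -
    have "\<exists>k. \<Phi> v \<in> mpols_le P k" if "v \<in> V" for v
      using \<Phi>[OF that] mdeg_bounded[of "\<Phi> v"] by (auto simp: mpols_def mpols_le_def)
    then obtain k where k: "\<And>v. v \<in> V \<Longrightarrow> \<Phi> v \<in> mpols_le P (k v)" by metis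
    have "\<Phi> v \<in> mpols_le P (sum k V)" if "v \<in> V" for v
      using k[OF that] mpols_le_mono[of "k v" "sum k V"] member_le_sum[of v V k] fin that by blast
    then show ?thesis using that by blast
  qed
  define m where "m = card P"
  define D where "D = card V"
  \<comment> \<open>Chosen so that the dimension, bounded by
    \<open>(K * D + 1) ^ m * (r + 1) ^ m\<close>, is at most \<open>r * (r + 1) ^ m\<close>, which
    is below \<open>(r + 1) ^ Suc m\<close>.\<close>
  define r where "r = (K * D + 1) ^ m"
  define \<Psi> where "\<Psi> a = (\<Prod>v\<in>keys a. \<Phi> v ^ lookup a v)" for a :: "'v \<Rightarrow>\<^sub>0 nat"
  have \<Psi>: "\<Psi> a \<in> mpols_le P (K * D * r)" if a: "a \<in> box V r" for a
  proof -
    have "\<Psi> a \<in> mpols_le P (\<Sum>v\<in>keys a. K * lookup a v)"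
      unfolding \<Psi>_def using a K by (intro mpols_le_prod mpols_le_power) (auto simp: box_def)
    moreover have "(\<Sum>v\<in>keys a. K * lookup a v) \<le> (\<Sum>v\<in>V. K * r)"
      using a fin by (intro order_trans[OF sum_mono sum_mono2]) (auto simp: box_def)
    ultimately show ?thesis using mpols_le_mono by (fastforce simp: D_def mult_ac)
  qed
  have "card (box P (K * D * r)) = (K * D * r + 1) ^ m"
    using fin by (simp add: card_box m_def)
  also have "\<dots> \<le> ((K * D + 1) * (r + 1)) ^ m"
    by (intro power_mono) (auto simp: algebra_simps)
  also have "\<dots> = r * (r + 1) ^ m" by (simp only: power_mult_distrib flip: r_def)
  also have "\<dots> < (r + 1) ^ Suc m" by (simp add: r_def)
  also have "\<dots> \<le> (r + 1) ^ D" using less by (intro power_increasing) (auto simp: m_def D_def)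
  also have "\<dots> = card (box V r)" using fin by (simp add: card_box D_def)
  finally have cards: "card (box P (K * D * r)) < card (box V r)" .
  from homogeneous_system_solvable[OF finite_box finite_box this, of "\<lambda>b a. lookup (\<Psi> a) b"] fin
  obtain z where z: "\<exists>a\<in>box V r. z a \<noteq> 0"
    "\<And>b. b \<in> box P (K * D * r) \<Longrightarrow> (\<Sum>a\<in>box V r. lookup (\<Psi> a) b * z a) = 0" by blast
  define F where "F = (\<Sum>a\<in>box V r. single a (z a))"
  have lF: "lookup F a = (if a \<in> box V r then z a else 0)" for a
    using fin finite_box[of V r] by (auto simp: F_def lookup_sum lookup_single when_def sum.delta')
  show ?thesis
  proof (intro bexI[of _ F] conjI allI)
    show "F \<in> mpols V" unfolding F_def by (intro mpols_sum mpols_single) (auto simp: box_def)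
    show "F \<noteq> 0" using z(1) lF by (metis lookup_zero)
    fix x
    have "eval_mpol F (\<lambda>v. eval_mpol (\<Phi> v) x) = (\<Sum>a\<in>box V r. z a * eval_mpol (\<Psi> a) x)"
      by (simp add: F_def \<Psi>_def monom_val_def)
    also have "\<dots> = (\<Sum>a\<in>box V r. \<Sum>b\<in>box P (K * D * r). z a * (lookup (\<Psi> a) b * monom_val x b))"
    proof (intro sum.cong refl)
      fix a assume "a \<in> box V r"
      then have "keys (\<Psi> a) \<subseteq> box P (K * D * r)"
        using \<Psi>[of a] lookup_le_mdeg by (fastforce simp: mpols_le_def box_def intro: order_trans)
      then show "z a * eval_mpol (\<Psi> a) x =
          (\<Sum>b\<in>box P (K * D * r). z a * (lookup (\<Psi> a) b * monom_val x b))"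
        using fin finite_box[of P] by (simp add: eval_mpol_superset[of "box P (K * D * r)"] sum_distrib_left)
    qed
    also have "\<dots> = (\<Sum>b\<in>box P (K * D * r). (\<Sum>a\<in>box V r. lookup (\<Psi> a) b * z a) * monom_val x b)"
      by (subst sum.swap) (simp add: sum_distrib_left sum_distrib_right mult_ac)
    also have "\<dots> = 0" using z(2) by simp
    finally show "eval_mpol F (\<lambda>v. eval_mpol (\<Phi> v) x) = 0" .
  qed
qed

section \<open>Apolarity: operators acting as shifts of coordinates\<close>

section \<open>Codimension one forms in divided power coordinates\<close>

definition expfact :: "('v \<Rightarrow>\<^sub>0 nat) \<Rightarrow> complex" where
  "expfact b = (\<Prod>v\<in>keys b. fact (lookup b v))"

text \<open>Coordinates for the divided powers \<open>X^b / b!\<close>. In them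
  \<open>partial k\<close> shifts the index by \<open>single k 1\<close>, and the
  \<open>d\<close>-th power of the linear form with coefficient vector \<open>p\<close> has the
  coordinates \<open>monom_val p b\<close>, up to the factor \<open>d!\<close>.\<close>

definition dcoef :: "('v, complex) mpol \<Rightarrow> ('v \<Rightarrow>\<^sub>0 nat) \<Rightarrow> complex" where
  "dcoef f b = expfact b * lookup f b"

lemma expfact_nonzero [simp]: "expfact b \<noteq> 0"
  by (simp add: expfact_def)

lemma expfact_add_single: "expfact (b + single k 1) = of_nat (lookup b k + 1) * expfact b"
proof -
  let ?A = "insert k (keys b)"
  have *: "expfact a = (\<Prod>v\<in>?A. fact (lookup a v))" if "keys a \<subseteq> ?A" for a
    unfolding expfact_def using that
    by (intro prod.mono_neutral_left) (auto simp: in_keys_iff)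
  have "expfact (b + single k 1) =
      (\<Prod>v\<in>?A. (if v = k then of_nat (lookup b k + 1) else 1) * fact (lookup b v))"
    by (subst *) (auto simp: keys_add_nat lookup_add lookup_single when_def intro!: prod.cong)
  also have "\<dots> = of_nat (lookup b k + 1) * expfact b"
    by (simp only: prod.distrib *[of b, OF subset_insertI] prod.delta finite_insert finite_keys) simp
  finally show ?thesis .
qed

lemma lookup_smul: "lookup (smul c f) b = c * lookup f b"
  unfolding smul_def mult_map_scale_conv_mult[symmetric]
  by (transfer) (simp add: when_def)

lemma lookup_partial: "lookup (partial i f) b = of_nat (lookup b i + 1) * lookup f (b + single i 1)"
proof -
  let ?b = "b + single i 1"
  have iff: "b' - single i 1 = b \<longleftrightarrow> b' = ?b" if "lookup b' i \<noteq> 0" for b'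
  proof
    assume "b' - single i 1 = b"
    then have "lookup b' j = lookup ?b j" for j
      using that by (auto simp: lookup_add lookup_minus lookup_single when_def)
    then show "b' = ?b" by (rule poly_mapping_eqI)
  qed simp
  have "lookup (partial i f) b =
      (\<Sum>b'\<in>keys f. if b' = ?b then of_nat (lookup b' i) * lookup f b' else 0)"
    unfolding partial_def lookup_sum
  proof (rule sum.cong[OF refl])
    fix b'
    show "lookup (single (b' - single i 1) (of_nat (lookup b' i) * lookup f b')) b =
        (if b' = ?b then of_nat (lookup b' i) * lookup f b' else 0)"
      using iff[of b'] by (cases "lookup b' i = 0") (auto simp: lookup_single when_def)
  qed
  also have "\<dots> = of_nat (lookup b i + 1) * lookup f ?b"
    by (simp add: sum.delta' in_keys_iff lookup_add lookup_single)
  finally show ?thesis .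
qed

lemma dcoef_partial: "dcoef (partial k f) b = dcoef f (b + single k 1)"
  by (simp only: dcoef_def lookup_partial expfact_add_single) (simp add: mult_ac)

lemma single_1_inj [simp]:
  "single x (1::nat) = single y 1 \<longleftrightarrow> x = y" "single x (Suc 0) = single y (Suc 0) \<longleftrightarrow> x = y"
  by (metis keys_single nat.distinct(1) One_nat_def singleton_inject)+

lemma monomials_1: "monomials V 1 = (\<lambda>k. single k 1) ` V"
proof (intro equalityI subsetI)
  fix a assume a: "a \<in> monomials V 1"
  then have "keys a \<noteq> {}" by (auto simp: monomials_def)
  then obtain k where k: "k \<in> keys a" by blast
  define b where "b = a - single k 1"
  have ab: "a = b + single k 1"
    by (rule poly_mapping_eqI)
      (use k in \<open>auto simp: b_def lookup_add lookup_minus lookup_single when_def in_keys_iff\<close>)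
  then have "mdeg b = 0" using a by (simp add: monomials_def mdeg_add)
  then show "a \<in> (\<lambda>k. single k 1) ` V" using ab k a by (auto simp: monomials_def)
qed (auto simp: monomials_def)

lemma dcoef_diff_act:
  assumes "L \<in> forms {..n} 1"
  shows "dcoef (diff_act L f) b = (\<Sum>k\<le>n. lookup L (single k 1) * dcoef f (b + single k 1))"
proof -
  have fin: "finite (monomials {..n} 1)" by (intro finite_monomials) auto
  have "diff_act L f = (\<Sum>a\<in>monomials {..n} 1. smul (lookup L a) (partial_monom a f))"
    unfolding diff_act_def using assms fin
    by (intro sum.mono_neutral_left) (auto simp: forms_def in_keys_iff smul_def)
  also have "\<dots> = (\<Sum>k\<le>n. smul (lookup L (single k 1)) (partial_monom (single k 1) f))"
    unfolding monomials_1 by (subst sum.reindex) (auto simp: inj_on_def simp del: One_nat_def)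
  finally have "diff_act L f = (\<Sum>k\<le>n. smul (lookup L (single k 1)) (partial k f))"
    by (simp add: partial_monom_def)
  then have "dcoef (diff_act L f) b = (\<Sum>k\<le>n. lookup L (single k 1) * dcoef (partial k f) b)"
    by (simp add: dcoef_def lookup_sum lookup_smul sum_distrib_left mult_ac)
  then show ?thesis unfolding dcoef_partial .
qed

lemma dcoef_eq_0_iff: "(\<forall>b. dcoef f b = 0) \<longleftrightarrow> f = 0"
  by (auto simp: dcoef_def intro!: poly_mapping_eqI)

lemma codim_one_form_iff:
  "codim_one_form n d g \<longleftrightarrow> g \<in> S_piece n d \<and>
    (\<exists>l. (\<exists>k\<le>n. l k \<noteq> 0) \<and> (\<forall>b. (\<Sum>k\<le>n. l k * dcoef g (b + single k 1)) = 0))"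
proof -
  have "(\<exists>L\<in>T_piece n 1. L \<noteq> 0 \<and> diff_act L g = 0) \<longleftrightarrow>
    (\<exists>l. (\<exists>k\<le>n. l k \<noteq> 0) \<and> (\<forall>b. (\<Sum>k\<le>n. l k * dcoef g (b + single k 1)) = 0))"
    (is "?A \<longleftrightarrow> ?B")
  proof
    assume ?A
    then obtain L where L: "L \<in> T_piece n 1" "L \<noteq> 0" "diff_act L g = 0" by blast
    obtain a where "a \<in> keys L" using L(2) by (meson all_not_in_conv keys_eq_empty)
    then have "\<exists>k\<le>n. lookup L (single k 1) \<noteq> 0"
      using L(1) unfolding forms_def monomials_1 by (auto simp: in_keys_iff)
    moreover have "\<forall>b. (\<Sum>k\<le>n. lookup L (single k 1) * dcoef g (b + single k 1)) = 0"
      unfolding dcoef_diff_act[OF L(1), symmetric] using L(3) by (simp add: dcoef_def)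
    ultimately show ?B by (intro exI[of _ "\<lambda>k. lookup L (single k 1)"]) simp
  next
    assume ?B
    then obtain l k0 where l: "k0 \<le> n" "l k0 \<noteq> 0"
      "\<And>b. (\<Sum>k\<le>n. l k * dcoef g (b + single k 1)) = 0" by blast
    define L where "L = (\<Sum>k\<le>n. single (single k (1::nat)) (l k))"
    have L: "L \<in> forms {..n} 1"
      unfolding L_def monomials_1[of "{..n}", symmetric]
      by (intro forms_sum forms_single) (simp add: monomials_1 del: One_nat_def)
    have lk: "lookup L (single k 1) = l k" if "k \<le> n" for k
    proof -
      have "lookup L (single k 1) = (\<Sum>i\<le>n. if i = k then l i else 0)"
        unfolding L_def lookup_sum by (intro sum.cong) (auto simp: lookup_single when_def)
      then show ?thesis using that by simp
    qed
    have "dcoef (diff_act L g) b = 0" for b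
      unfolding dcoef_diff_act[OF L] using l(3)[of b] lk by simp
    then have "diff_act L g = 0" using dcoef_eq_0_iff by blast
    moreover have "L \<noteq> 0" using lk[OF l(1)] l(2) by auto
    ultimately show ?A using L by blast
  qed
  then show ?thesis unfolding codim_one_form_def by blast
qed

lemma card_monomials: "card (monomials {..n} e) = (e + n) choose n"
proof (induction n arbitrary: e)
  case 0
  have "monomials {..0::nat} e = {single 0 e}"
  proof (intro equalityI subsetI)
    fix a assume a: "a \<in> monomials {..0::nat} e"
    then have "keys a \<subseteq> {0}" by (auto simp: monomials_def)
    moreover from this have "lookup a 0 = e" using a mdeg_superset[of "{0}" a]
      by (auto simp: monomials_def)
    ultimately have "a = single 0 e"
      by (intro poly_mapping_eqI) (auto simp: lookup_single when_def in_keys_iff subset_iff)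
    then show "a \<in> {single 0 e}" by simp
  qed (auto simp: monomials_def)
  then show ?case by simp
next
  case (Suc n)
  show ?case
  proof (induction e)
    case 0
    have "monomials {..Suc n} 0 = {0}" by (auto simp: monomials_def)
    then show ?case by simp
  next
    case (Suc e)
    let ?g = "\<lambda>a. a + single (Suc n) (1::nat)"
    have un: "monomials {..Suc n} (Suc e) = monomials {..n} (Suc e) \<union> ?g ` monomials {..Suc n} e"
    proof (intro equalityI subsetI)
      fix a assume a: "a \<in> monomials {..Suc n} (Suc e)"
      show "a \<in> monomials {..n} (Suc e) \<union> ?g ` monomials {..Suc n} e"
      proof (cases "lookup a (Suc n) = 0")
        case True
        then have "Suc n \<notin> keys a" by (simp add: in_keys_iff)
        then show ?thesis using a by (auto simp: monomials_def subset_iff le_Suc_eq)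
      next
        case False
        define b where "b = a - single (Suc n) 1"
        have ab: "a = b + single (Suc n) 1"
          by (rule poly_mapping_eqI)
            (use False in \<open>auto simp: b_def lookup_add lookup_minus lookup_single when_def\<close>)
        then have "b \<in> monomials {..Suc n} e"
          using a by (auto simp: monomials_def mdeg_add keys_add_nat)
        then show ?thesis using ab by blast
      qed
    qed (auto simp: monomials_def mdeg_add keys_add_nat le_Suc_eq subset_iff)
    have disj: "monomials {..n} (Suc e) \<inter> ?g ` monomials {..Suc n} e = {}"
      by (auto simp: monomials_def keys_add_nat)
    have "card (monomials {..Suc n} (Suc e)) =
        card (monomials {..n} (Suc e)) + card (monomials {..Suc n} e)"
      unfolding un by (subst card_Un_disjoint[OF _ _ disj])
        (auto intro!: finite_monomials finite_imageI card_image inj_onI)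
    then show ?case using Suc.IH \<open>\<And>e. card (monomials {..n} e) = (e + n choose n)\<close> by simp
  qed
qed

section \<open>Few summands: the sums satisfy a polynomial relation\<close>

section \<open>Too few summands\<close>

text \<open>A function \<kappa> selects one term from each factor, so the outer sum is the expanded
  product of the operators. For the summand \<open>c i0\<close>, summing over the choice at
  \<open>i0\<close> first applies the operator that kills it.\<close>

lemma product_of_annihilators:
  fixes l :: "nat \<Rightarrow> nat \<Rightarrow> complex" and c :: "nat \<Rightarrow> (nat \<Rightarrow>\<^sub>0 nat) \<Rightarrow> complex"
  assumes kill: "\<And>i b. i < s \<Longrightarrow> (\<Sum>k\<le>n. l i k * c i (b + single k 1)) = 0"
  shows "(\<Sum>\<kappa>\<in>PiE {..<s} (\<lambda>_. {..n}). (\<Prod>i<s. l i (\<kappa> i)) *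
    (\<Sum>i<s. c i (m + (\<Sum>i<s. single (\<kappa> i) 1)))) = 0"
proof -
  have "(\<Sum>\<kappa>\<in>PiE {..<s} (\<lambda>_. {..n}). (\<Prod>i<s. l i (\<kappa> i)) * c i0 (m + (\<Sum>i<s. single (\<kappa> i) 1))) = 0"
    if i0: "i0 < s" for i0
  proof -
    define I where "I = {..<s} - {i0}"
    have I: "{..<s} = insert i0 I" "i0 \<notin> I" "finite I" using i0 by (auto simp: I_def)
    let ?h = "\<lambda>\<kappa>. (\<Prod>i<s. l i (\<kappa> i)) * c i0 (m + (\<Sum>i<s. single (\<kappa> i) 1))"
    have "sum ?h (PiE {..<s} (\<lambda>_. {..n})) =
        (\<Sum>(k, \<kappa>)\<in>{..n} \<times> PiE I (\<lambda>_. {..n}). ?h (\<kappa>(i0 := k)))"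
    proof -
      have "PiE {..<s} (\<lambda>_. {..n}) = (\<lambda>(k, \<kappa>). \<kappa>(i0 := k)) ` ({..n} \<times> PiE I (\<lambda>_. {..n}))"
        by (simp only: I(1) PiE_insert_eq)
      moreover have "inj_on (\<lambda>(k, \<kappa>). \<kappa>(i0 := k)) ({..n} \<times> PiE I (\<lambda>_. {..n}))"
        by (rule inj_combinator[OF I(2)])
      ultimately show ?thesis
        by (simp only: sum.reindex comp_def case_prod_unfold)
    qed
    also have "\<dots> = (\<Sum>k\<le>n. \<Sum>\<kappa>\<in>PiE I (\<lambda>_. {..n}). ?h (\<kappa>(i0 := k)))"
      by (rule sum.cartesian_product[symmetric])
    also have "\<dots> = (\<Sum>\<kappa>\<in>PiE I (\<lambda>_. {..n}). \<Sum>k\<le>n. ?h (\<kappa>(i0 := k)))"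
      by (rule sum.swap)
    also have "\<dots> = (\<Sum>\<kappa>\<in>PiE I (\<lambda>_. {..n}). (\<Prod>i\<in>I. l i (\<kappa> i)) *
        (\<Sum>k\<le>n. l i0 k * c i0 ((m + (\<Sum>i\<in>I. single (\<kappa> i) 1)) + single k 1)))"
    proof (rule sum.cong[OF refl])
      fix \<kappa>
      have "?h (\<kappa>(i0 := k)) = (\<Prod>i\<in>I. l i (\<kappa> i)) *
        (l i0 k * c i0 ((m + (\<Sum>i\<in>I. single (\<kappa> i) 1)) + single k 1))" for k
      proof -
        have "(\<Prod>i<s. l i ((\<kappa>(i0 := k)) i)) = l i0 k * (\<Prod>i\<in>I. l i (\<kappa> i))"
          unfolding I(1) using I(2,3) by (auto intro!: prod.cong)
        moreover have "(\<Sum>i<s. single ((\<kappa>(i0 := k)) i) (1::nat)) =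
            single k 1 + (\<Sum>i\<in>I. single (\<kappa> i) 1)"
          unfolding I(1) using I(2,3) by (auto intro!: sum.cong)
        ultimately show ?thesis by (simp add: add_ac mult_ac)
      qed
      then show "(\<Sum>k\<le>n. ?h (\<kappa>(i0 := k))) = (\<Prod>i\<in>I. l i (\<kappa> i)) *
        (\<Sum>k\<le>n. l i0 k * c i0 ((m + (\<Sum>i\<in>I. single (\<kappa> i) 1)) + single k 1))"
        by (simp only: sum_distrib_left)
    qed
    also have "\<dots> = 0" by (simp only: kill[OF i0]) simp
    finally show ?thesis .
  qed
  then show ?thesis unfolding sum_distrib_left by (subst sum.swap) simp
qed

text \<open>Ordering monomials by the weight \<open>\<Sum>k. k * b\<^sub>k\<close>, the product of linear forms with leading
  coefficients 1 has a unique term of least weight, so the relations in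
  product_of_annihilators determine the coordinates \<open>m + \<gamma>\<close> recursively.\<close>

definition weight :: "nat \<Rightarrow> (nat \<Rightarrow>\<^sub>0 nat) \<Rightarrow> nat" where
  "weight n b = (\<Sum>k\<le>n. k * lookup b k)"

lemma weight_add: "weight n (a + b) = weight n a + weight n b"
  by (simp add: weight_def lookup_add distrib_left sum.distrib)

lemma weight_single: "k \<le> n \<Longrightarrow> weight n (single k 1) = k"
  unfolding weight_def lookup_single when_def by (simp add: if_distrib cong: if_cong)

lemma weight_sum: "weight n (sum f A) = (\<Sum>i\<in>A. weight n (f i))"
  by (induction A rule: infinite_finite_induct) (auto simp: weight_add, simp_all add: weight_def)

lemma weight_le:
  assumes "b \<in> monomials {..n} d"
  shows "weight n b \<le> n * d"
proof -
  have "weight n b \<le> (\<Sum>k\<le>n. n * lookup b k)"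
    unfolding weight_def by (intro sum_mono) auto
  also have "\<dots> = n * d" using assms mdeg_superset[of "{..n}" b]
    by (simp add: monomials_def sum_distrib_left)
  finally show ?thesis .
qed

definition annihilated where
  "annihilated n s l c \<longleftrightarrow> (\<forall>m. (\<Sum>\<kappa>\<in>PiE {..<s} (\<lambda>_. {..n}). (\<Prod>i<s. l i (\<kappa> i)) *
     c (m + (\<Sum>i<s. single (\<kappa> i) 1))) = (0::complex))"

text \<open>The relation at \<open>m\<close> is solved for its lightest term, the coordinate at
  \<open>m + \<gamma>\<close>. Free parameters are the operator coefficients beyond the leading
  positions and the coordinates outside the multiples of \<gamma>. The polynomial is fixed before
  \<open>l\<close> and \<open>c\<close>, so a count of parameters applies to all of them at
  once.\<close>

lemma annihilated_parametrization:
  fixes j :: "nat \<Rightarrow> nat"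
  assumes j: "\<And>i. i < s \<Longrightarrow> j i \<le> n" and "s \<le> d"
  defines "\<gamma> \<equiv> \<Sum>i<s. single (j i) (1::nat)"
  defines "P \<equiv> Inl ` (SIGMA i:{..<s}. {j i<..n}) \<union>
    Inr ` (monomials {..n} d - (\<lambda>m. m + \<gamma>) ` monomials {..n} (d - s))"
  assumes "b \<in> monomials {..n} d"
  shows "\<exists>\<Phi>\<in>mpols P. \<forall>l c. (\<forall>i<s. l i (j i) = 1 \<and> (\<forall>k<j i. l i k = 0)) \<longrightarrow>
    annihilated n s l c \<longrightarrow> c b = eval_mpol \<Phi> (case_sum (\<lambda>(i, k). l i k) c)"
  using assms(5)
\<comment> \<open>The recursion refers to heavier monomials; it ends because weights in degree
  \<open>d\<close> are at most \<open>n * d\<close>.\<close>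
proof (induction "n * d - weight n b" arbitrary: b rule: less_induct)
  case less
  show ?case
  proof (cases "b \<in> (\<lambda>m. m + \<gamma>) ` monomials {..n} (d - s)")
    case False
    then show ?thesis
      using less.prems
      by (intro bexI[of _ "single (single (Inr b) 1) 1"]) (auto simp: P_def intro!: mpols_single)
  next
    case True
    then obtain m where m: "b = m + \<gamma>" "m \<in> monomials {..n} (d - s)" by blast
    define \<kappa>0 where "\<kappa>0 = restrict j {..<s}"
    \<comment> \<open>Choices falling below a leading position have coefficient 0, and
      \<open>\<kappa>0\<close> selects the term to be solved for; \<open>K\<close> indexes all other
      terms.\<close>
    define K where "K = {\<kappa>\<in>PiE {..<s} (\<lambda>_. {..n}). (\<forall>i<s. j i \<le> \<kappa> i) \<and> \<kappa> \<noteq> \<kappa>0}"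
    define e where "e \<kappa> = m + (\<Sum>i<s. single (\<kappa> i) (1::nat))" for \<kappa> :: "nat \<Rightarrow> nat"
    have "\<exists>\<Phi>\<in>mpols P. \<forall>l c. (\<forall>i<s. l i (j i) = 1 \<and> (\<forall>k<j i. l i k = 0)) \<longrightarrow>
        annihilated n s l c \<longrightarrow> c (e \<kappa>) = eval_mpol \<Phi> (case_sum (\<lambda>(i, k). l i k) c)"
      if \<kappa>: "\<kappa> \<in> K" for \<kappa>
    proof (rule less.hyps)
      have range: "\<kappa> i \<le> n" if "i < s" for i using \<kappa> that by (auto simp: K_def)
      have "keys (\<Sum>i<s. single (\<kappa> i) (1::nat)) \<subseteq> {..n}"
        using keys_sum[of "\<lambda>i. single (\<kappa> i) (1::nat)" "{..<s}"] range by auto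
      then show ek: "e \<kappa> \<in> monomials {..n} d"
        using m(2) \<open>s \<le> d\<close> by (auto simp: e_def monomials_def mdeg_add mdeg_sum keys_add_nat)
      have "\<exists>i<s. j i \<noteq> \<kappa> i"
      proof (rule ccontr)
        assume "\<not> ?thesis"
        then have "\<kappa> = \<kappa>0" using \<kappa>
          by (auto simp: K_def \<kappa>0_def PiE_def extensional_def fun_eq_iff restrict_def)
        then show False using \<kappa> by (simp add: K_def)
      qed
      then have "(\<Sum>i<s. j i) < (\<Sum>i<s. \<kappa> i)"
        using \<kappa> by (intro sum_strict_mono_ex1) (auto simp: K_def, metis lessThan_iff le_neq_implies_less)
      moreover have "weight n (e \<kappa>) = weight n m + (\<Sum>i<s. \<kappa> i)"
        using range by (simp add: e_def weight_add weight_sum weight_single del: One_nat_def)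
      moreover have "weight n b = weight n m + (\<Sum>i<s. j i)"
        using j by (simp add: m \<gamma>_def weight_add weight_sum weight_single del: One_nat_def)
      moreover have "weight n (e \<kappa>) \<le> n * d" using ek by (rule weight_le)
      ultimately show "n * d - weight n (e \<kappa>) < n * d - weight n b" by linarith
    qed
    then obtain \<Phi> where \<Phi>: "\<And>\<kappa>. \<kappa> \<in> K \<Longrightarrow> \<Phi> \<kappa> \<in> mpols P"
      "\<And>\<kappa> l c. \<kappa> \<in> K \<Longrightarrow> (\<forall>i<s. l i (j i) = 1 \<and> (\<forall>k<j i. l i k = 0)) \<Longrightarrow>
        annihilated n s l c \<Longrightarrow> c (e \<kappa>) = eval_mpol (\<Phi> \<kappa>) (case_sum (\<lambda>(i, k). l i k) c)"
      by metis
    define g where "g x = - (\<Sum>\<kappa>\<in>K. (\<Prod>i<s. if \<kappa> i = j i then 1 else x (Inl (i, \<kappa> i))) *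
      eval_mpol (\<Phi> \<kappa>) x)" for x :: "(nat \<times> nat) + (nat \<Rightarrow>\<^sub>0 nat) \<Rightarrow> complex"
    have "polyfun P g"
      unfolding g_def
    proof (intro polyfun_uminus polyfun_sum polyfun_mult polyfun_prod polyfun_eval \<Phi>)
      fix \<kappa> i assume "\<kappa> \<in> K" "i \<in> {..<s}"
      then have "\<kappa> i = j i \<or> (i, \<kappa> i) \<in> (SIGMA i:{..<s}. {j i<..n})"
        by (auto simp: K_def le_less)
      then have "\<kappa> i = j i \<or> Inl (i, \<kappa> i) \<in> P" unfolding P_def by blast
      then show "polyfun P (\<lambda>x. if \<kappa> i = j i then 1 else x (Inl (i, \<kappa> i)))"
        by (cases "\<kappa> i = j i") auto
    qed
    then obtain \<Psi> where \<Psi>: "\<Psi> \<in> mpols P" "\<And>x. eval_mpol \<Psi> x = g x"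
      by (auto simp: polyfun_def)
    have "c b = eval_mpol \<Psi> (case_sum (\<lambda>(i, k). l i k) c)"
      if l: "\<forall>i<s. l i (j i) = 1 \<and> (\<forall>k<j i. l i k = 0)" and c: "annihilated n s l c" for l c
    proof -
      let ?PE = "PiE {..<s} (\<lambda>_. {..n})"
      let ?t = "\<lambda>\<kappa>. (\<Prod>i<s. l i (\<kappa> i)) * c (e \<kappa>)"
      have finPE: "finite ?PE" by (intro finite_PiE) auto
      have \<kappa>0: "\<kappa>0 \<in> ?PE" using j by (auto simp: \<kappa>0_def)
      have t0: "?t \<kappa>0 = c b"
        using l by (simp add: \<kappa>0_def e_def m \<gamma>_def)
      have "0 = sum ?t ?PE" using c by (simp add: annihilated_def e_def)
      also have "\<dots> = sum ?t (insert \<kappa>0 K)"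
      proof (rule sum.mono_neutral_right[OF finPE])
        show "insert \<kappa>0 K \<subseteq> ?PE" using \<kappa>0 by (auto simp: K_def)
        show "\<forall>\<kappa>\<in>?PE - insert \<kappa>0 K. ?t \<kappa> = 0"
        proof
          fix \<kappa> assume "\<kappa> \<in> ?PE - insert \<kappa>0 K"
          then obtain i where i: "i < s" "\<kappa> i < j i" by (auto simp: K_def not_le)
          then have "l i (\<kappa> i) = 0" using l by blast
          then have "(\<Prod>i<s. l i (\<kappa> i)) = 0" using i by (intro prod_zero) auto
          then show "?t \<kappa> = 0" by simp
        qed
      qed
      also have "\<dots> = c b + sum ?t K"
        using finPE by (subst sum.insert) (auto simp: K_def t0 simp del: mult_eq_0_iff)
      finally have "c b = - sum ?t K" by (simp add: eq_neg_iff_add_eq_0)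
      also have "\<dots> = g (case_sum (\<lambda>(i, k). l i k) c)"
        unfolding g_def
      proof (intro arg_cong[of _ _ uminus] sum.cong refl)
        fix \<kappa> assume \<kappa>: "\<kappa> \<in> K"
        have "(\<Prod>i<s. l i (\<kappa> i)) = (\<Prod>i<s. if \<kappa> i = j i then 1 else
            case_sum (\<lambda>(i, k). l i k) c (Inl (i, \<kappa> i)))"
          using l by (intro prod.cong) auto
        then show "?t \<kappa> = (\<Prod>i<s. if \<kappa> i = j i then 1 else
            case_sum (\<lambda>(i, k). l i k) c (Inl (i, \<kappa> i))) *
            eval_mpol (\<Phi> \<kappa>) (case_sum (\<lambda>(i, k). l i k) c)"
          using \<Phi>(2)[OF \<kappa> l c] by simp
      qed
      finally show ?thesis by (simp add: \<Psi>)
    qed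
    then show ?thesis using \<Psi>(1) by blast
  qed
qed

text \<open>The operators cost at most \<open>n\<close> parameters each, and the relations save one
  coordinate for each monomial of degree \<open>d - s\<close>. By \<open>less\<close> more is saved
  than spent, so there are fewer parameters than coordinates.\<close>

lemma annihilated_dependent:
  assumes j: "\<And>i. i < s \<Longrightarrow> j i \<le> n" and "s \<le> d" and less: "n * s < (d - s + n) choose n"
  shows "\<exists>F\<in>mpols (monomials {..n} d). F \<noteq> 0 \<and>
    (\<forall>l c. (\<forall>i<s. l i (j i) = 1 \<and> (\<forall>k<j i. l i k = 0)) \<longrightarrow> annihilated n s l c \<longrightarrow>
      eval_mpol F c = 0)"
proof -
  define M where "M = monomials {..n} d"
  define \<gamma> where "\<gamma> = (\<Sum>i<s. single (j i) (1::nat))"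
  define Q where "Q = (\<lambda>m. m + \<gamma>) ` monomials {..n} (d - s)"
  define P1 where "P1 = (SIGMA i:{..<s}. {j i<..n})"
  define P where "P = Inl ` P1 \<union> Inr ` (M - Q)"
  have fM: "finite M" "finite Q" by (auto simp: M_def Q_def intro!: finite_monomials)
  have fP1: "finite P1" by (auto simp: P1_def)
  have "card P1 = (\<Sum>i<s. n - j i)" by (simp add: P1_def)
  also have "\<dots> \<le> (\<Sum>i<s. n)" by (intro sum_mono) auto
  finally have cP1: "card P1 \<le> n * s" by (simp add: mult.commute)
  have cQ: "card Q = (d - s + n) choose n"
    unfolding Q_def by (subst card_image) (auto simp: card_monomials inj_on_def)
  have "keys \<gamma> \<subseteq> {..n}"
    using keys_sum[of "\<lambda>i. single (j i) (1::nat)" "{..<s}"] j by (auto simp: \<gamma>_def)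
  then have "Q \<subseteq> M"
    using \<open>s \<le> d\<close> by (auto simp: Q_def M_def monomials_def keys_add_nat mdeg_add \<gamma>_def mdeg_sum)
  then have cMQ: "card (M - Q) = card M - card Q" "card Q \<le> card M"
    using fM by (auto simp: card_Diff_subset card_mono)
  have "card P \<le> card P1 + card (M - Q)"
    unfolding P_def using fM fP1
    by (intro order_trans[OF card_Un_le] add_mono card_image_le) auto
  then have card: "card P < card M" using cP1 cQ cMQ less by linarith
  have "\<exists>\<Phi>\<in>mpols P. \<forall>l c. (\<forall>i<s. l i (j i) = 1 \<and> (\<forall>k<j i. l i k = 0)) \<longrightarrow>
    annihilated n s l c \<longrightarrow> c b = eval_mpol \<Phi> (case_sum (\<lambda>(i, k). l i k) c)" if "b \<in> M" for b
    using annihilated_parametrization[of s j n d b] j \<open>s \<le> d\<close> that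
    unfolding P_def P1_def Q_def \<gamma>_def M_def by blast
  then obtain \<Phi> where \<Phi>: "\<And>b. b \<in> M \<Longrightarrow> \<Phi> b \<in> mpols P"
    "\<And>b l c. b \<in> M \<Longrightarrow> (\<forall>i<s. l i (j i) = 1 \<and> (\<forall>k<j i. l i k = 0)) \<Longrightarrow>
      annihilated n s l c \<Longrightarrow> c b = eval_mpol (\<Phi> b) (case_sum (\<lambda>(i, k). l i k) c)" by metis
  have "finite P" using fP1 fM by (auto simp: P_def)
  from algebraically_dependent[OF fM(1) this card, of \<Phi>] \<Phi>(1) obtain F where
    F: "F \<in> mpols M" "F \<noteq> 0" "\<And>x. eval_mpol F (\<lambda>b. eval_mpol (\<Phi> b) x) = 0" by blast
  have "eval_mpol F c = 0"
    if l: "\<forall>i<s. l i (j i) = 1 \<and> (\<forall>k<j i. l i k = 0)" and c: "annihilated n s l c" for l c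
  proof -
    have "eval_mpol F c = eval_mpol F (\<lambda>b. eval_mpol (\<Phi> b) (case_sum (\<lambda>(i, k). l i k) c))"
      using \<Phi>(2)[OF _ l c] by (intro eval_mpol_cong[OF F(1)])
    then show ?thesis using F(3) by simp
  qed
  then show ?thesis using F(1,2) unfolding M_def by blast
qed

text \<open>Dividing an operator by its first nonzero coefficient normalizes it, but the position of
  that coefficient is not known in advance. The relations for the finitely many patterns of
  positions are multiplied, and a rescaling of variables passes from divided power coordinates to
  coefficients.\<close>

lemma codim_one_sums_dependent:
  assumes "s \<le> d" and less: "n * s < (d - s + n) choose n"
  shows "\<exists>G\<in>mpols (monomials {..n} d). G \<noteq> 0 \<and>
    (\<forall>f gs. length gs = s \<longrightarrow> codim_one_decomposition n d f gs \<longrightarrow> eval_mpol G (lookup f) = 0)"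
proof -
  define M where "M = monomials {..n} d"
  define J where "J = PiE {..<s} (\<lambda>_. {..n})"
  have fM: "finite M" by (auto simp: M_def intro!: finite_monomials)
  have fJ: "finite J" unfolding J_def by (intro finite_PiE) auto
  have "\<exists>F\<in>mpols M. F \<noteq> 0 \<and> (\<forall>l c. (\<forall>i<s. l i (j i) = 1 \<and> (\<forall>k<j i. l i k = 0)) \<longrightarrow>
      annihilated n s l c \<longrightarrow> eval_mpol F c = 0)" if "j \<in> J" for j
    unfolding M_def by (intro annihilated_dependent assms) (use that in \<open>auto simp: J_def\<close>)
  then obtain F where F: "\<And>j. j \<in> J \<Longrightarrow> F j \<in> mpols M" "\<And>j. j \<in> J \<Longrightarrow> F j \<noteq> 0"
    "\<And>j l c. j \<in> J \<Longrightarrow> (\<forall>i<s. l i (j i) = 1 \<and> (\<forall>k<j i. l i k = 0)) \<Longrightarrow>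
      annihilated n s l c \<Longrightarrow> eval_mpol (F j) c = 0" by metis
  define H where "H = (\<Prod>j\<in>J. F j)"
  have H0: "H \<noteq> 0" using F(2) fJ by (simp add: H_def)
  have H: "H \<in> mpols M"
    unfolding H_def using fJ F(1) by (induction J rule: finite_induct) (auto simp: mpols_1 mpols_mult)
  have "polyfun M (\<lambda>x. eval_mpol H (\<lambda>b. expfact b * x b))"
    using H by (intro polyfun_subst polyfun_mult polyfun_const polyfun_var)
  then obtain G where G: "G \<in> mpols M" "\<And>x. eval_mpol H (\<lambda>b. expfact b * x b) = eval_mpol G x"
    unfolding polyfun_def by (auto dest: fun_cong)
  have "G \<noteq> 0"
  proof
    assume "G = 0"
    obtain x where "eval_mpol H x \<noteq> 0" using mpol_nonzero_eval H fM H0 by blast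
    then show False using G(2)[of "\<lambda>b. x b / expfact b"] \<open>G = 0\<close> by simp
  qed
  moreover have "eval_mpol G (lookup f) = 0"
    if gs: "length gs = s" "codim_one_decomposition n d f gs" for f gs
  proof -
    define c where "c i = dcoef (gs ! i)" for i
    have "\<exists>l. (\<exists>k\<le>n. l k \<noteq> 0) \<and> (\<forall>b. (\<Sum>k\<le>n. l k * c i (b + single k 1)) = 0)" if "i < s" for i
      using gs that unfolding codim_one_decomposition_def codim_one_form_iff c_def by auto
    then obtain l0 where l0: "\<And>i. i < s \<Longrightarrow> \<exists>k\<le>n. l0 i k \<noteq> 0"
      "\<And>i b. i < s \<Longrightarrow> (\<Sum>k\<le>n. l0 i k * c i (b + single k 1)) = 0" by metis
    define j0 where "j0 i = (LEAST k. l0 i k \<noteq> 0)" for i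
    have j0: "l0 i (j0 i) \<noteq> 0" "j0 i \<le> n" "\<And>k. k < j0 i \<Longrightarrow> l0 i k = 0" if i: "i < s" for i
    proof -
      obtain k where k: "k \<le> n" "l0 i k \<noteq> 0" using l0(1)[OF i] by blast
      show "l0 i (j0 i) \<noteq> 0" unfolding j0_def using k(2) by (rule LeastI)
      show "j0 i \<le> n" unfolding j0_def using k(1) Least_le[of "\<lambda>k. l0 i k \<noteq> 0", OF k(2)] by simp
      show "\<And>k. k < j0 i \<Longrightarrow> l0 i k = 0" unfolding j0_def using not_less_Least by blast
    qed
    define j where "j = restrict j0 {..<s}"
    have jJ: "j \<in> J" using j0 by (auto simp: J_def j_def)
    define l where "l i k = l0 i k / l0 i (j0 i)" for i k
    have l: "\<forall>i<s. l i (j i) = 1 \<and> (\<forall>k<j i. l i k = 0)"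
      using j0 by (auto simp: l_def j_def)
    have "(\<Sum>k\<le>n. l i k * c i (b + single k 1)) = 0" if "i < s" for i b
    proof -
      have "(\<Sum>k\<le>n. l i k * c i (b + single k 1)) =
          (\<Sum>k\<le>n. l0 i k * c i (b + single k 1)) / l0 i (j0 i)"
        by (simp add: l_def sum_divide_distrib)
      then show ?thesis using l0(2)[OF that] by simp
    qed
    then have "annihilated n s l (\<lambda>b. \<Sum>i<s. c i b)"
      unfolding annihilated_def using product_of_annihilators by blast
    then have "eval_mpol (F j) (\<lambda>b. \<Sum>i<s. c i b) = 0" by (rule F(3)[OF jJ l])
    then have "eval_mpol H (\<lambda>b. \<Sum>i<s. c i b) = 0"
      unfolding H_def eval_mpol_prod by (intro prod_zero) (use fJ jJ in auto)
    moreover have "(\<Sum>i<s. c i b) = expfact b * lookup f b" for b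
    proof -
      have "f = (\<Sum>i<s. gs ! i)"
        using gs by (simp add: codim_one_decomposition_def sum_list_sum_nth atLeast0LessThan)
      then show ?thesis by (simp add: c_def dcoef_def lookup_sum sum_distrib_left)
    qed
    ultimately show ?thesis by (simp flip: G(2))
  qed
  ultimately show ?thesis using G(1) unfolding M_def by blast
qed

section \<open>Descartes-type zero bounds and explicit points in general position\<close>

section \<open>Sparse polynomials on the positive reals\<close>

text \<open>The new zeros lie strictly between the extreme old ones, so positivity of zeros is
  inherited when the lemma is iterated.\<close>

lemma Rolle_zeros:
  fixes g g' :: "real \<Rightarrow> real"
  assumes der: "\<And>t. (g has_real_derivative g' t) (at t)"
    and "finite Z" "Z \<noteq> {}" "\<And>t. t \<in> Z \<Longrightarrow> g t = 0"
  shows "\<exists>Z'. finite Z' \<and> card Z = Suc (card Z') \<and> (\<forall>t\<in>Z'. g' t = 0 \<and> Min Z < t \<and> t < Max Z)"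
  using assms(2-4)
proof (induction Z rule: finite_linorder_max_induct)
  case (insert b A)
  show ?case
  proof (cases "A = {}")
    case True
    then show ?thesis by (intro exI[of _ "{}"]) auto
  next
    case False
    obtain Z' where Z': "finite Z'" "card A = Suc (card Z')"
      "\<forall>t\<in>Z'. g' t = 0 \<and> Min A < t \<and> t < Max A"
      using insert.IH[OF False] insert.prems by blast
    have "Max A < b" "Max A \<in> A" using insert False by auto
    from MVT2[OF this(1) der] obtain z where z: "Max A < z" "z < b" "g b - g (Max A) = (b - Max A) * g' z"
      by blast
    have "g' z = 0" using z insert.prems \<open>Max A \<in> A\<close> \<open>Max A < b\<close> by simp
    have "Min A \<le> Max A" using insert.hyps False by simp
    have mm: "Max (insert b A) = b" "Min (insert b A) = Min A"
      using \<open>Max A < b\<close> \<open>Min A \<le> Max A\<close>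
      by (simp_all only: Max_insert[OF insert.hyps(1) False] Min_insert[OF insert.hyps(1) False])
    have "b \<notin> A" "z \<notin> Z'" using insert.hyps z Z' by auto
    then show ?thesis
      unfolding mm using Z' z \<open>g' z = 0\<close> \<open>Min A \<le> Max A\<close> insert.hyps
      by (intro exI[of _ "insert z Z'"]) (auto intro: less_trans)
  qed
qed simp

text \<open>Division by the lowest power, harmless at positive zeros, makes the lowest term
  constant; differentiation removes it, and Rolle costs one zero. Terms and zeros thus decrease
  together.\<close>

lemma sparse_real_polynomial_zero:
  fixes c :: "'i \<Rightarrow> real" and e :: "'i \<Rightarrow> nat"
  assumes "finite I" "inj_on e I" "finite Z" "card I \<le> card Z" "\<And>t. t \<in> Z \<Longrightarrow> t > 0"
    and "\<And>t. t \<in> Z \<Longrightarrow> (\<Sum>i\<in>I. c i * t ^ e i) = 0" and "i \<in> I"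
  shows "c i = 0"
  using assms
proof (induction "card I" arbitrary: I e c Z i)
  case (Suc N)
  then have ne: "I \<noteq> {}" "Z \<noteq> {}" by auto
  obtain i0 where i0: "i0 \<in> I" "\<And>i. i \<in> I \<Longrightarrow> e i0 \<le> e i"
    using ex_min_if_finite[of "e ` I"] Suc.prems(1) ne by (force simp: not_less)
  define I' where "I' = I - {i0}"
  have lt: "e i0 < e i" if "i \<in> I'" for i
    using that i0 Suc.prems(2) by (metis DiffE I'_def inj_onD insertI1 le_neq_implies_less)
  have I': "finite I'" "card I' = N" "I = insert i0 I'" "i0 \<notin> I'"
    using Suc i0 by (auto simp: I'_def)
  define g where "g t = (\<Sum>i\<in>I. c i * t ^ (e i - e i0))" for t
  define g' where "g' t = (\<Sum>i\<in>I'. (c i * real (e i - e i0)) * t ^ (e i - e i0 - 1))" for t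
  have gZ: "g t = 0" if "t \<in> Z" for t
  proof -
    have "0 = (\<Sum>i\<in>I. c i * t ^ e i)" using Suc.prems that by simp
    also have "\<dots> = t ^ e i0 * g t"
      unfolding g_def sum_distrib_left
      by (intro sum.cong refl) (use i0 in \<open>simp flip: power_add\<close>)
    finally show ?thesis using Suc.prems(5)[OF that] by simp
  qed
  have "(g has_real_derivative g' t) (at t)" for t
    unfolding g_def g'_def I'(3) using I'
    by (auto intro!: derivative_eq_intros sum.cong)
  from Rolle_zeros[OF this Suc.prems(3) ne(2) gZ] obtain Z' where
    Z': "finite Z'" "card Z = Suc (card Z')" "\<forall>t\<in>Z'. g' t = 0 \<and> Min Z < t \<and> t < Max Z" by blast
  have "Min Z > 0" using Suc.prems ne by simp
  have c0: "c i = 0" if i: "i \<in> I'" for i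
  proof -
    have "c i * real (e i - e i0) = 0"
    proof (rule Suc.hyps(1)[of I' "\<lambda>i. e i - e i0 - 1" Z' "\<lambda>i. c i * real (e i - e i0)"])
      show "inj_on (\<lambda>i. e i - e i0 - 1) I'"
      proof (rule inj_onI)
        fix x y assume xy: "x \<in> I'" "y \<in> I'" "e x - e i0 - 1 = e y - e i0 - 1"
        with lt[of x] lt[of y] have "e x = e y" by linarith
        then show "x = y" using xy Suc.prems(2) by (auto simp: I'_def inj_on_def)
      qed
      show "card I' \<le> card Z'" using I' Z' Suc by simp
      fix t assume "t \<in> Z'"
      then show "t > 0" "(\<Sum>i\<in>I'. c i * real (e i - e i0) * t ^ (e i - e i0 - 1)) = 0"
        using Z' \<open>Min Z > 0\<close> by (auto simp: g'_def)
    qed (use I' Z' i in auto)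
    then show ?thesis using lt[OF i] by simp
  qed
  obtain t where t: "t \<in> Z" using ne by blast
  have "(\<Sum>i\<in>I. c i * t ^ e i) = c i0 * t ^ e i0" unfolding I'(3) using I' c0 by simp
  then have "c i0 = 0" using Suc.prems(5)[OF t] Suc.prems(6)[OF t] by simp
  then show ?case using c0 Suc.prems(7) I' by auto
qed auto

lemma sparse_complex_polynomial_zero:
  fixes c :: "'i \<Rightarrow> complex" and e :: "'i \<Rightarrow> nat"
  assumes "finite I" "inj_on e I" "finite Z" "card I \<le> card Z" "\<And>t. t \<in> Z \<Longrightarrow> t > 0"
    and zero: "\<And>t. t \<in> Z \<Longrightarrow> (\<Sum>i\<in>I. c i * of_real t ^ e i) = 0" and "i \<in> I"
  shows "c i = 0"
proof (rule complex_eqI)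
  have "(\<Sum>i\<in>I. Re (c i) * t ^ e i) = 0" "(\<Sum>i\<in>I. Im (c i) * t ^ e i) = 0" if "t \<in> Z" for t
    using arg_cong[OF zero[OF that], of Re] arg_cong[OF zero[OF that], of Im]
    by (simp_all flip: of_real_power)
  note zeros = this
  show "Re (c i) = Re 0"
    using sparse_real_polynomial_zero[OF assms(1-5) zeros(1) assms(7)] by simp
  show "Im (c i) = Im 0"
    using sparse_real_polynomial_zero[OF assms(1-5) zeros(2) assms(7)] by simp
qed

text \<open>The base \<open>Suc d\<close> makes the exponents of all monomials of degree at most \<open>d\<close> distinct on this curve.\<close>

definition moment :: "nat \<Rightarrow> real \<Rightarrow> nat \<Rightarrow> complex" where
  "moment d t k = of_real t ^ (Suc d ^ k)"

text \<open>On the curve \<open>F\<close> becomes a univariate polynomial with the same number of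
  terms, so as many distinct positive parameters as terms already determine it. No genericity
  argument for the points is required.\<close>

lemma moment_unisolvent:
  assumes F: "F \<in> mpols_le {..n} d" and Z: "finite Z" "card (keys F) \<le> card Z"
    "\<And>t. t \<in> Z \<Longrightarrow> t > 0" "\<And>t. t \<in> Z \<Longrightarrow> eval_mpol F (moment d t) = 0"
  shows "F = 0"
proof -
  define \<kappa> where "\<kappa> a = (\<Sum>k<Suc n. lookup a k * Suc d ^ k)" for a :: "nat \<Rightarrow>\<^sub>0 nat"
  have keys: "keys a \<subseteq> {..n}" "lookup a k < Suc d" if "a \<in> keys F" for a k
    using F that lookup_le_mdeg[of a k] by (auto simp: mpols_le_def less_Suc_eq_le intro: order_trans)
  have "inj_on \<kappa> (keys F)"
  proof (rule inj_onI, rule poly_mapping_eqI)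
    fix a b k assume ab: "a \<in> keys F" "b \<in> keys F" "\<kappa> a = \<kappa> b"
    show "lookup a k = lookup b k"
    proof (cases "k \<le> n")
      case True
      then show ?thesis
        using base_digits_unique[of "Suc n" "lookup a" "Suc d" "lookup b" k] keys ab
        by (simp add: \<kappa>_def del: sum.lessThan_Suc)
    next
      case False
      then have "k \<notin> keys a" "k \<notin> keys b" using keys ab by auto
      then show ?thesis by (simp add: in_keys_iff)
    qed
  qed
  moreover have "(\<Sum>a\<in>keys F. lookup F a * of_real t ^ \<kappa> a) = 0" if "t \<in> Z" for t
  proof -
    have "monom_val (moment d t) a = of_real t ^ \<kappa> a" if a: "a \<in> keys F" for a
    proof -
      have "monom_val (moment d t) a = (\<Prod>k<Suc n. moment d t k ^ lookup a k)"
        using keys[OF a] by (intro monom_val_superset) auto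
      then show ?thesis
        by (simp only: moment_def \<kappa>_def power_sum power_mult[symmetric] mult.commute)
    qed
    then show ?thesis using Z(4)[OF that] by (simp add: eval_mpol_superset[of "keys F"])
  qed
  ultimately have "lookup F a = 0" if "a \<in> keys F" for a
    using sparse_complex_polynomial_zero[of "keys F" \<kappa> Z "lookup F" a] Z that by simp
  then show ?thesis by (intro poly_mapping_eqI) (auto simp: in_keys_iff)
qed

lemma moment_linear_independent:
  assumes "d \<ge> 1" "finite Z" "card Z = Suc n" "\<And>t. t \<in> Z \<Longrightarrow> t > 0"
    "\<And>t. t \<in> Z \<Longrightarrow> (\<Sum>k\<le>n. l k * moment d t k) = 0" "k \<le> n"
  shows "l k = 0"
proof (rule sparse_complex_polynomial_zero[of "{..n}" "\<lambda>k. Suc d ^ k" Z])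
  show "inj_on (\<lambda>k. Suc d ^ k) {..n}" using assms(1) by (auto simp: inj_on_def power_inject_exp)
qed (use assms in \<open>auto simp: moment_def\<close>)

section \<open>Membership in a span, tested by functionals\<close>

section \<open>Duality\<close>

lemma single_sum_lookup:
  "finite V \<Longrightarrow> lookup (\<Sum>v\<in>V. single v (y v)) w = (if w \<in> V then y w else 0)"
  by (auto simp: lookup_sum lookup_single when_def sum.delta')

text \<open>Outside the span, a functional could be prescribed to be 0 on a maximal independent
  subfamily and 1 at \<open>y\<close>. The index set \<open>I\<close> may be infinite, hence the
  finite \<open>J\<close> in the conclusion.\<close>

lemma in_span_if_functionals_vanish:
  fixes y :: "'v \<Rightarrow> 'a::field" and s :: "'i \<Rightarrow> 'v \<Rightarrow> 'a"
  assumes fin: "finite V"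
    and vanish: "\<And>D. (\<And>i. i \<in> I \<Longrightarrow> (\<Sum>v\<in>V. D v * s i v) = 0) \<Longrightarrow> (\<Sum>v\<in>V. D v * y v) = 0"
  shows "\<exists>J c. J \<subseteq> I \<and> finite J \<and> (\<forall>v\<in>V. y v = (\<Sum>i\<in>J. c i * s i v))"
proof -
  \<comment> \<open>Vectors indexed by \<open>V\<close> are encoded as finitely supported maps,
    which form a vector space under \<open>sc\<close>.\<close>
  define sc where "sc c f = Poly_Mapping.map ((*) c) f" for c :: 'a and f :: "'v \<Rightarrow>\<^sub>0 'a"
  have lsc: "lookup (sc c f) v = c * lookup f v" for c f v
    unfolding sc_def by transfer (simp add: when_def)
  interpret vp: vector_space_pair sc "(*) :: 'a \<Rightarrow> 'a \<Rightarrow> 'a"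
    by unfold_locales (auto intro!: poly_mapping_eqI simp: lsc lookup_add algebra_simps)
  define emb where "emb z = (\<Sum>v\<in>V. single v (z v))" for z :: "'v \<Rightarrow> 'a"
  have lemb: "lookup (emb z) w = (if w \<in> V then z w else 0)" for z w
    unfolding emb_def using fin by (rule single_sum_lookup)
  let ?S = "(\<lambda>i. emb (s i)) ` I"
  have "emb y \<in> vp.vs1.span ?S"
  proof (rule ccontr)
    assume ny: "emb y \<notin> vp.vs1.span ?S"
    obtain B where B: "B \<subseteq> ?S" "vp.vs1.independent B" "?S \<subseteq> vp.vs1.span B"
      using vp.vs1.maximal_independent_subset .
    have "vp.vs1.span ?S \<subseteq> vp.vs1.span B" using B(3) by (simp add: vp.vs1.span_minimal)
    moreover have "vp.vs1.span B \<subseteq> vp.vs1.span ?S" using B(1) by (rule vp.vs1.span_mono)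
    ultimately have nB: "emb y \<notin> vp.vs1.span B" using ny by blast
    then have "vp.vs1.independent (insert (emb y) B)" using B(2) by (rule vp.vs1.independent_insertI)
    from vp.linear_independent_extend[OF this, of "\<lambda>x. if x = emb y then 1 else 0"]
    obtain g where g: "Vector_Spaces.linear sc (*) g"
      "\<forall>x\<in>insert (emb y) B. g x = (if x = emb y then 1 else 0)" by blast
    interpret g: Vector_Spaces.linear sc "(*)" g by fact
    have "emb y \<notin> B" using nB vp.vs1.span_base by blast
    then have gB: "g b = 0" if "b \<in> B" for b using g that by auto
    have gspan: "g b = 0" if "b \<in> vp.vs1.span B" for b
      using that
    proof (induction rule: vp.vs1.span_induct_alt)
      case base
      show ?case by (rule g.zero)
    next
      case (step c x y)
      then show ?case using gB by (simp add: g.add g.scale)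
    qed
    define D where "D v = g (single v 1)" for v
    have gD: "g (emb z) = (\<Sum>v\<in>V. D v * z v)" for z
    proof -
      have "emb z = (\<Sum>v\<in>V. sc (z v) (single v 1))"
        unfolding emb_def
        by (intro sum.cong refl poly_mapping_eqI) (auto simp: lsc lookup_single when_def)
      then show ?thesis by (simp add: g.sum g.scale D_def mult.commute)
    qed
    have "(\<Sum>v\<in>V. D v * y v) = 0"
    proof (rule vanish)
      fix i assume "i \<in> I"
      then have "emb (s i) \<in> vp.vs1.span B" using B(3) by blast
      then show "(\<Sum>v\<in>V. D v * s i v) = 0" using gspan gD by metis
    qed
    then show False using g gD[of y] by simp
  qed
  then obtain T r where T: "finite T" "T \<subseteq> ?S" "emb y = (\<Sum>a\<in>T. sc (r a) a)"
    unfolding vp.vs1.span_explicit by blast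
  then obtain J where J: "J \<subseteq> I" "inj_on (\<lambda>i. emb (s i)) J" "T = (\<lambda>i. emb (s i)) ` J"
    by (auto simp: subset_image_inj)
  show ?thesis
  proof (intro exI[of _ J] exI[of _ "\<lambda>i. r (emb (s i))"] conjI ballI)
    show "finite J" using T(1) J finite_imageD by blast
    fix v assume v: "v \<in> V"
    have "y v = lookup (emb y) v" using v by (simp add: lemb)
    also have "\<dots> = (\<Sum>i\<in>J. r (emb (s i)) * s i v)"
      unfolding T(3) lookup_sum J(3) lsc sum.reindex[OF J(2)] using v by (simp add: lsc lemb)
    finally show "y v = (\<Sum>i\<in>J. r (emb (s i)) * s i v)" .
  qed (rule J)
qed

section \<open>Division of a form by a linear form\<close>

section \<open>Forms vanishing on a hyperplane\<close>

text \<open>Forms are treated as functions here, so that factorizations are pointwise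
  identities.\<close>

definition formfun :: "'v set \<Rightarrow> nat \<Rightarrow> (('v \<Rightarrow> 'a::comm_ring_1) \<Rightarrow> 'a) \<Rightarrow> bool" where
  "formfun V e g \<longleftrightarrow> (\<exists>F\<in>forms V e. g = eval_mpol F)"

lemma formfun_0: "formfun V e (\<lambda>_. 0)"
  unfolding formfun_def by (rule bexI[of _ 0]) (auto simp: forms_def)

lemma formfun_const: "formfun V 0 (\<lambda>_. c)"
  unfolding formfun_def by (rule bexI[of _ "single 0 c"]) (auto simp: forms_def monomials_def)

lemma formfun_var: "v \<in> V \<Longrightarrow> formfun V 1 (\<lambda>x. x v)"
  unfolding formfun_def
  by (rule bexI[of _ "single (single v 1) 1"]) (auto simp: forms_def monomials_def)

lemma formfun_add: "formfun V e f \<Longrightarrow> formfun V e g \<Longrightarrow> formfun V e (\<lambda>x. f x + g x)"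
  unfolding formfun_def by (auto intro!: bexI[OF _ forms_add])

lemma formfun_mult: "formfun V d f \<Longrightarrow> formfun V e g \<Longrightarrow> formfun V (d + e) (\<lambda>x. f x * g x)"
  unfolding formfun_def by (auto intro!: bexI[OF _ forms_mult])

lemma formfun_cmult: "formfun V e f \<Longrightarrow> formfun V e (\<lambda>x. c * f x)"
  using formfun_mult[OF formfun_const] by simp

lemma formfun_sum: "(\<And>i. i \<in> A \<Longrightarrow> formfun V e (f i)) \<Longrightarrow> formfun V e (\<lambda>x. \<Sum>i\<in>A. f i x)"
  by (induction A rule: infinite_finite_induct) (auto simp: formfun_0 formfun_add)

text \<open>Project \<open>x\<close> onto the hyperplane along the coordinate \<open>k\<close>. Each
  monomial changes under this by a multiple of the linear form, and \<open>g\<close> vanishes after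
  projection, so \<open>g\<close> itself is such a multiple.\<close>

lemma formfun_divide:
  fixes g :: "('v \<Rightarrow> 'a::field) \<Rightarrow> 'a"
  assumes fin: "finite V" and k: "k \<in> V" "l k \<noteq> 0" and g: "formfun V (Suc e) g"
    and vanish: "\<And>x. (\<Sum>v\<in>V. l v * x v) = 0 \<Longrightarrow> g x = 0"
  shows "\<exists>Q. formfun V e Q \<and> (\<forall>x. g x = (\<Sum>v\<in>V. l v * x v) * Q x)"
proof -
  define L where "L x = (\<Sum>v\<in>V. l v * x v)" for x
  define y where "y x = x(k := x k - L x / l k)" for x
  have yk: "y x v = x v - (if v = k then 1 / l k else 0) * L x" for x v
    by (simp add: y_def)
  have Ly: "L (y x) = 0" for x
  proof -
    have "L (y x) = (\<Sum>v\<in>V. l v * x v) - (\<Sum>v\<in>V. if v = k then L x else 0)"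
      unfolding L_def[of "y x"] sum_subtractf[symmetric] yk
      by (intro sum.cong refl) (use k in \<open>auto simp: algebra_simps\<close>)
    then show ?thesis using k fin by (simp add: L_def)
  qed
  have fL: "formfun V 1 L"
    unfolding L_def by (intro formfun_sum formfun_cmult formfun_var)
  have fy: "formfun V 1 (\<lambda>x. y x v)" if "v \<in> V" for v
  proof -
    have "formfun V 1 (\<lambda>x. x v + (- (if v = k then 1 / l k else 0)) * L x)"
      using that by (intro formfun_add formfun_var formfun_cmult fL)
    then show ?thesis by (simp add: yk)
  qed
  \<comment> \<open>The clause for \<open>a = 0\<close> repairs the truncated degree
    \<open>mdeg a - 1\<close>: only with zero quotient does multiplication by a variable keep the
    degree claimed in the next step.\<close>
  have mono: "formfun V (mdeg a) (\<lambda>x. monom_val (y x) a) \<and>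
    (\<exists>Q. formfun V (mdeg a - 1) Q \<and> (a = 0 \<longrightarrow> Q = (\<lambda>_. 0)) \<and>
      (\<forall>x. monom_val x a - monom_val (y x) a = L x * Q x))" if "keys a \<subseteq> V" for a
    using that
  proof (induction a rule: expvec_induct)
    case zero
    show ?case by (auto intro!: formfun_const exI[of _ "\<lambda>_. 0"])
  next
    case (add a v)
    then have v: "v \<in> V" "keys a \<subseteq> V" by (auto simp: keys_add_nat)
    from add.IH[OF v(2)] obtain Q where m: "formfun V (mdeg a) (\<lambda>x. monom_val (y x) a)"
      and Q: "formfun V (mdeg a - 1) Q" "a = 0 \<longrightarrow> Q = (\<lambda>_. 0)"
        "\<And>x. monom_val x a - monom_val (y x) a = L x * Q x" by blast
    define q where "q = (if v = k then 1 / l k else 0)"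
    have deg: "mdeg (a + single v 1) = mdeg a + 1" by (simp add: mdeg_add)
    have "formfun V (mdeg a + 1) (\<lambda>x. monom_val (y x) a * y x v)"
      by (intro formfun_mult m fy v)
    then have A: "formfun V (mdeg (a + single v 1)) (\<lambda>x. monom_val (y x) (a + single v 1))"
      by (simp only: monom_val_add monom_val_single deg)
    have "formfun V (mdeg a) (\<lambda>x. Q x * x v)"
    proof (cases "a = 0")
      case True
      then show ?thesis using Q by (simp add: formfun_0)
    next
      case False
      then have "mdeg a = mdeg a - 1 + 1" using mdeg_eq_0_iff[of a] by linarith
      then show ?thesis using formfun_mult[OF Q(1) formfun_var[OF v(1)]] by simp
    qed
    then have "formfun V (mdeg a) (\<lambda>x. Q x * x v + q * monom_val (y x) a)"
      by (intro formfun_add formfun_cmult m)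
    moreover have "monom_val x (a + single v 1) - monom_val (y x) (a + single v 1) =
        L x * (Q x * x v + q * monom_val (y x) a)" for x
    proof -
      have "monom_val x (a + single v 1) - monom_val (y x) (a + single v 1) =
          (monom_val x a - monom_val (y x) a) * x v + monom_val (y x) a * (x v - y x v)"
        by (simp add: monom_val_add algebra_simps)
      then show ?thesis by (simp add: Q yk q_def algebra_simps)
    qed
    moreover have "a + single v 1 \<noteq> 0" using deg by fastforce
    ultimately show ?case using A deg
      by (intro conjI exI[of _ "\<lambda>x. Q x * x v + q * monom_val (y x) a"]) auto
  qed
  obtain F where F: "F \<in> forms V (Suc e)" "g = eval_mpol F" using g by (auto simp: formfun_def)
  then have "keys a \<subseteq> V \<and> mdeg a = Suc e" if "a \<in> keys F" for a
    using that by (auto simp: forms_def monomials_def)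
  then have "\<exists>Q. formfun V e Q \<and> (\<forall>x. monom_val x a - monom_val (y x) a = L x * Q x)"
    if "a \<in> keys F" for a
    using mono[of a] that by (metis diff_Suc_1)
  then obtain Q where Q: "\<And>a. a \<in> keys F \<Longrightarrow> formfun V e (Q a)"
    "\<And>a x. a \<in> keys F \<Longrightarrow> monom_val x a - monom_val (y x) a = L x * Q a x" by metis
  have "g x = L x * (\<Sum>a\<in>keys F. lookup F a * Q a x)" for x
  proof -
    have "g x = g x - g (y x)" using vanish[of "y x"] Ly by (simp add: L_def)
    also have "\<dots> = (\<Sum>a\<in>keys F. lookup F a * (monom_val x a - monom_val (y x) a))"
      by (simp add: F eval_mpol_superset[of "keys F"] sum_subtractf algebra_simps)
    also have "\<dots> = L x * (\<Sum>a\<in>keys F. lookup F a * Q a x)"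
      unfolding sum_distrib_left by (intro sum.cong refl) (simp add: Q algebra_simps)
    finally show ?thesis .
  qed
  moreover have "formfun V e (\<lambda>x. \<Sum>a\<in>keys F. lookup F a * Q a x)"
    using Q by (intro formfun_sum formfun_cmult)
  ultimately show ?thesis unfolding L_def by blast
qed

section \<open>The tangent space at a sum of powers, and the absence of orthogonal forms\<close>

section \<open>Tangent vectors at a sum of powers of linear forms\<close>

text \<open>Partial derivative of the monomial \<open>b\<close> at \<open>p\<close>; the exponent is
  truncated only when the factor \<open>lookup b k\<close> is 0.\<close>

definition monom_pderiv :: "('v \<Rightarrow> complex) \<Rightarrow> 'v \<Rightarrow> ('v \<Rightarrow>\<^sub>0 nat) \<Rightarrow> complex" where
  "monom_pderiv p k b = of_nat (lookup b k) * p k ^ (lookup b k - 1) *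
     (\<Prod>v\<in>keys b - {k}. p v ^ lookup b v)"

lemma monom_val_has_derivative:
  assumes "\<And>k. (x k has_field_derivative m k) (at 0)"
  shows "((\<lambda>\<epsilon>. monom_val (\<lambda>k. x k \<epsilon>) b) has_field_derivative
    (\<Sum>k\<in>keys b. m k * monom_pderiv (\<lambda>k. x k 0) k b)) (at 0)"
  unfolding monom_val_def
proof (rule DERIV_cong, rule has_field_derivative_prod)
  fix k
  show "((\<lambda>\<epsilon>. x k \<epsilon> ^ lookup b k) has_field_derivative
      of_nat (lookup b k) * (m k * x k 0 ^ (lookup b k - 1))) (at 0)"
    using DERIV_power[OF assms, of k "lookup b k"] by simp
qed (simp add: monom_pderiv_def mult_ac)

lemma sum_keys_monom_pderiv:
  assumes "finite V" "keys b \<subseteq> V"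
  shows "(\<Sum>k\<in>keys b. m k * monom_pderiv p k b) = (\<Sum>k\<in>V. m k * monom_pderiv p k b)"
  using assms by (intro sum.mono_neutral_left) (auto simp: in_keys_iff monom_pderiv_def)

text \<open>Any \<open>n + 1\<close> points of the curve with distinct positive parameters are
  linearly independent, so \<open>n\<close> of them span a hyperplane containing no further such
  point.\<close>

lemma hyperplane_through_moment_points:
  assumes d: "d \<ge> 1" and T: "inj_on T {..<n}" "\<And>j. j < n \<Longrightarrow> T j > 0"
  obtains l where "\<And>j. j < n \<Longrightarrow> (\<Sum>k\<le>n. l k * moment d (T j) k) = 0"
    "\<And>t. t > 0 \<Longrightarrow> t \<notin> T ` {..<n} \<Longrightarrow> (\<Sum>k\<le>n. l k * moment d t k) \<noteq> 0"
    "\<And>x. (\<Sum>k\<le>n. l k * x k) = 0 \<Longrightarrow> \<exists>q. \<forall>k\<le>n. x k = (\<Sum>j<n. q j * moment d (T j) k)"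
proof -
  obtain l where l: "\<exists>k\<le>n. l k \<noteq> 0" "\<And>j. j < n \<Longrightarrow> (\<Sum>k\<le>n. moment d (T j) k * l k) = 0"
    using homogeneous_system_solvable[of "{..<n}" "{..n}" "\<lambda>j k. moment d (T j) k"] by auto
  have *: "l' k = 0" if "t > 0" "t \<notin> T ` {..<n}" "k \<le> n"
    "\<And>j. j < n \<Longrightarrow> (\<Sum>k\<le>n. l' k * moment d (T j) k) = 0" "(\<Sum>k\<le>n. l' k * moment d t k) = 0"
    for l' t k
    by (rule moment_linear_independent[OF d, of "insert t (T ` {..<n})" n l' k])
      (use that T in \<open>auto simp: card_image\<close>)
  show thesis
  proof
    show l1: "(\<Sum>k\<le>n. l k * moment d (T j) k) = 0" if "j < n" for j
      using l(2)[OF that] by (simp add: mult.commute)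
    show l2: "(\<Sum>k\<le>n. l k * moment d t k) \<noteq> 0" if "t > 0" "t \<notin> T ` {..<n}" for t
      using *[OF that, of _ l] l1 l(1) by blast
    fix x assume x: "(\<Sum>k\<le>n. l k * x k) = 0"
    obtain t where t: "t > 0" "t \<notin> T ` {..<n}"
    proof -
      have "infinite ({0<..} :: real set)" by (rule infinite_Ioi)
      then have "\<not> {0<..} \<subseteq> T ` {..<n}" by (meson finite_imageI finite_lessThan finite_subset)
      then show ?thesis using that by auto
    qed
    have "\<exists>J c. J \<subseteq> {..<n} \<and> finite J \<and> (\<forall>k\<in>{..n}. x k = (\<Sum>j\<in>J. c j * moment d (T j) k))"
    proof (rule in_span_if_functionals_vanish)
      fix D assume D: "\<And>j. j \<in> {..<n} \<Longrightarrow> (\<Sum>k\<le>n. D k * moment d (T j) k) = 0"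
      \<comment> \<open>\<open>A * D - B * l\<close> vanishes at the \<open>n\<close> given points
        and at \<open>t\<close>, hence is zero: up to scaling, \<open>l\<close> is the only
        functional killing the given points.\<close>
      define A where "A = (\<Sum>k\<le>n. l k * moment d t k)"
      define B where "B = (\<Sum>k\<le>n. D k * moment d t k)"
      have "A * D k - B * l k = 0" if "k \<le> n" for k
      proof (rule *[OF t that])
        have expand: "(\<Sum>k\<le>n. (A * D k - B * l k) * y k) =
            A * (\<Sum>k\<le>n. D k * y k) - B * (\<Sum>k\<le>n. l k * y k)" for y
          by (simp add: sum_distrib_left sum_subtractf algebra_simps)
        show "(\<Sum>k\<le>n. (A * D k - B * l k) * moment d (T j) k) = 0" if "j < n" for j
          unfolding expand using D l1 that by simp
        show "(\<Sum>k\<le>n. (A * D k - B * l k) * moment d t k) = 0"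
          unfolding expand by (simp add: A_def[symmetric] B_def[symmetric])
      qed
      then have "A * (\<Sum>k\<le>n. D k * x k) = B * (\<Sum>k\<le>n. l k * x k)"
        unfolding sum_distrib_left mult.assoc[symmetric] by (intro sum.cong) auto
      then show "(\<Sum>k\<in>{..n}. D k * x k) = 0" using x l2[OF t] by (simp add: A_def)
    qed auto
    then obtain J c where J: "J \<subseteq> {..<n}" "\<And>k. k \<le> n \<Longrightarrow> x k = (\<Sum>j\<in>J. c j * moment d (T j) k)"
      by auto
    have "x k = (\<Sum>j<n. (if j \<in> J then c j else 0) * moment d (T j) k)" if "k \<le> n" for k
      unfolding J(2)[OF that] using J(1) by (intro sum.mono_neutral_cong_left) auto
    then show "\<exists>q. \<forall>k\<le>n. x k = (\<Sum>j<n. q j * moment d (T j) k)"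
      by (intro exI[of _ "\<lambda>j. if j \<in> J then c j else 0"]) simp
  qed
qed

text \<open>Coefficient vectors of the linear forms whose powers are added. The parameters are
  distinct and positive, and the \<open>n\<close> nodes of block \<open>i\<close> span the
  hyperplane belonging to the operator \<open>L_i\<close>.\<close>

definition node :: "nat \<Rightarrow> nat \<Rightarrow> nat \<Rightarrow> nat \<Rightarrow> nat \<Rightarrow> complex" where
  "node n d i j = moment d (real (i * n + j + 1))"

definition node_comb :: "nat \<Rightarrow> nat \<Rightarrow> nat \<Rightarrow> (nat \<Rightarrow> complex) \<Rightarrow> nat \<Rightarrow> complex" where
  "node_comb n d i q k = (\<Sum>j<n. q j * node n d i j k)"

lemma node_index_inj:
  fixes i j i' j' n :: nat
  assumes "i * n + j = i' * n + j'" "j < n" "j' < n"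
  shows "i = i' \<and> j = j'"
proof -
  have "(i * n + j) div n = i" using assms(2) by simp
  moreover have "(i' * n + j') div n = i'" using assms(3) by simp
  ultimately have "i = i'" using assms(1) by simp
  then show ?thesis using assms(1) by simp
qed

lemma tendsto_eval_line:
  fixes F :: "('v, complex) mpol"
  assumes "F \<in> mpols V"
  shows "((\<lambda>\<epsilon>. eval_mpol F (\<lambda>v. x v + \<epsilon> * z v)) \<longlongrightarrow> eval_mpol F x) (at 0)"
proof (rule tendsto_eval_mpol[OF assms])
  fix v
  show "((\<lambda>\<epsilon>. x v + \<epsilon> * z v) \<longlongrightarrow> x v) (at 0)"
    by (rule tendsto_eq_intros | simp)+
qed

text \<open>A form \<open>D\<close> orthogonal to all tangent vectors vanishes on the hyperplanes spanned by the nodes,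
  so it is a product \<open>L\<^sub>1 \<cdots> L\<^sub>s E\<close>; vanishing of its gradient at the nodes then forces \<open>E\<close> to vanish
  there.\<close>

lemma no_functional_vanishes_on_tangent_space:
  assumes n: "n \<ge> 1" and d: "d \<ge> 1" and s: "s \<le> d" and large: "(d - s + n) choose n \<le> n * s"
    and D: "D \<in> forms {..n} d"
    and vanish: "\<And>i q. i < s \<Longrightarrow> eval_mpol D (node_comb n d i q) = 0"
    and grad: "\<And>i j k. i < s \<Longrightarrow> j < n \<Longrightarrow> k \<le> n \<Longrightarrow>
      (\<Sum>b\<in>monomials {..n} d. lookup D b * monom_pderiv (node n d i j) k b) = 0"
  shows "D = 0"
proof -
  define \<tau> where "\<tau> i j = real (i * n + j + 1)" for i j
  have node: "node n d i j = moment d (\<tau> i j)" for i j by (simp add: node_def \<tau>_def)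
  have \<tau>pos: "\<tau> i j > 0" for i j unfolding \<tau>_def of_nat_0_less_iff by simp
  have \<tau>inj: "i = i' \<and> j = j'" if "\<tau> i j = \<tau> i' j'" "j < n" "j' < n" for i j i' j'
  proof (rule node_index_inj)
    show "i * n + j = i' * n + j'" using that(1) unfolding \<tau>_def of_nat_eq_iff by simp
  qed (use that in auto)
  define hyp where "hyp i l \<longleftrightarrow> (\<forall>j<n. (\<Sum>k\<le>n. l k * moment d (\<tau> i j) k) = 0) \<and>
    (\<forall>t>0. t \<notin> \<tau> i ` {..<n} \<longrightarrow> (\<Sum>k\<le>n. l k * moment d t k) \<noteq> 0) \<and>
    (\<forall>x. (\<Sum>k\<le>n. l k * x k) = 0 \<longrightarrow> (\<exists>q. \<forall>k\<le>n. x k = (\<Sum>j<n. q j * moment d (\<tau> i j) k)))" for i l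
  have hyp_ex: "\<exists>l. hyp i l" for i
  proof -
    have inj: "inj_on (\<tau> i) {..<n}" using \<tau>inj by (auto simp: inj_on_def)
    show ?thesis
    proof (rule hyperplane_through_moment_points[OF d inj \<tau>pos])
      fix l
      assume "\<And>j. j < n \<Longrightarrow> (\<Sum>k\<le>n. l k * moment d (\<tau> i j) k) = 0"
        "\<And>t. t > 0 \<Longrightarrow> t \<notin> \<tau> i ` {..<n} \<Longrightarrow> (\<Sum>k\<le>n. l k * moment d t k) \<noteq> 0"
        "\<And>x. (\<Sum>k\<le>n. l k * x k) = 0 \<Longrightarrow> \<exists>q. \<forall>k\<le>n. x k = (\<Sum>j<n. q j * moment d (\<tau> i j) k)"
      then show ?thesis unfolding hyp_def by - (rule exI[of _ l], intro conjI allI impI; simp)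
    qed
  qed
  define l where "l i = (SOME l. hyp i l)" for i
  have hyp: "hyp i (l i)" for i unfolding l_def by (rule someI_ex[OF hyp_ex])
  have
    l1: "\<And>i j. j < n \<Longrightarrow> (\<Sum>k\<le>n. l i k * moment d (\<tau> i j) k) = 0" and
    l2: "\<And>i t. t > 0 \<Longrightarrow> t \<notin> \<tau> i ` {..<n} \<Longrightarrow> (\<Sum>k\<le>n. l i k * moment d t k) \<noteq> 0" and
    l3: "\<And>i x. (\<Sum>k\<le>n. l i k * x k) = 0 \<Longrightarrow>
      \<exists>q. \<forall>k\<le>n. x k = (\<Sum>j<n. q j * moment d (\<tau> i j) k)"
    using hyp unfolding hyp_def by simp_all
  define L where "L i x = (\<Sum>k\<le>n. l i k * x k)" for i and x :: "nat \<Rightarrow> complex"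
  have Lline: "L i (\<lambda>v. x v + \<epsilon> * z v) = L i x + \<epsilon> * L i z" for i x \<epsilon> z
    by (simp add: L_def sum_distrib_left algebra_simps sum.distrib)
  have L0: "L i (node n d i j) = 0" if "j < n" for i j
    using l1[OF that] by (simp add: L_def node)
  have Lne: "L i (node n d i' j) \<noteq> 0" if "i \<noteq> i'" "j < n" for i i' j
    unfolding L_def node using that \<tau>inj[of i' j i] by (intro l2) (auto simp: \<tau>pos)
  have lne: "\<exists>k\<le>n. l i k \<noteq> 0" for i
  proof (rule ccontr)
    assume "\<not> ?thesis"
    then have "L i (node n d (Suc i) 0) = 0" by (simp add: L_def)
    with Lne[of i "Suc i" 0] n show False by simp
  qed
  have Dm: "D \<in> mpols {..n}" using D forms_mpols by blast
  have vanishL: "eval_mpol D x = 0" if "i < s" "L i x = 0" for i x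
  proof -
    obtain q where q: "\<forall>k\<le>n. x k = (\<Sum>j<n. q j * moment d (\<tau> i j) k)"
      using l3[of i x] \<open>L i x = 0\<close> unfolding L_def by blast
    have "eval_mpol D x = eval_mpol D (node_comb n d i q)"
      using q by (intro eval_mpol_cong[OF Dm]) (auto simp: node_comb_def node)
    then show ?thesis using vanish that by simp
  qed
  have "\<exists>E. formfun {..n} (d - r) E \<and> (\<forall>x. eval_mpol D x = (\<Prod>i<r. L i x) * E x)" if "r \<le> s" for r
    using that
  proof (induction r)
    case 0
    have "formfun {..n} d (eval_mpol D)" using D by (auto simp: formfun_def)
    then show ?case by (intro exI[of _ "eval_mpol D"]) simp
  next
    case (Suc r)
    then obtain E where E: "formfun {..n} (d - r) E"
      "\<And>x. eval_mpol D x = (\<Prod>i<r. L i x) * E x" by auto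
    have r: "r < s" "d - r = Suc (d - Suc r)" using Suc.prems s by auto
    have E0: "E x = 0" if x: "L r x = 0" for x
    proof -
      \<comment> \<open>Moving along a node of block \<open>r\<close> stays on the hyperplane of
        \<open>L r\<close>, while every earlier \<open>L i\<close> becomes nonzero for small nonzero
        \<epsilon>. There \<open>E\<close> must vanish, and by continuity also at
        \<open>x\<close>.\<close>
      define v where "v = node n d r 0"
      obtain F where F: "F \<in> mpols {..n}" "E = eval_mpol F"
        using E(1) forms_mpols by (auto simp: formfun_def)
      have lim: "((\<lambda>\<epsilon>. E (\<lambda>k. x k + \<epsilon> * v k)) \<longlongrightarrow> E x) (at 0)"
        unfolding F(2) by (rule tendsto_eval_line[OF F(1)])
      have "eventually (\<lambda>\<epsilon>. L i x + \<epsilon> * L i v \<noteq> 0) (at 0)" if "i < r" for i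
      proof -
        have "L i v \<noteq> 0" unfolding v_def using that n by (intro Lne) auto
        then have "L i x + \<epsilon> * L i v = 0 \<longleftrightarrow> \<epsilon> = - L i x / L i v" for \<epsilon>
          by (auto simp: field_simps eq_neg_iff_add_eq_0)
        then show ?thesis using eventually_neq_at_within[of "- L i x / L i v" 0 UNIV] by simp
      qed
      then have "eventually (\<lambda>\<epsilon>. \<forall>i\<in>{..<r}. L i x + \<epsilon> * L i v \<noteq> 0) (at 0)"
        by (intro eventually_ball_finite) auto
      then have "eventually (\<lambda>\<epsilon>. E (\<lambda>k. x k + \<epsilon> * v k) = 0) (at 0)"
      proof eventually_elim
        case (elim \<epsilon>)
        let ?z = "\<lambda>k. x k + \<epsilon> * v k"
        have "L r ?z = 0" unfolding Lline using x L0 n by (simp add: v_def)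
        then have "eval_mpol D ?z = 0" using vanishL r by blast
        moreover have "(\<Prod>i<r. L i ?z) \<noteq> 0" unfolding Lline using elim by simp
        ultimately show ?case using E(2)[of ?z] by simp
      qed
      then have "((\<lambda>\<epsilon>. E (\<lambda>k. x k + \<epsilon> * v k)) \<longlongrightarrow> 0) (at 0)" by (rule tendsto_eventually)
      then show "E x = 0" using lim tendsto_unique[of "at (0::complex)"] by force
    qed
    obtain k where "k \<le> n" "l r k \<noteq> 0" using lne by blast
    then have "\<exists>Q. formfun {..n} (d - Suc r) Q \<and> (\<forall>x. E x = (\<Sum>v\<in>{..n}. l r v * x v) * Q x)"
      using E(1) r E0 unfolding L_def by (intro formfun_divide[of _ k]) auto
    then obtain Q where "formfun {..n} (d - Suc r) Q" "\<And>x. E x = L r x * Q x"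
      unfolding L_def by blast
    then show ?case using E(2) by (intro exI[of _ Q]) (simp add: mult_ac)
  qed
  then obtain E where E: "formfun {..n} (d - s) E" "\<And>x. eval_mpol D x = (\<Prod>i<s. L i x) * E x"
    by blast
  obtain F where F: "F \<in> forms {..n} (d - s)" "E = eval_mpol F" using E(1) by (auto simp: formfun_def)
  have Fm: "F \<in> mpols {..n}" using F forms_mpols by blast
  have Enode: "E (node n d i j) = 0" if ij: "i < s" "j < n" for i j
  proof -
    define p where "p = node n d i j"
    obtain k where k: "k \<le> n" "l i k \<noteq> 0" using lne by blast
    \<comment> \<open>A direction transversal to the hyperplane of \<open>L i\<close>. As
      \<open>D\<close> equals \<open>L i\<close> times \<open>R\<close> and
      \<open>L i p = 0\<close>, the derivative of \<open>D\<close> at \<open>p\<close> along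
      \<open>e\<close> is \<open>l i k * R p\<close>, and \<open>grad\<close> makes it 0.\<close>
    define e where "e v = (if v = k then 1 else 0 :: complex)" for v
    define R where "R x = (\<Prod>i'\<in>{..<s} - {i}. L i' x) * E x" for x
    have DR: "eval_mpol D x = L i x * R x" for x
      unfolding E(2) R_def using ij by (subst prod.remove[of _ i]) auto
    have Le: "L i e = l i k" using k by (simp add: L_def e_def if_distrib[of "(*) _"] cong: if_cong)
    have Lp: "L i p = 0" using L0 ij by (simp add: p_def)
    have limR: "((\<lambda>\<epsilon>. R (\<lambda>v. p v + \<epsilon> * e v)) \<longlongrightarrow> R p) (at 0)"
      unfolding R_def Lline F(2)
      by (rule tendsto_mult[OF tendsto_prod tendsto_eval_line[OF Fm]])
        (rule tendsto_eq_intros | simp)+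
    have "((\<lambda>\<epsilon>. eval_mpol D (\<lambda>v. p v + \<epsilon> * e v)) has_field_derivative
        (\<Sum>b\<in>monomials {..n} d. lookup D b * (\<Sum>v\<in>keys b. e v * monom_pderiv (\<lambda>v. p v + 0 * e v) v b)))
        (at 0)"
    proof -
      have fin: "finite (monomials {..n} d)" by (intro finite_monomials) auto
      have "eval_mpol D = (\<lambda>x. \<Sum>b\<in>monomials {..n} d. lookup D b * monom_val x b)"
        using D by (intro ext eval_mpol_superset fin) (auto simp: forms_def)
      then show ?thesis
        by (simp only:) (intro DERIV_sum DERIV_cmult monom_val_has_derivative,
          (rule derivative_eq_intros | simp)+)
    qed
    also have "(\<Sum>b\<in>monomials {..n} d. lookup D b *
        (\<Sum>v\<in>keys b. e v * monom_pderiv (\<lambda>v. p v + 0 * e v) v b)) =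
        (\<Sum>b\<in>monomials {..n} d. lookup D b * monom_pderiv p k b)"
    proof (intro sum.cong refl arg_cong[where f = "(*) _"])
      fix b assume "b \<in> monomials {..n} d"
      then have "(\<Sum>v\<in>keys b. e v * monom_pderiv p v b) = (\<Sum>v\<in>{..n}. e v * monom_pderiv p v b)"
        by (intro sum_keys_monom_pderiv) (auto simp: monomials_def)
      also have "\<dots> = monom_pderiv p k b"
        using k by (simp add: e_def if_distrib[of "\<lambda>x. x * _"] cong: if_cong)
      finally show "(\<Sum>v\<in>keys b. e v * monom_pderiv (\<lambda>v. p v + 0 * e v) v b) = monom_pderiv p k b"
        by simp
    qed
    also have "\<dots> = 0" using grad ij k by (simp add: p_def)
    finally have "((\<lambda>\<epsilon>. (eval_mpol D (\<lambda>v. p v + \<epsilon> * e v) - eval_mpol D p) / \<epsilon>) \<longlongrightarrow> 0) (at 0)"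
      unfolding has_field_derivative_iff by simp
    moreover have "eventually (\<lambda>\<epsilon>. (eval_mpol D (\<lambda>v. p v + \<epsilon> * e v) - eval_mpol D p) / \<epsilon> =
        l i k * R (\<lambda>v. p v + \<epsilon> * e v)) (at 0)"
      unfolding DR Lline Lp Le
      by (rule eventually_mono[OF eventually_neq_at_within[of 0]]) simp
    ultimately have "((\<lambda>\<epsilon>. l i k * R (\<lambda>v. p v + \<epsilon> * e v)) \<longlongrightarrow> 0) (at 0)"
      by (rule Lim_transform_eventually)
    moreover have "((\<lambda>\<epsilon>. l i k * R (\<lambda>v. p v + \<epsilon> * e v)) \<longlongrightarrow> l i k * R p) (at 0)"
      by (intro tendsto_mult tendsto_const limR)
    ultimately have "l i k * R p = 0"
      using tendsto_unique[of "at (0::complex)"] by force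
    then have "R p = 0" using k by simp
    moreover have "(\<Prod>i'\<in>{..<s} - {i}. L i' p) \<noteq> 0" using Lne ij by (auto simp: p_def)
    ultimately show ?thesis by (simp add: R_def p_def)
  qed
  \<comment> \<open>\<open>F\<close> has no more terms than there are nodes. It is viewed with
    degree bound \<open>d\<close> instead of \<open>d - s\<close> to match the curve on which the
    nodes lie.\<close>
  have "F = 0"
  proof (rule moment_unisolvent)
    show "F \<in> mpols_le {..n} d" using F(1) s by (auto simp: forms_def mpols_le_def monomials_def)
    let ?Z = "(\<lambda>(i, j). \<tau> i j) ` ({..<s} \<times> {..<n})"
    show "finite ?Z" by simp
    have "card ?Z = s * n" by (subst card_image) (auto simp: inj_on_def dest: \<tau>inj)
    moreover have "card (keys F) \<le> card (monomials {..n} (d - s))"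
      using F(1) by (intro card_mono finite_monomials) (auto simp: forms_def)
    ultimately show "card (keys F) \<le> card ?Z" using large by (simp add: card_monomials mult.commute)
    show "t > 0" if "t \<in> ?Z" for t using that \<tau>pos by auto
    show "eval_mpol F (moment d t) = 0" if "t \<in> ?Z" for t
      using that Enode F(2) by (auto simp: node)
  qed
  then have "eval_mpol D x = eval_mpol 0 x" for x using E(2) F(2) by simp
  then show "D = 0" by (rule mpol_eq_if_eval_eq)
qed

text \<open>The two families are the velocities available at a sum of powers: moving a node in a
  coordinate direction, and adding the power of a vector in the span of one block, which
  \<open>L_i\<close> still kills.\<close>

lemma tangent_spanning:
  assumes n: "n \<ge> 1" and d: "d \<ge> 1" and s: "s \<le> d" and large: "(d - s + n) choose n \<le> n * s"
  shows "\<exists>a Q c. finite Q \<and> (\<forall>b\<in>monomials {..n} d. y b =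
    (\<Sum>i<s. \<Sum>j<n. \<Sum>k\<le>n. a i j k * monom_pderiv (node n d i j) k b) +
    (\<Sum>i<s. \<Sum>q\<in>Q. c i q * monom_val (node_comb n d i q) b))"
proof -
  define M where "M = monomials {..n} d"
  have fM: "finite M" unfolding M_def by (intro finite_monomials) auto
  define fam :: "(nat \<times> nat \<times> nat) + (nat \<times> (nat \<Rightarrow> complex)) \<Rightarrow> (nat \<Rightarrow>\<^sub>0 nat) \<Rightarrow> complex"
    where "fam = case_sum (\<lambda>(i, j, k). monom_pderiv (node n d i j) k)
      (\<lambda>(i, q). monom_val (node_comb n d i q))"
  define A where "A = {..<s} \<times> {..<n} \<times> {..n}"
  define I where "I = Inl ` A \<union> Inr ` ({..<s} \<times> (UNIV :: (nat \<Rightarrow> complex) set))"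
  have "\<exists>J c. J \<subseteq> I \<and> finite J \<and> (\<forall>b\<in>M. y b = (\<Sum>\<iota>\<in>J. c \<iota> * fam \<iota> b))"
  proof (rule in_span_if_functionals_vanish[OF fM])
    fix D assume D: "\<And>\<iota>. \<iota> \<in> I \<Longrightarrow> (\<Sum>b\<in>M. D b * fam \<iota> b) = 0"
    define F where "F = (\<Sum>b\<in>M. single b (D b))"
    have lF: "lookup F b = (if b \<in> M then D b else 0)" for b
      unfolding F_def by (rule single_sum_lookup[OF fM])
    have F: "F \<in> forms {..n} d" by (auto simp: forms_def in_keys_iff lF M_def split: if_splits)
    have "F = 0"
    proof (rule no_functional_vanishes_on_tangent_space[OF n d s large F])
      fix i q assume "i < s"
      then have "Inr (i, q) \<in> I" by (auto simp: I_def)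
      from D[OF this] show "eval_mpol F (node_comb n d i q) = 0"
        using eval_mpol_superset[OF fM, of F] F by (simp add: forms_def M_def[symmetric] fam_def lF)
    next
      fix i j k assume "i < s" "j < n" "k \<le> n"
      then have "Inl (i, j, k) \<in> I" by (auto simp: I_def A_def)
      from D[OF this] show "(\<Sum>b\<in>monomials {..n} d. lookup F b * monom_pderiv (node n d i j) k b) = 0"
        by (simp add: M_def[symmetric] fam_def lF)
    qed
    then have "D b = 0" if "b \<in> M" for b using lF[of b] that by simp
    then show "(\<Sum>b\<in>M. D b * y b) = 0" by simp
  qed
  then obtain J c where J: "J \<subseteq> I" "finite J" "\<And>b. b \<in> M \<Longrightarrow> y b = (\<Sum>\<iota>\<in>J. c \<iota> * fam \<iota> b)"
    by blast
  define Q where "Q = (\<lambda>\<iota>. case \<iota> of Inl _ \<Rightarrow> (\<lambda>_. 0) | Inr (i, q) \<Rightarrow> q) ` J"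
  define c' where "c' \<iota> = (if \<iota> \<in> J then c \<iota> else 0)" for \<iota>
  have fQ: "finite Q" using J by (simp add: Q_def)
  have sub: "J \<subseteq> Inl ` A \<union> Inr ` ({..<s} \<times> Q)"
  proof
    fix \<iota> assume \<iota>: "\<iota> \<in> J"
    show "\<iota> \<in> Inl ` A \<union> Inr ` ({..<s} \<times> Q)"
    proof (cases \<iota>)
      case (Inl x)
      then show ?thesis using \<iota> J(1) by (auto simp: I_def)
    next
      case (Inr x)
      obtain i q where x: "x = (i, q)" by (cases x)
      then have "i < s" using \<iota> J(1) Inr by (auto simp: I_def)
      moreover have "q \<in> Q" unfolding Q_def using \<iota> Inr x by (intro image_eqI[of _ _ \<iota>]) auto
      ultimately show ?thesis using Inr x by auto
    qed
  qed
  have fA: "finite A" by (simp add: A_def)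
  have "y b = (\<Sum>i<s. \<Sum>j<n. \<Sum>k\<le>n. c' (Inl (i, j, k)) * monom_pderiv (node n d i j) k b) +
    (\<Sum>i<s. \<Sum>q\<in>Q. c' (Inr (i, q)) * monom_val (node_comb n d i q) b)" if b: "b \<in> M" for b
  proof -
    have "y b = (\<Sum>\<iota>\<in>Inl ` A \<union> Inr ` ({..<s} \<times> Q). c' \<iota> * fam \<iota> b)"
      unfolding J(3)[OF b] using sub fA fQ
      by (intro sum.mono_neutral_cong_left) (auto simp: c'_def)
    also have "\<dots> = (\<Sum>\<iota>\<in>Inl ` A. c' \<iota> * fam \<iota> b) + (\<Sum>\<iota>\<in>Inr ` ({..<s} \<times> Q). c' \<iota> * fam \<iota> b)"
      using fA fQ by (intro sum.union_disjoint) auto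
    also have "\<dots> = (\<Sum>z\<in>A. c' (Inl z) * fam (Inl z) b) + (\<Sum>z\<in>{..<s} \<times> Q. c' (Inr z) * fam (Inr z) b)"
      by (simp add: sum.reindex comp_def)
    finally show ?thesis
      by (simp add: A_def fam_def sum.cartesian_product case_prod_unfold)
  qed
  then show ?thesis unfolding M_def using fQ
    by (intro exI[of _ "\<lambda>i j k. c' (Inl (i, j, k))"] exI[of _ Q] exI[of _ "\<lambda>i q. c' (Inr (i, q))"])
      blast
qed

section \<open>Many summands: an explicit dominant family of sums\<close>

section \<open>Enough summands\<close>

lemma codim_one_form_of_coordinates:
  assumes l: "k0 \<le> n" "l k0 \<noteq> 0" and C: "\<And>b. (\<Sum>k\<le>n. l k * C (b + single k 1)) = 0"
  shows "codim_one_form n d (\<Sum>b\<in>monomials {..n} d. single b (C b / expfact b))" (is "codim_one_form n d ?g")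
proof -
  have fM: "finite (monomials {..n} d)" by (intro finite_monomials) auto
  have dc: "dcoef ?g b = (if b \<in> monomials {..n} d then C b else 0)" for b
    by (simp add: dcoef_def single_sum_lookup[OF fM])
  have "(\<Sum>k\<le>n. l k * dcoef ?g (b + single k 1)) = 0" for b
  proof (cases "keys b \<subseteq> {..n} \<and> mdeg b + 1 = d")
    case True
    then have "b + single k 1 \<in> monomials {..n} d" if "k \<le> n" for k
      using that by (auto simp: monomials_def keys_add_nat mdeg_add)
    then show ?thesis using C[of b] unfolding dc by simp
  next
    case False
    then have "b + single k 1 \<notin> monomials {..n} d" for k
      by (auto simp: monomials_def keys_add_nat mdeg_add)
    then show ?thesis unfolding dc by simp
  qed
  moreover have "?g \<in> S_piece n d" by (intro forms_sum forms_single)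
  ultimately show ?thesis unfolding codim_one_form_iff using l by blast
qed

lemma monom_val_killed:
  assumes "(\<Sum>k\<le>n. l k * x k) = 0"
  shows "(\<Sum>k\<le>n. l k * monom_val x (b + single k 1)) = 0"
proof -
  have "(\<Sum>k\<le>n. l k * monom_val x (b + single k 1)) = monom_val x b * (\<Sum>k\<le>n. l k * x k)"
    by (simp add: monom_val_add sum_distrib_left mult_ac)
  then show ?thesis using assms by simp
qed

text \<open>There is one parameter \<open>t w\<close> per monomial \<open>w\<close>; to first order
  it follows a tangent expression for the unit vector at \<open>w\<close>. The resulting map \<phi>
  has derivative the identity at 0, while each of its values is a sum of \<open>s\<close>
  codimension one forms by construction.\<close>

lemma generic_form_is_codim_one_sum:
  assumes n: "n \<ge> 1" and d: "d \<ge> 1" and s: "s \<le> d" and large: "(d - s + n) choose n \<le> n * s"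
  shows "\<exists>u\<in>mpols (monomials {..n} d). u \<noteq> 0 \<and> (\<forall>f\<in>S_piece n d. eval_mpol u (dcoef f) \<noteq> 0 \<longrightarrow>
    (\<exists>gs. length gs = s \<and> codim_one_decomposition n d f gs))"
proof -
  define M where "M = monomials {..n} d"
  have fM: "finite M" unfolding M_def by (intro finite_monomials) auto
  define rep where "rep w a Q c \<longleftrightarrow> finite Q \<and> (\<forall>b\<in>M. (if b = w then 1 else 0) =
    (\<Sum>i<s. \<Sum>j<n. \<Sum>k\<le>n. a i j k * monom_pderiv (node n d i j) k b) +
    (\<Sum>i<s. \<Sum>q\<in>Q. c i q * monom_val (node_comb n d i q) b))" for w a Q c
  have "\<exists>a Q c. rep w a Q c" for w
    unfolding rep_def M_def by (rule tangent_spanning[OF assms])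
  then obtain a Q0 c0 where "\<And>w. rep w (a w) (Q0 w) (c0 w)" by metis
  then have fQ0: "\<And>w. finite (Q0 w)" and sp0: "\<And>w b. b \<in> M \<Longrightarrow> (if b = w then 1 else 0) =
    (\<Sum>i<s. \<Sum>j<n. \<Sum>k\<le>n. a w i j k * monom_pderiv (node n d i j) k b) +
    (\<Sum>i<s. \<Sum>q\<in>Q0 w. c0 w i q * monom_val (node_comb n d i q) b)"
    unfolding rep_def by blast+
  define Q where "Q = (\<Union>w\<in>M. Q0 w)"
  define c where "c w i q = (if q \<in> Q0 w then c0 w i q else 0)" for w i q
  have fQ: "finite Q" using fQ0 fM by (simp add: Q_def)
  have sp: "(if b = w then 1 else 0) =
    (\<Sum>i<s. \<Sum>j<n. \<Sum>k\<le>n. a w i j k * monom_pderiv (node n d i j) k b) +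
    (\<Sum>i<s. \<Sum>q\<in>Q. c w i q * monom_val (node_comb n d i q) b)" if "b \<in> M" "w \<in> M" for w b
  proof -
    have "(\<Sum>q\<in>Q0 w. c0 w i q * monom_val (node_comb n d i q) b) =
        (\<Sum>q\<in>Q. c w i q * monom_val (node_comb n d i q) b)" for i
      using fQ that by (intro sum.mono_neutral_cong_left) (auto simp: Q_def c_def)
    then show ?thesis using sp0[OF that(1), of w] by simp
  qed
  \<comment> \<open>\<open>P\<close> moves the nodes affinely in \<open>t\<close>. \<open>C\<close>
    has no constant term, so the extra powers are absent at \<open>t = 0\<close>; they are powers of
    combinations of the moved nodes, so each block stays within a hyperplane.\<close>
  define P where "P i j t k = node n d i j k + (\<Sum>w\<in>M. t w * a w i j k)" for i j t k
  define C where "C i q t = (\<Sum>w\<in>M. t w * c w i q)" for i q t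
  define G where "G i t b = (\<Sum>j<n. monom_val (P i j t) b) +
    (\<Sum>q\<in>Q. C i q t * monom_val (\<lambda>k. \<Sum>j<n. q j * P i j t k) b)" for i t b
  define \<phi> where "\<phi> b t = (\<Sum>i<s. G i t b)" for b t
  have "polyfun M (\<phi> b)" for b
    unfolding \<phi>_def G_def P_def C_def monom_val_def
    by (intro polyfun_sum polyfun_add polyfun_mult polyfun_prod polyfun_power polyfun_const polyfun_var)
  then obtain \<Phi> where \<Phi>: "\<And>b. \<Phi> b \<in> mpols M" "\<And>b. \<phi> b = eval_mpol (\<Phi> b)"
    unfolding polyfun_def by metis
  have der: "((\<lambda>\<epsilon>. \<phi> b (\<lambda>w. \<epsilon> * t w)) has_field_derivative t b) (at 0)" if b: "b \<in> M" for b t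
  proof -
    define A where "A i j k = (\<Sum>w\<in>M. t w * a w i j k)" for i j k
    have Pe: "P i j (\<lambda>w. \<epsilon> * t w) k = node n d i j k + \<epsilon> * A i j k" for i j \<epsilon> k
      by (simp add: P_def A_def sum_distrib_left mult_ac)
    have Ce: "C i q (\<lambda>w. \<epsilon> * t w) = \<epsilon> * C i q t" for i q \<epsilon>
      by (simp add: C_def sum_distrib_left mult_ac)
    have bV: "keys b \<subseteq> {..n}" using b by (simp add: M_def monomials_def)
    have dP: "((\<lambda>\<epsilon>. monom_val (\<lambda>k. node n d i j k + \<epsilon> * A i j k) b) has_field_derivative
        (\<Sum>k\<le>n. A i j k * monom_pderiv (node n d i j) k b)) (at 0)" for i j
    proof -
      have "((\<lambda>\<epsilon>. node n d i j k + \<epsilon> * A i j k) has_field_derivative A i j k) (at 0)" for k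
        by (rule derivative_eq_intros | simp)+
      from monom_val_has_derivative[OF this, where b = b] show ?thesis
        using sum_keys_monom_pderiv[of "{..n}" b] bV by simp
    qed
    have dQ: "((\<lambda>\<epsilon>. \<epsilon> * C i q t * monom_val (\<lambda>k. \<Sum>j<n. q j * (node n d i j k + \<epsilon> * A i j k)) b)
        has_field_derivative C i q t * monom_val (node_comb n d i q) b) (at 0)" for i q
    proof -
      have "((\<lambda>\<epsilon>. \<Sum>j<n. q j * (node n d i j k + \<epsilon> * A i j k)) has_field_derivative
          (\<Sum>j<n. q j * A i j k)) (at 0)" for k
        by (intro DERIV_sum) (auto intro!: derivative_eq_intros)
      \<comment> \<open>Thanks to the factor \<epsilon>, the motion of the nodes inside the extra
        powers contributes nothing at 0.\<close>
      from DERIV_mult[OF DERIV_ident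
          DERIV_cmult[OF monom_val_has_derivative[OF this, where b = b], of "C i q t"]]
      have "((\<lambda>\<epsilon>. \<epsilon> * (C i q t * monom_val (\<lambda>k. \<Sum>j<n. q j * (node n d i j k + \<epsilon> * A i j k)) b))
        has_field_derivative C i q t * monom_val (\<lambda>k. \<Sum>j<n. q j * (node n d i j k + 0 * A i j k)) b) (at 0)"
        by simp
      then show ?thesis by (simp add: node_comb_def[abs_def] mult.assoc)
    qed
    have "((\<lambda>\<epsilon>. \<phi> b (\<lambda>w. \<epsilon> * t w)) has_field_derivative
        (\<Sum>i<s. (\<Sum>j<n. \<Sum>k\<le>n. A i j k * monom_pderiv (node n d i j) k b) +
          (\<Sum>q\<in>Q. C i q t * monom_val (node_comb n d i q) b))) (at 0)"
      unfolding \<phi>_def G_def Pe Ce by (intro DERIV_sum DERIV_add dP dQ)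
    also have "(\<Sum>i<s. (\<Sum>j<n. \<Sum>k\<le>n. A i j k * monom_pderiv (node n d i j) k b) +
          (\<Sum>q\<in>Q. C i q t * monom_val (node_comb n d i q) b)) =
        (\<Sum>w\<in>M. t w * ((\<Sum>i<s. \<Sum>j<n. \<Sum>k\<le>n. a w i j k * monom_pderiv (node n d i j) k b) +
          (\<Sum>i<s. \<Sum>q\<in>Q. c w i q * monom_val (node_comb n d i q) b)))"
    proof -
      have lin1: "(\<Sum>z\<in>Z. (\<Sum>w\<in>M. t w * \<alpha> w z) * \<mu> z) = (\<Sum>w\<in>M. t w * (\<Sum>z\<in>Z. \<alpha> w z * \<mu> z))"
        for Z :: "'z set" and \<alpha> \<mu>
        unfolding sum_distrib_right sum_distrib_left mult.assoc by (rule sum.swap)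
      have lin2: "(\<Sum>z\<in>Z. \<Sum>w\<in>M. t w * \<alpha> w z) = (\<Sum>w\<in>M. t w * (\<Sum>z\<in>Z. \<alpha> w z))"
        for Z :: "nat set" and \<alpha>
        unfolding sum_distrib_left by (rule sum.swap)
      show ?thesis
        unfolding A_def C_def lin1 lin2 sum.distrib distrib_left ..
    qed
    also have "\<dots> = (\<Sum>w\<in>M. t w * (if b = w then 1 else 0))"
      using sp[OF b] by (intro sum.cong refl) simp
    also have "\<dots> = t b" using b fM by (simp add: if_distrib[of "(*) _"] cong: if_cong)
    finally show ?thesis .
  qed
  have indep: "F = 0" if "F \<in> mpols M" "\<And>x. eval_mpol F (\<lambda>v. eval_mpol (\<Phi> v) x) = 0" for F
    by (rule independent_if_deriv_id[OF fM that(1), of \<phi>]) (use der that(2) \<Phi>(2) in auto)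
  obtain u where u: "u \<in> mpols M" "u \<noteq> 0"
    "\<And>y. eval_mpol u y \<noteq> 0 \<Longrightarrow> \<exists>t. \<forall>b\<in>M. eval_mpol (\<Phi> b) t = y b"
    using poly_map_image[of M \<Phi>, OF fM \<Phi>(1) indep] by blast
  have "\<exists>gs. length gs = s \<and> codim_one_decomposition n d f gs"
    if f: "f \<in> S_piece n d" "eval_mpol u (dcoef f) \<noteq> 0" for f
  proof -
    obtain t where t: "\<And>b. b \<in> M \<Longrightarrow> \<phi> b t = dcoef f b" using u(3)[OF f(2)] \<Phi>(2) by auto
    define g where "g i = (\<Sum>b\<in>monomials {..n} d. single b (G i t b / expfact b))" for i
    have g: "codim_one_form n d (g i)" for i
    proof -
      \<comment> \<open>The \<open>n\<close> moved nodes live in dimension \<open>n + 1\<close>, so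
        some nonzero operator kills them all, even where they have become dependent.\<close>
      obtain l where l: "\<exists>k\<in>{..n}. l k \<noteq> 0" "\<forall>j\<in>{..<n}. (\<Sum>k\<le>n. P i j t k * l k) = 0"
        using homogeneous_system_solvable[of "{..<n}" "{..n}" "\<lambda>j. P i j t"] by auto
      then obtain k0 where k0: "k0 \<le> n" "l k0 \<noteq> 0" by auto
      have lP: "(\<Sum>k\<le>n. l k * P i j t k) = 0" if "j < n" for j
        using l(2) that by (simp add: mult.commute)
      have lq: "(\<Sum>k\<le>n. l k * (\<Sum>j<n. q j * P i j t k)) = 0" for q
      proof -
        have "(\<Sum>k\<le>n. l k * (\<Sum>j<n. q j * P i j t k)) = (\<Sum>j<n. q j * (\<Sum>k\<le>n. l k * P i j t k))"
          unfolding sum_distrib_left by (subst sum.swap) (simp add: mult_ac)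
        then show ?thesis using lP by simp
      qed
      have "(\<Sum>k\<le>n. l k * G i t (b + single k 1)) = 0" for b
      proof -
        have "(\<Sum>k\<le>n. l k * G i t (b + single k 1)) =
            (\<Sum>j<n. \<Sum>k\<le>n. l k * monom_val (P i j t) (b + single k 1)) +
            (\<Sum>q\<in>Q. C i q t * (\<Sum>k\<le>n. l k * monom_val (\<lambda>k. \<Sum>j<n. q j * P i j t k) (b + single k 1)))"
          unfolding G_def distrib_left sum.distrib sum_distrib_left
          by (subst (1 2) sum.swap) (simp add: mult_ac)
        then show ?thesis using monom_val_killed[OF lP] monom_val_killed[OF lq] by simp
      qed
      then show ?thesis unfolding g_def using k0 by (intro codim_one_form_of_coordinates)
    qed
    have lg: "lookup (g i) b = (if b \<in> M then G i t b / expfact b else 0)" for i b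
      unfolding g_def M_def[symmetric] by (rule single_sum_lookup[OF fM])
    have "f = (\<Sum>i<s. g i)"
    proof (rule poly_mapping_eqI)
      fix b
      show "lookup f b = lookup (\<Sum>i<s. g i) b"
      proof (cases "b \<in> M")
        case True
        then have "lookup (\<Sum>i<s. g i) b = \<phi> b t / expfact b"
          by (simp add: lookup_sum lg \<phi>_def sum_divide_distrib)
        then show ?thesis using t[OF True] by (simp add: dcoef_def)
      next
        case False
        then have "b \<notin> keys f" using f(1) by (auto simp: forms_def M_def)
        then show ?thesis using False by (simp add: lookup_sum lg in_keys_iff)
      qed
    qed
    then have "codim_one_decomposition n d f (map g [0..<s])"
      using g by (auto simp: codim_one_decomposition_def interv_sum_list_conv_sum_set_nat
          atLeast0LessThan)
    then show ?thesis by (intro exI[of _ "map g [0..<s]"]) simp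
  qed
  then show ?thesis using u unfolding M_def by blast
qed

section \<open>From affine conditions to open sets of the projective space, and the value of
  \<open>s_min\<close>\<close>

section \<open>The generic number of summands\<close>

lemma proj_point_self: "f \<in> proj_point f"
  unfolding proj_point_def smul_def by (auto intro: exI[of _ 1])

lemma proj_forms_iff: "f \<in> S_piece n d \<Longrightarrow> f \<noteq> 0 \<Longrightarrow> proj_point f \<in> proj_forms n d"
  unfolding proj_forms_def by blast

lemma codim_one_form_smul:
  assumes "codim_one_form n d g"
  shows "codim_one_form n d (smul c g)"
proof -
  from assms obtain l where l: "g \<in> S_piece n d" "\<exists>k\<le>n. l k \<noteq> 0"
    "\<And>b. (\<Sum>k\<le>n. l k * dcoef g (b + single k 1)) = 0"
    unfolding codim_one_form_iff by blast
  have "(\<Sum>k\<le>n. l k * dcoef (smul c g) (b + single k 1)) = 0" for b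
  proof -
    have "(\<Sum>k\<le>n. l k * dcoef (smul c g) (b + single k 1)) =
        c * (\<Sum>k\<le>n. l k * dcoef g (b + single k 1))"
      by (simp add: dcoef_def lookup_smul sum_distrib_left mult_ac)
    then show ?thesis using l(3) by simp
  qed
  moreover have "smul c g \<in> S_piece n d"
    using l(1) by (auto simp: forms_def in_keys_iff lookup_smul)
  ultimately show ?thesis unfolding codim_one_form_iff using l(2) by blast
qed

lemma codim_one_decomposition_smul:
  assumes "codim_one_decomposition n d (smul c f) gs" "c \<noteq> 0"
  shows "codim_one_decomposition n d f (map (smul (1 / c)) gs)"
proof -
  have "f = smul (1 / c) (smul c f)"
    by (rule poly_mapping_eqI) (use assms(2) in \<open>simp add: lookup_smul\<close>)
  also have "\<dots> = smul (1 / c) (sum_list gs)"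
    using assms(1) by (simp add: codim_one_decomposition_def)
  also have "\<dots> = sum_list (map (smul (1 / c)) gs)"
    by (induction gs) (auto simp: smul_def distrib_left)
  finally show ?thesis
    using assms(1) by (auto simp: codim_one_decomposition_def codim_one_form_smul)
qed

definition generically_sufficient :: "nat \<Rightarrow> nat \<Rightarrow> nat \<Rightarrow> bool" where
  "generically_sufficient n d s \<longleftrightarrow> (\<exists>U. zariski_open n d U \<and> U \<noteq> {} \<and>
     (\<forall>f \<in> S_piece n d. f \<noteq> 0 \<longrightarrow> proj_point f \<in> U \<longrightarrow>
        (\<exists>gs. length gs = s \<and> codim_one_decomposition n d f gs)))"

text \<open>The affine condition \<open>u\<close> need not be homogeneous. The open set consists of
  the points where some homogeneous component is nonzero; for such \<open>f\<close> the condition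
  along the line of multiples of \<open>f\<close> is a nonzero polynomial, so some nonzero multiple
  decomposes, and scaling back decomposes \<open>f\<close>.\<close>

lemma generically_sufficient_if_large:
  assumes n: "n \<ge> 1" and d: "d \<ge> 1" and s: "s \<le> d" and large: "(d - s + n) choose n \<le> n * s"
  shows "generically_sufficient n d s"
proof -
  define M where "M = monomials {..n} d"
  have fM: "finite M" unfolding M_def by (intro finite_monomials) auto
  obtain u where u: "u \<in> mpols M" "u \<noteq> 0" "\<And>f. f \<in> S_piece n d \<Longrightarrow> eval_mpol u (dcoef f) \<noteq> 0 \<Longrightarrow>
    \<exists>gs. length gs = s \<and> codim_one_decomposition n d f gs"
    using generic_form_is_codim_one_sum[OF assms] unfolding M_def by blast
  have "polyfun M (\<lambda>x. eval_mpol u (\<lambda>b. expfact b * x b))"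
    using u(1) by (intro polyfun_subst polyfun_mult polyfun_const polyfun_var)
  then obtain F where F: "F \<in> mpols M" "\<And>x. eval_mpol u (\<lambda>b. expfact b * x b) = eval_mpol F x"
    unfolding polyfun_def by (auto dest: fun_cong)
  have Fu: "eval_mpol F (lookup f) = eval_mpol u (dcoef f)" for f
    unfolding F(2)[symmetric] dcoef_def ..
  have "F \<noteq> 0"
  proof
    assume "F = 0"
    obtain x where "eval_mpol u x \<noteq> 0" using mpol_nonzero_eval u fM by blast
    then show False using F(2)[of "\<lambda>b. x b / expfact b"] \<open>F = 0\<close> by simp
  qed
  then obtain a where a: "lookup F a \<noteq> 0" by (metis lookup_zero poly_mapping_eqI)
  define Z where "Z = {p \<in> proj_forms n d. \<forall>H\<in>range (\<lambda>e. hpart e F). \<forall>f\<in>p. eval_mpol H (lookup f) = 0}"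
  have hp: "hpart e F \<in> forms M e" for e by (rule hpart_forms[OF F(1)])
  have closed: "zariski_closed n d Z"
    unfolding zariski_closed_def
    by (rule exI[of _ "range (\<lambda>e. hpart e F)"]) (use hp in \<open>auto simp: Z_def M_def\<close>)
  have "proj_forms n d - (proj_forms n d - Z) = Z" by (auto simp: Z_def)
  then have op: "zariski_open n d (proj_forms n d - Z)"
    using closed by (auto simp: zariski_open_def)
  have ne: "proj_forms n d - Z \<noteq> {}"
  proof -
    \<comment> \<open>Requiring the coordinate at \<open>b0\<close> to be nonzero ensures
      \<open>f \<noteq> 0\<close>, which a nonzero component of degree 0 would not.\<close>
    define b0 where "b0 = single (0::nat) d"
    have b0: "b0 \<in> M" by (auto simp: b0_def M_def monomials_def)
    define e where "e = mdeg a"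
    have "hpart e F \<noteq> 0" using a by (metis e_def lookup_hpart lookup_zero)
    moreover have "single (single b0 1) 1 \<noteq> (0 :: (nat \<Rightarrow>\<^sub>0 nat, complex) mpol)"
      by (metis lookup_single_eq lookup_zero zero_neq_one)
    ultimately have "hpart e F * single (single b0 1) 1 \<noteq> 0" by simp
    moreover have "hpart e F * single (single b0 1) 1 \<in> mpols M"
      using hp forms_mpols b0 by (intro mpols_mult mpols_single) auto
    ultimately obtain x where x: "eval_mpol (hpart e F * single (single b0 1) 1) x \<noteq> 0"
      using mpol_nonzero_eval fM by blast
    define f where "f = (\<Sum>b\<in>M. single b (x b))"
    have lf: "lookup f b = (if b \<in> M then x b else 0)" for b
      unfolding f_def by (rule single_sum_lookup[OF fM])
    have fS: "f \<in> S_piece n d" unfolding f_def M_def by (intro forms_sum forms_single)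
    have "x b0 \<noteq> 0" using x by auto
    then have "f \<noteq> 0" using lf[of b0] b0 by auto
    have "hpart e F \<in> mpols M" using hp forms_mpols by blast
    then have "eval_mpol (hpart e F) (lookup f) = eval_mpol (hpart e F) x"
      using lf by (intro eval_mpol_cong) auto
    then have "eval_mpol (hpart e F) (lookup f) \<noteq> 0" using x by auto
    then have "proj_point f \<notin> Z" using proj_point_self by (auto simp: Z_def)
    then show ?thesis using proj_forms_iff[OF fS \<open>f \<noteq> 0\<close>] by blast
  qed
  have "\<exists>gs. length gs = s \<and> codim_one_decomposition n d f gs"
    if f: "f \<in> S_piece n d" "f \<noteq> 0" "proj_point f \<in> proj_forms n d - Z" for f
  proof -
    from f(3) obtain e g where g: "g \<in> proj_point f" "eval_mpol (hpart e F) (lookup g) \<noteq> 0"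
      by (auto simp: Z_def)
    then obtain c where "g = smul c f" by (auto simp: proj_point_def)
    then have "lookup g = (\<lambda>b. c * lookup f b)" by (simp add: fun_eq_iff lookup_smul)
    then have "eval_mpol (hpart e F) (lookup g) = c ^ e * eval_mpol (hpart e F) (lookup f)"
      using eval_form_scale[OF hp] by simp
    then have he: "eval_mpol (hpart e F) (lookup f) \<noteq> 0" using g(2) by auto
    obtain K where K: "\<And>b. b \<in> keys F \<Longrightarrow> mdeg b \<le> K" using mdeg_bounded by blast
    define P where "P = (\<Sum>e\<le>K. monom (eval_mpol (hpart e F) (lookup f)) e)"
    have Pt: "poly P t = eval_mpol F (lookup (smul t f))" for t
    proof -
      have "lookup (smul t f) = (\<lambda>b. t * lookup f b)" by (simp add: fun_eq_iff lookup_smul)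
      then have "eval_mpol (hpart e F) (lookup (smul t f)) =
          t ^ e * eval_mpol (hpart e F) (lookup f)" for e
        using eval_form_scale[OF hp] by simp
      moreover have "eval_mpol F (lookup (smul t f)) =
          (\<Sum>e\<le>K. eval_mpol (hpart e F) (lookup (smul t f)))"
        using arg_cong[OF sum_hpart[OF K], where f = "\<lambda>F. eval_mpol F (lookup (smul t f))"] by simp
      ultimately show ?thesis by (simp add: P_def poly_sum poly_monom mult.commute)
    qed
    have "e \<le> K"
    proof (rule ccontr)
      assume "\<not> e \<le> K"
      then have "hpart e F = 0"
        by (intro poly_mapping_eqI) (use K in \<open>force simp: lookup_hpart in_keys_iff\<close>)
      then show False using he by simp
    qed
    then have "coeff P e \<noteq> 0" using he by (simp add: P_def coeff_sum)
    then have "P \<noteq> 0" by auto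
    \<comment> \<open>The additional factor forces the nonroot \<open>t\<close> to be different from
      0.\<close>
    then have "P * monom 1 1 \<noteq> 0" by simp
    then obtain t where "poly (P * monom 1 1) t \<noteq> 0" using poly_all_0_iff_0 by blast
    then have t: "poly P t \<noteq> 0" "t \<noteq> 0" by (auto simp: poly_monom)
    have "smul t f \<in> S_piece n d" using f(1) by (auto simp: forms_def in_keys_iff lookup_smul)
    moreover have "eval_mpol u (dcoef (smul t f)) \<noteq> 0" using t(1) Pt Fu by simp
    ultimately obtain gs where gs: "length gs = s" "codim_one_decomposition n d (smul t f) gs"
      using u(3) by blast
    then show ?thesis using codim_one_decomposition_smul[OF gs(2) t(2)]
      by (intro exI[of _ "map (smul (1 / t)) gs"]) simp
  qed
  then show ?thesis unfolding generically_sufficient_def using op ne by blast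
qed

text \<open>A nonempty open set contains the nonvanishing locus of some nonzero form
  \<open>F\<close>. As \<open>F * G \<noteq> 0\<close>, this locus meets that of the relation
  \<open>G\<close>, which all sums satisfy.\<close>

lemma not_generically_sufficient_if_small:
  assumes n: "n \<ge> 1" and small: "n * s < (d - s + n) choose n"
  shows "\<not> generically_sufficient n d s"
proof
  assume "generically_sufficient n d s"
  then obtain U where U: "zariski_open n d U" "U \<noteq> {}"
    "\<And>f. f \<in> S_piece n d \<Longrightarrow> f \<noteq> 0 \<Longrightarrow> proj_point f \<in> U \<Longrightarrow>
      \<exists>gs. length gs = s \<and> codim_one_decomposition n d f gs"
    unfolding generically_sufficient_def by blast
  define M where "M = monomials {..n} d"
  have fM: "finite M" unfolding M_def by (intro finite_monomials) auto
  \<comment> \<open>For \<open>s > d\<close> the truncated difference makes the binomial equal to 1,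
    which does not exceed \<open>n * s\<close>.\<close>
  have "s \<le> d"
  proof (rule ccontr)
    assume "\<not> s \<le> d"
    then have "d - s = 0" "s \<ge> 1" by auto
    then show False using small n by simp
  qed
  from codim_one_sums_dependent[OF this small] obtain G where G: "G \<in> mpols M" "G \<noteq> 0"
    "\<And>f gs. length gs = s \<Longrightarrow> codim_one_decomposition n d f gs \<Longrightarrow> eval_mpol G (lookup f) = 0"
    unfolding M_def by blast
  from U(1) obtain \<F> where \<F>: "\<forall>F\<in>\<F>. \<exists>e. F \<in> forms M e" and
    Z: "proj_forms n d - U = {p \<in> proj_forms n d. \<forall>F\<in>\<F>. \<forall>f\<in>p. eval_mpol F (lookup f) = 0}"
    unfolding zariski_open_def zariski_closed_def M_def by blast
  obtain p where p: "p \<in> U" using U(2) by blast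
  then have "p \<in> proj_forms n d" "p \<notin> proj_forms n d - U" using U(1) by (auto simp: zariski_open_def)
  then obtain F f0 where F: "F \<in> \<F>" "eval_mpol F (lookup f0) \<noteq> 0" unfolding Z by blast
  then have "F * G \<noteq> 0" using G(2) by auto
  moreover have "F * G \<in> mpols M" using F(1) \<F> G(1) forms_mpols by (intro mpols_mult) blast+
  ultimately obtain x where x: "eval_mpol (F * G) x \<noteq> 0" using mpol_nonzero_eval fM by blast
  define f where "f = (\<Sum>b\<in>M. single b (x b))"
  have lf: "lookup f b = (if b \<in> M then x b else 0)" for b
    unfolding f_def by (rule single_sum_lookup[OF fM])
  have fS: "f \<in> S_piece n d" unfolding f_def M_def by (intro forms_sum forms_single)
  have Fm: "F \<in> mpols M" using F(1) \<F> forms_mpols by blast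
  have "eval_mpol F (lookup f) = eval_mpol F x" "eval_mpol G (lookup f) = eval_mpol G x"
    using lf by (auto intro!: eval_mpol_cong[OF Fm] eval_mpol_cong[OF G(1)])
  with x have nz: "eval_mpol F (lookup f) \<noteq> 0" "eval_mpol G (lookup f) \<noteq> 0" by auto
  \<comment> \<open>The zero form is a sum of \<open>s\<close> zero forms, each of codimension one,
    so \<open>G\<close> vanishes there.\<close>
  have "f \<noteq> 0"
  proof
    assume "f = 0"
    have "codim_one_form n d 0"
      using codim_one_form_of_coordinates[of 0 n "\<lambda>_. 1" "\<lambda>_. 0" d] by simp
    then have "codim_one_decomposition n d f (replicate s 0)"
      by (auto simp: codim_one_decomposition_def \<open>f = 0\<close> sum_list_replicate)
    then show False using G(3)[of "replicate s 0" f] nz by simp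
  qed
  moreover have "proj_point f \<in> U"
  proof (rule ccontr)
    assume "proj_point f \<notin> U"
    then have "proj_point f \<in> proj_forms n d - U" using proj_forms_iff[OF fS \<open>f \<noteq> 0\<close>] by blast
    then show False using F(1) nz(1) proj_point_self unfolding Z by blast
  qed
  ultimately obtain gs where "length gs = s" "codim_one_decomposition n d f gs"
    using U(3)[OF fS] by blast
  then show False using G(3) nz(2) by blast
qed

text \<open>As the number of summands decreases, \<open>n * s\<close> falls and the binomial does
  not, so failure at \<open>s - 1\<close> excludes every smaller number.\<close>

lemma s_min_eq:
  assumes n: "n \<ge> 1" and s: "s \<le> d" "s \<ge> 1" and large: "(d - s + n) choose n \<le> n * s"
    and small: "n * (s - 1) < (d - (s - 1) + n) choose n"
  shows "s_min n d = s"
  unfolding s_min_def generically_sufficient_def[symmetric]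
proof (rule Least_equality)
  show "generically_sufficient n d s"
    using assms by (intro generically_sufficient_if_large) auto
  fix s' assume s': "generically_sufficient n d s'"
  show "s \<le> s'"
  proof (rule ccontr)
    assume "\<not> s \<le> s'"
    then have "n * s' \<le> n * (s - 1)" "d - (s - 1) + n \<le> d - s' + n" by auto
    then have "n * s' < (d - s' + n) choose n"
      using small binomial_right_mono[of "d - (s - 1) + n" "d - s' + n" n] by linarith
    then show False using not_generically_sufficient_if_small[OF n] s' by blast
  qed
qed

text \<open>With \<open>d\<close> summands the binomial is 1, so the criterion holds; hence the
  minimum is attained, and an attained value cannot violate the criterion.\<close>

lemma s_min_large:
  assumes "n \<ge> 1" "d \<ge> 1"
  shows "(d - s_min n d + n) choose n \<le> n * s_min n d"
proof (rule ccontr)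
  assume "\<not> ?thesis"
  then have "\<not> generically_sufficient n d (s_min n d)"
    using assms by (intro not_generically_sufficient_if_small) auto
  moreover have "generically_sufficient n d d"
    using assms by (intro generically_sufficient_if_large) auto
  then have "generically_sufficient n d (s_min n d)"
    unfolding s_min_def generically_sufficient_def[symmetric] by (rule LeastI)
  ultimately show False by blast
qed

section \<open>Binomial inequalities separating the true number from the expected one\<close>

section \<open>Comparison with the expected value\<close>

lemma s_exp_eq_iff:
  assumes "n \<ge> 1" "s \<ge> 1"
  shows "s_exp n d = int s \<longleftrightarrow>
    (s - 1) * (n + ((d + n - 1) choose (n - 1))) < (d + n) choose n \<and>
    (d + n) choose n \<le> s * (n + ((d + n - 1) choose (n - 1)))"
proof -
  define A where "A = n + ((d + n - 1) choose (n - 1))"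
  define T where "T = (d + n) choose n"
  have A: "real A > 0" using assms by (simp add: A_def)
  have "s_exp n d = \<lceil>real T / real A\<rceil>" by (simp add: s_exp_def A_def T_def)
  also have "\<lceil>real T / real A\<rceil> = int s \<longleftrightarrow> real s - 1 < real T / real A \<and> real T / real A \<le> real s"
    by (simp add: ceiling_eq_iff)
  also have "\<dots> \<longleftrightarrow> (real s - 1) * real A < real T \<and> real T \<le> real s * real A"
    using A by (simp add: pos_less_divide_eq pos_divide_le_eq)
  also have "real s - 1 = real (s - 1)" using assms by (simp add: of_nat_diff)
  also have "real (s - 1) * real A < real T \<and> real T \<le> real s * real A \<longleftrightarrow> (s - 1) * A < T \<and> T \<le> s * A"
    by (metis of_nat_less_iff of_nat_le_iff of_nat_mult)
  finally show ?thesis by (simp add: A_def T_def)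
qed

lemma six_choose_three: "6 * ((m + 3) choose 3) = (m + 3) * (m + 2) * (m + (1::nat))"
proof -
  have "3 * ((m + 3) choose 3) = (m + 3) * ((m + 2) choose 2)"
    using Suc_times_binomial[of 2 "m + 2"] by (simp add: numeral_eq_Suc)
  moreover have "2 * ((m + 2) choose 2) = (m + 2) * (m + 1)"
    using Suc_times_binomial[of 1 "m + 1"] by (simp add: numeral_eq_Suc)
  moreover have "6 * ((m + 3) choose 3) = 2 * (3 * ((m + 3) choose 3))" by simp
  ultimately show ?thesis by (metis mult.assoc mult.left_commute)
qed

lemma two_choose_two: "2 * ((m + 2) choose 2) = (m + 2) * (m + (1::nat))"
  using Suc_times_binomial[of 1 "m + 1"] by (simp add: numeral_eq_Suc)

lemma quadratic_case:
  assumes "n \<ge> 2"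
  shows "s_exp n 2 = 2" "s_min n 2 = 2"
proof -
  have sym: "(2 + n) choose n = (n + 2) choose 2" "(2 + n - 1) choose (n - 1) = (n + 1) choose 2"
    using assms binomial_symmetric[of 2 "n + 2"] binomial_symmetric[of 2 "n + 1"]
    by (simp_all add: add.commute)
  have "2 * ((n + 2) choose 2) = (n + 2) * (n + 1)" "2 * ((n + 1) choose 2) = (n + 1) * n"
    using two_choose_two[of n] two_choose_two[of "n - 1"] assms by auto
  moreover have "n * n \<ge> 2 * n" using assms by simp
  ultimately have "n + ((n + 1) choose 2) < (n + 2) choose 2"
    "(n + 2) choose 2 \<le> 2 * (n + ((n + 1) choose 2))" using assms by (auto simp: algebra_simps)
  then show "s_exp n 2 = 2" using s_exp_eq_iff[of n 2 2] assms sym by simp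
  show "s_min n 2 = 2" using assms by (intro s_min_eq) auto
qed

lemma cubic_case:
  assumes "n \<ge> 2"
  shows "s_exp n 3 = 2" "s_min n 3 = 2"
proof -
  have sym: "(3 + n) choose n = (n + 3) choose 3" "(3 + n - 1) choose (n - 1) = (n + 2) choose 3"
    using assms binomial_symmetric[of 3 "n + 3"] binomial_symmetric[of 3 "n + 2"]
    by (simp_all add: add.commute)
  have "6 * ((n + 3) choose 3) = (n + 3) * (n + 2) * (n + 1)" "6 * ((n + 2) choose 3) = (n + 2) * (n + 1) * n"
    using six_choose_three[of n] six_choose_three[of "n - 1"] assms by auto
  moreover have "n * n \<ge> 2 * n" "n * (n * n) \<ge> 2 * (n * n)" using assms by auto
  ultimately have "n + ((n + 2) choose 3) < (n + 3) choose 3"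
    "(n + 3) choose 3 \<le> 2 * (n + ((n + 2) choose 3))" using assms by (auto simp: algebra_simps)
  then show "s_exp n 3 = 2" using s_exp_eq_iff[of n 2 3] assms sym by simp
  have "(n + 2) choose n = (n + 2) choose 2" using binomial_symmetric[of 2 "n + 2"] by simp
  moreover have "2 * ((n + 2) choose 2) = (n + 2) * (n + 1)" by (rule two_choose_two)
  ultimately have "n < (n + 2) choose n" by (auto simp: algebra_simps)
  then show "s_min n 3 = 2" using assms by (intro s_min_eq) (auto simp: add.commute)
qed

lemma plane_cases:
  "s_exp 2 4 = 3" "s_min 2 4 = 3" "s_exp 2 5 = 3" "s_min 2 5 = 3"
  "s_exp 2 6 = 4" "s_min 2 6 = 4" "s_exp 2 8 = 5" "s_min 2 8 = 5"
proof -
  show "s_exp 2 4 = 3" using s_exp_eq_iff[of 2 3 4] by (simp add: choose_two)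
  show "s_exp 2 5 = 3" using s_exp_eq_iff[of 2 3 5] by (simp add: choose_two)
  show "s_exp 2 6 = 4" using s_exp_eq_iff[of 2 4 6] by (simp add: choose_two)
  show "s_exp 2 8 = 5" using s_exp_eq_iff[of 2 5 8] by (simp add: choose_two)
  show "s_min 2 4 = 3" "s_min 2 5 = 3" "s_min 2 6 = 4" "s_min 2 8 = 5"
    by (rule s_min_eq; simp add: choose_two)+
qed

text \<open>The ceiling gives \<open>n * s < d + 2 * n\<close>, which is linear, whereas the
  binomial is at least quadratic in what remains of the degree. Only small cases require the finer
  estimates.\<close>

lemma expected_value_small:
  assumes n: "n \<ge> 2" and d: "d \<ge> 4" and ex: "\<not> (n = 2 \<and> d \<in> {4, 5, 6, 8})"
    and s: "s \<ge> 1" "s_exp n d = int s"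
  shows "n * s < (d - s + n) choose n"
proof -
  define B where "B = (d + n - 1) choose (n - 1)"
  have lt: "(s - 1) * (n + B) < (d + n) choose n"
    using s_exp_eq_iff[of n s d] n s by (simp add: B_def)
  have B: "B > 0" using n by (simp add: B_def)
  \<comment> \<open>Absorption relates the two binomials by the factor \<open>(d + n) / n\<close>;
    dropping the summand \<open>n\<close> from \<open>n + B\<close> then leaves
    \<open>n * (s - 1) < d + n\<close>.\<close>
  have "n * ((d + n) choose n) = (d + n) * B"
    using Suc_times_binomial[of "n - 1" "d + n - 1"] n by (simp add: B_def)
  then have "n * ((s - 1) * (n + B)) < (d + n) * B" using lt n by (metis mult_less_mono2 zero_less_numeral order_less_le_trans)
  moreover have "(n * k) * B \<le> n * (k * (n + B))" for k by (simp add: algebra_simps)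
  then have "(n * (s - 1)) * B \<le> n * ((s - 1) * (n + B))" .
  ultimately have "(n * (s - 1)) * B < (d + n) * B" by linarith
  then have "n * (s - 1) < d + n" using B by simp
  then have ns: "n * s < d + 2 * n" using s(1) by (cases s) auto
  show ?thesis
  proof (cases "n = 2")
    case True
    \<comment> \<open>In the plane the dropped summand matters: keeping it sharpens the bound to
      \<open>2 * (s - 1) \<le> d\<close>.\<close>
    have "B = d + 1" using True by (simp add: B_def)
    moreover have "2 * ((d + 2) choose 2) = (d + 2) * (d + 1)" by (rule two_choose_two)
    ultimately have "2 * (s - 1) * (d + 3) < d * (d + 3) + 2"
      using lt True by (simp add: algebra_simps)
    then have sd: "2 * (s - 1) \<le> d"
    proof -
      assume a: "2 * (s - 1) * (d + 3) < d * (d + 3) + 2"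
      show ?thesis
      proof (rule ccontr)
        assume "\<not> ?thesis"
        then have "(d + 1) * (d + 3) \<le> 2 * (s - 1) * (d + 3)" by (intro mult_right_mono) auto
        then show False using a by (simp add: algebra_simps)
      qed
    qed
    define m where "m = d - s"
    have dm: "d = m + s" using sd s d by (simp add: m_def)
    have "2 * ((m + 2) choose 2) = (m + 2) * (m + 1)" by (rule two_choose_two)
    moreover have "4 * s < (m + 2) * (m + 1)"
    proof (cases "m \<ge> 4")
      case True
      have "s \<le> m + 2" using sd dm by linarith
      moreover have "4 * m \<le> m * m" using True by simp
      moreover have "(m + 2) * (m + 1) = m * m + 3 * m + 2" by (simp add: algebra_simps)
      ultimately show ?thesis using True by linarith
    next
      case False
      \<comment> \<open>Here \<open>s \<le> m + 2\<close> and \<open>m \<le> 3\<close> give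
        \<open>d \<le> 8\<close>; of the degrees from 4 to 8 only 7 is not excluded.\<close>
      then have "m = 3 \<and> s \<le> 4" using sd dm d ex \<open>n = 2\<close> by auto
      then show ?thesis by auto
    qed
    ultimately have "2 * s < (m + 2) choose 2" by linarith
    then show ?thesis using True by (simp add: m_def)
  next
    case False
    then have n3: "n \<ge> 3" using n by simp
    show ?thesis
    \<comment> \<open>For this pair alone the linear bound on \<open>n * s\<close> fails to yield
      \<open>s + 2 \<le> d\<close>.\<close>
    proof (cases "n = 3 \<and> d = 4")
      case True
      then have "B = 15" "(d + n) choose n = 35" by (simp_all add: B_def numeral_eq_Suc)
      then have "(s - 1) * 18 < 35" using lt True by simp
      then have "s = 1 \<or> s = 2" using s(1) by auto
      then show ?thesis using True by (auto simp: numeral_eq_Suc)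
    next
      case F: False
      have sd: "s + 2 \<le> d"
      proof (rule ccontr)
        assume "\<not> ?thesis"
        then have "n * (d - 1) \<le> n * s" by (intro mult_left_mono) auto
        then have *: "n * (d - 1) < d + 2 * n" using ns by linarith
        obtain n' where n': "n = n' + 3" using n3 by (metis add.commute le_Suc_ex)
        obtain d' where d': "d = d' + 4" using d by (metis add.commute le_Suc_ex)
        from * have "n' * d' + n' + 2 * d' < 1" unfolding n' d' by (simp add: algebra_simps)
        then show False using F n' d' by simp
      qed
      define m where "m = d - s - 2"
      have dm: "d = m + 2 + s" using sd by (simp add: m_def)
      \<comment> \<open>Linear growth suffices: the value at \<open>m = 0\<close> is
        \<open>(n + 2) choose 2\<close>, and each further step adds at least \<open>n\<close>, hence
        at least 3.\<close>
      have bin: "(n + 1) * (n + 2) + 6 * m \<le> 2 * ((m + 2 + n) choose n)"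
      proof (induction m)
        case 0
        have "(2 + n) choose n = (n + 2) choose 2"
          using binomial_symmetric[of 2 "n + 2"] by (simp add: add.commute)
        then show ?case using two_choose_two[of n] by (simp add: algebra_simps)
      next
        case (Suc m)
        have "Suc m + 2 + n = Suc (m + 2 + n)" "n = Suc (n - 1)" using n3 by auto
        then have "(Suc m + 2 + n) choose n = ((m + 2 + n) choose (n - 1)) + ((m + 2 + n) choose n)"
          by (metis binomial_Suc_Suc)
        moreover have "(m + 2 + n) choose (n - 1) \<ge> n"
        proof -
          have "n choose (n - 1) \<le> (m + 2 + n) choose (n - 1)" by (rule binomial_right_mono) auto
          moreover have "n choose (n - 1) = n" using binomial_symmetric[of "n - 1" n] n3 by simp
          ultimately show ?thesis by simp
        qed
        ultimately show ?case using Suc n3 by simp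
      qed
      have "(n - 1) * s < m + 2 + 2 * n"
        using ns dm n3 by (cases n) auto
      moreover have "2 * s \<le> (n - 1) * s" using n3 by (intro mult_right_mono) auto
      ultimately have "2 * s < m + 2 + 2 * n" by (rule order.strict_trans1[rotated])
      moreover have "n * s < m + 2 + 2 * n + s" using ns dm by simp
      ultimately have s2: "2 * s < m + 2 + 2 * n" "n * s < m + 2 + 2 * n + s" by blast+
      have "2 * (n * s) < 2 * ((m + 2 + n) choose n)"
      proof (cases "n = 3")
        case True
        then show ?thesis using s2 bin by (cases "m = 0") (auto simp: algebra_simps)
      next
        case False
        then have "4 * n \<le> n * n" using n3 by simp
        moreover have "(n + 1) * (n + 2) = n * n + 3 * n + 2" by (simp add: algebra_simps)
        ultimately show ?thesis using s2 bin n3 by linarith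
      qed
      then show ?thesis by (simp add: dm)
    qed
  qed
qed

theorem corollary2p16:
  fixes n d :: nat
  assumes "n \<ge> 2" and "d \<ge> 2"
  shows "int (s_min n d) = s_exp n d \<longleftrightarrow>
    d = 2 \<or> d = 3 \<or> (d \<in> {4, 5, 6, 8} \<and> n = 2)"
proof
  assume eq: "int (s_min n d) = s_exp n d"
  show "d = 2 \<or> d = 3 \<or> (d \<in> {4, 5, 6, 8} \<and> n = 2)"
  proof (rule ccontr)
    assume *: "\<not> ?thesis"
    \<comment> \<open>The contradiction is numerical: the true minimum passes the criterion, while
      outside the listed cases the expected number fails it.\<close>
    have large: "(d - s_min n d + n) choose n \<le> n * s_min n d"
      using assms by (intro s_min_large) auto
    moreover have "0 < (d - s_min n d + n) choose n" by simp
    ultimately have "s_min n d \<ge> 1" by (metis Suc_eq_plus1 le_zero_eq mult_0_right not_less_eq_eq not_gr0 One_nat_def)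
    then have "n * s_min n d < (d - s_min n d + n) choose n"
      using assms * eq by (intro expected_value_small) auto
    then show False using large by simp
  qed
next
  assume "d = 2 \<or> d = 3 \<or> (d \<in> {4, 5, 6, 8} \<and> n = 2)"
  then show "int (s_min n d) = s_exp n d"
    using quadratic_case cubic_case plane_cases assms(1) by auto
qed

end
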